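(* Let $\lambda>0$ and let $H:T^*\mathbb{T}^n\to\mathbb{R}$ be a $C^r$ ($r\geq 2$) Tonelli Hamiltonian. A KAM torus of the conformally symplectic system generated by $H$ and $\lambda$ keeps to be (that is, persists as an invariant) $C^1$ Lagrangian graph under small perturbations of the system.
   Context: $\mathbb{T}^n=\mathbb{R}^n/\mathbb{Z}^n$ and $T^*\mathbb{T}^n=\mathbb{T}^n\times\mathbb{R}^n$ with coordinates $(x,p)$. A Hamiltonian $H$ is Tonelli if $H_{pp}(x,p)$ is positive definite for every $(x,p)$ and $\lim_{|p|\to+\infty}H(x,p)/|p|=+\infty$ for every $x$. The conformally symplectic system generated by $H$ and $\lambda$ is $$\dot x=H_p(x,p),\qquad \dot p=-H_x(x,p)-\lambda p ,$$ with flow $\Phi^t_{H,\lambda}$. KAM torus: a homologically nontrivial, $C^1$-graphic (i.e. the graph of a $C^1$ map $\mathbb{T}^n\to\mathbb{R}^n$), $\Phi^t_{H,\lambda}$-invariant set on which the dynamics is conjugate to the rotation of frequency $\omega$ for some $\omega\in\mathbb{R}^n$. That is, there is a $C^1$ embedding $K:\mathbb{T}^n\to T^*\mathbb{T}^n$, $K(x)=(\zeta(x),\eta(x))$, with (for lifts to $\mathbb{R}^n$) $\zeta(x+m)=\zeta(x)+m$, $\eta(x+m)=\eta(x)$ for all $m\in\mathbb{Z}^n$, such that $\Phi^t_{H,\lambda}(K(x))=K(x+\omega t)$ for all $x\in\mathbb{T}^n$, $t\in\mathbb{R}$, and the torus is $K(\mathbb{T}^n)$. Small perturbation: the Hamiltonian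 $H$ is replaced by a Tonelli Hamiltonian $H_\epsilon=H+\epsilon H_1$ with $0<\epsilon\leq\epsilon_0(H)$ and $\epsilon_0(H)$ sufficiently small, $\lambda$ being unchanged; invariance of the perturbed graph is with respect to $\Phi^t_{H_\epsilon,\lambda}$, and the dynamics on it need no longer be conjugate to a rotation. A $C^1$ graph $\Sigma=\{(x,P(x)):x\in\mathbb{T}^n\}$ is Lagrangian if the symplectic form $\sum_i dp_i\wedge dx_i$ vanishes on $T\Sigma$. *)

theory Defs
  imports "HOL-Analysis.Analysis"
begin

text \<open>
  Everything on the torus is written on its universal cover: functions on the torus are
  functions on \<open>real ^ 'n\<close> periodic under integer vectors, and subsets of the cotangent bundle of
  the torus are represented by their preimages in \<open>(real ^ 'n) \<times> (real ^ 'n)\<close>.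
\<close>

definition int_vec :: "real ^ 'n \<Rightarrow> bool" where
  "int_vec m \<longleftrightarrow> (\<forall>i. m $ i \<in> \<int>)"

text \<open>
  Class \<open>C\<^sup>k\<close> on the whole space; in finite dimension, continuity of all iterated directional
  derivatives agrees with continuity of the iterated Frechet derivatives.
\<close>

primrec C_class :: "nat \<Rightarrow> ('a::euclidean_space \<Rightarrow> 'b::real_normed_vector) \<Rightarrow> bool" where
  "C_class 0 f \<longleftrightarrow> continuous_on UNIV f"
| "C_class (Suc k) f \<longleftrightarrow>
     (\<forall>z. f differentiable at z) \<and> (\<forall>v. C_class k (\<lambda>z. frechet_derivative f (at z) v))"

text \<open>The \<open>C\<^sup>2\<close> norm of \<open>f\<close> over \<open>S\<close> (with operator norms of the derivatives) is at most \<open>B\<close>.\<close>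

definition C2_norm_le :: "('a::euclidean_space \<Rightarrow> real) \<Rightarrow> 'a set \<Rightarrow> real \<Rightarrow> bool" where
  "C2_norm_le f S B \<longleftrightarrow> (\<forall>z\<in>S.
     \<bar>f z\<bar> \<le> B \<and>
     (\<forall>v. \<bar>frechet_derivative f (at z) v\<bar> \<le> B * norm v) \<and>
     (\<forall>v w. \<bar>frechet_derivative (\<lambda>y. frechet_derivative f (at y) v) (at z) w\<bar>
              \<le> B * norm v * norm w))"

definition hamiltonian :: "nat \<Rightarrow> ((real ^ 'n) \<times> (real ^ 'n) \<Rightarrow> real) \<Rightarrow> bool" where
  "hamiltonian r H \<longleftrightarrow>
     C_class r H \<and> (\<forall>x p m. int_vec m \<longrightarrow> H (x + m, p) = H (x, p))"

definition H_x :: "((real ^ 'n) \<times> (real ^ 'n) \<Rightarrow> real) \<Rightarrow> (real ^ 'n) \<times> (real ^ 'n) \<Rightarrow> real ^ 'n" where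
  "H_x H z = (\<chi> i. frechet_derivative H (at z) (axis i 1, 0))"

definition H_p :: "((real ^ 'n) \<times> (real ^ 'n) \<Rightarrow> real) \<Rightarrow> (real ^ 'n) \<times> (real ^ 'n) \<Rightarrow> real ^ 'n" where
  "H_p H z = (\<chi> i. frechet_derivative H (at z) (0, axis i 1))"

definition H_pp :: "((real ^ 'n) \<times> (real ^ 'n) \<Rightarrow> real) \<Rightarrow> (real ^ 'n) \<times> (real ^ 'n) \<Rightarrow> real ^ 'n ^ 'n" where
  "H_pp H z = (\<chi> i j. frechet_derivative (\<lambda>y. H_p H y $ i) (at z) (0, axis j 1))"

definition tonelli :: "((real ^ 'n) \<times> (real ^ 'n) \<Rightarrow> real) \<Rightarrow> bool" where
  "tonelli H \<longleftrightarrow>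
     (\<forall>z v. v \<noteq> 0 \<longrightarrow> v \<bullet> (H_pp H z *v v) > 0) \<and>
     (\<forall>x. filterlim (\<lambda>p. H (x, p) / norm p) at_top at_infinity)"

definition cs_field ::
  "((real ^ 'n) \<times> (real ^ 'n) \<Rightarrow> real) \<Rightarrow> real \<Rightarrow>
    (real ^ 'n) \<times> (real ^ 'n) \<Rightarrow> (real ^ 'n) \<times> (real ^ 'n)" where
  "cs_field H lam z = (H_p H z, - H_x H z - lam *\<^sub>R snd z)"

text \<open>
  \<open>cs_flow H lam t z w\<close> means that the time-\<open>t\<close> flow map is defined at \<open>z\<close> and sends it to \<open>w\<close>.
  The flow is a relation because solutions through points off the tori considered need not exist
  for all (negative) times; for \<open>H\<close> of class \<open>C\<^sup>2\<close> the field is \<open>C\<^sup>1\<close>, so \<open>w\<close> is unique.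
\<close>

definition cs_flow ::
  "((real ^ 'n) \<times> (real ^ 'n) \<Rightarrow> real) \<Rightarrow> real \<Rightarrow> real \<Rightarrow>
    (real ^ 'n) \<times> (real ^ 'n) \<Rightarrow> (real ^ 'n) \<times> (real ^ 'n) \<Rightarrow> bool" where
  "cs_flow H lam t z w \<longleftrightarrow> (\<exists>c. c 0 = z \<and> c t = w \<and>
     (\<forall>s\<in>closed_segment 0 t.
        (c has_vector_derivative cs_field H lam (c s)) (at s within closed_segment 0 t)))"

text \<open>
  As \<open>t\<close> ranges over both signs, this inclusion gives equality of the set with its image under
  each flow map.
\<close>

definition cs_invariant ::
  "((real ^ 'n) \<times> (real ^ 'n) \<Rightarrow> real) \<Rightarrow> real \<Rightarrow> ((real ^ 'n) \<times> (real ^ 'n)) set \<Rightarrow> bool" where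
  "cs_invariant H lam S \<longleftrightarrow> (\<forall>z\<in>S. \<forall>t. \<exists>w\<in>S. cs_flow H lam t z w)"

definition graph_of :: "(real ^ 'n \<Rightarrow> real ^ 'n) \<Rightarrow> ((real ^ 'n) \<times> (real ^ 'n)) set" where
  "graph_of P = range (\<lambda>x. (x, P x))"

definition C1_torus_map :: "(real ^ 'n \<Rightarrow> real ^ 'n) \<Rightarrow> bool" where
  "C1_torus_map P \<longleftrightarrow> C_class 1 P \<and> (\<forall>x m. int_vec m \<longrightarrow> P (x + m) = P x)"

text \<open>The form \<open>\<Sum>i. dp\<^sub>i \<and> dx\<^sub>i\<close> on tangent vectors written as pairs (x-part, p-part).\<close>

definition symp_form :: "(real ^ 'n) \<times> (real ^ 'n) \<Rightarrow> (real ^ 'n) \<times> (real ^ 'n) \<Rightarrow> real" where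
  "symp_form a b = (\<Sum>i\<in>UNIV. snd a $ i * fst b $ i - fst a $ i * snd b $ i)"

text \<open>The tangent space of the graph at \<open>(x, P x)\<close> consists of the vectors \<open>(v, DP(x) v)\<close>.\<close>

definition lagrangian_graph :: "(real ^ 'n \<Rightarrow> real ^ 'n) \<Rightarrow> bool" where
  "lagrangian_graph P \<longleftrightarrow> (\<forall>x v w.
     symp_form (v, frechet_derivative P (at x) v) (w, frechet_derivative P (at x) w) = 0)"

text \<open>
  Lift of a \<open>C\<^sup>1\<close> embedding of the torus into its cotangent bundle that is homotopic to the zero
  section. By compactness of the torus, an injective immersion is an embedding.
\<close>

definition C1_torus_embedding ::
  "(real ^ 'n \<Rightarrow> real ^ 'n) \<Rightarrow> (real ^ 'n \<Rightarrow> real ^ 'n) \<Rightarrow> bool" where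
  "C1_torus_embedding zeta eta \<longleftrightarrow>
     C_class 1 zeta \<and> C_class 1 eta \<and>
     (\<forall>x m. int_vec m \<longrightarrow> zeta (x + m) = zeta x + m \<and> eta (x + m) = eta x) \<and>
     (\<forall>x. inj (\<lambda>v. (frechet_derivative zeta (at x) v, frechet_derivative eta (at x) v))) \<and>
     (\<forall>x y. int_vec (zeta x - zeta y) \<and> eta x = eta y \<longrightarrow> int_vec (x - y))"

text \<open>
  The KAM torus of frequency \<open>omega\<close> is \<open>graph_of P\<close>. Its homological nontriviality is part of
  being a graph over the torus.
\<close>

definition kam_torus ::
  "((real ^ 'n) \<times> (real ^ 'n) \<Rightarrow> real) \<Rightarrow> real \<Rightarrow> real ^ 'n \<Rightarrow> (real ^ 'n \<Rightarrow> real ^ 'n) \<Rightarrow> bool" where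
  "kam_torus H lam omega P \<longleftrightarrow>
     C1_torus_map P \<and> cs_invariant H lam (graph_of P) \<and>
     (\<exists>zeta eta. C1_torus_embedding zeta eta \<and>
        range (\<lambda>x. (zeta x, eta x)) = graph_of P \<and>
        (\<forall>x t. cs_flow H lam t (zeta x, eta x)
                 (zeta (x + t *\<^sub>R omega), eta (x + t *\<^sub>R omega))))"

end

theory Submission
  imports Defs
begin

text \<open>
  The torus is a normally attracting invariant manifold, and this is why it persists as a \<open>C\<^sup>1\<close> graph. Its
  normal contraction is forced by the geometry. The flow multiplies the symplectic form by
  \<open>exp (- lam * t)\<close>, while on the torus it is conjugate to a rotation, so that its derivative is bounded on
  tangent vectors for all times. Hence the form vanishes on the torus (\<open>P_symmetric\<close>), and pairing tangent with
  transversal vectors shows that the normal part of the derivative is at most a constant times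
  \<open>exp (- lam * t)\<close> (\<open>torus_linearization\<close>).

  Use the coordinates \<open>x = zeta q\<close>, \<open>p = P (zeta q) + c *\<^sub>R b\<close>. Here \<open>zeta\<close> and \<open>P\<close> are only \<open>C\<^sup>1\<close>, which would
  be too little to transform the vector field but is enough for its time \<open>T\<close> map. For \<open>T\<close> large and \<open>c\<close> small this map has
  on the torus a derivative close to \<open>(v, w) \<mapsto> (v, 0)\<close>. On a thin strip around the torus the same holds for perturbed
  systems, because \<open>C\<^sup>1\<close>-close fields have \<open>C\<^sup>1\<close>-close flows (\<open>flow_perturbation\<close>).

  For such a map, the points with a backward orbit in the strip form a graph: over each \<open>q\<close> there is exactly one
  backward orbit that grows at most like \<open>2 ^ k\<close>, as the fixed point of a contraction on weighted sequences
  (\<open>backward_orbit_exists\<close>). With the larger weight \<open>3 ^ k\<close> this orbit is differentiable in \<open>q\<close>, with continuous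
  derivative (\<open>orbit_derivative\<close>, \<open>tangent_orbit_continuous\<close>). This description of the graph by backward orbits yields the
  remaining claims. The flow commutes with its time \<open>T\<close> map, so it moves backward orbits to backward orbits and leaves the
  graph invariant (\<open>range_E_invariant\<close>). Tangent vectors of the graph grow at most like \<open>2 ^ k\<close> into the past while the
  symplectic form contracts by \<open>exp (- lam * T)\<close> per step, less than \<open>1 / 4\<close>; so the form vanishes on the
  graph (\<open>E_tangent_isotropic\<close>).

  Solutions off the torus may cease to exist and the perturbation is small only for \<open>norm p \<le> R\<close>. Therefore the fields are
  multiplied by a cut-off in \<open>p\<close> that is 1 near the torus. The graphs obtained lie where the cut-off is 1, and there
  the modified and the original systems agree.
\<close>

section \<open>Backward orbits\<close>

text \<open>
  The estimate behind every statement on backward orbits: uniqueness, Lipschitz dependence,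
  differentiability and continuity of the derivative all bound the difference of two sequences.
  The first component is controlled from its predecessor, the second from its successor, so in the
  norm \<open>sup\<^sub>k d k / w ^ k\<close> the three terms of the recursion have weights \<open>1 / w\<close>, \<open>1 / 16\<close> and \<open>w / 16\<close>.
  For \<open>w\<close> between 2 and 3 they add up to at most \<open>11 / 16\<close>, and the recursion can be absorbed.
  Two weights are needed because the errors of a linearization along an orbit that grows like \<open>2 ^ k\<close>
  are small only relative to \<open>3 ^ k\<close>.
\<close>

lemma weighted_sequence_bound:
  fixes a b d :: "nat \<Rightarrow> real" and w e C :: real
  assumes w: "2 \<le> w" "w \<le> 3" and e: "0 \<le> e"
    and nonneg: "\<And>k. 0 \<le> a k" "\<And>k. 0 \<le> b k" and d: "\<And>k. d k \<le> a k + b k"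
    and a0: "a 0 \<le> e"
    and aS: "\<And>k. a (Suc k) \<le> a k + d (Suc k) / 16 + e * w ^ Suc k"
    and bS: "\<And>k. b k \<le> d (Suc k) / 16 + e * w ^ k"
    and growth: "\<And>k. a k + b k \<le> C * w ^ k"
  shows "a k + b k \<le> 8 * e * w ^ k"
proof -
  define m where "m k = (a k + b k) / w ^ k" for k
  define M where "M = (SUP k. m k)"
  have wpos: "w ^ k > 0" for k using w by simp
  have ab: "a k + b k = m k * w ^ k" for k
    using wpos[of k] w by (simp add: m_def)
  have bdd: "bdd_above (range m)"
    by (rule bdd_aboveI[of _ C]) (use growth wpos in \<open>auto simp: m_def divide_le_eq\<close>)
  have mM: "m k \<le> M" for k unfolding M_def by (rule cSUP_upper[OF _ bdd]) simp
  have m0: "0 \<le> m k" for k using nonneg wpos[of k] by (simp add: m_def)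
  have M0: "0 \<le> M" using m0[of 0] mM[of 0] by linarith
  have abM: "a k + b k \<le> M * w ^ k" for k
    using mM[of k] wpos[of k] by (simp add: ab)
  have coeff: "1 / w + 1 / 16 + w / 16 \<le> 11 / 16"
  proof -
    have "(w - 2) * (w - 8) \<le> 0" using w by (intro mult_nonneg_nonpos) auto
    then have "16 + w + w * w \<le> 11 * w" by (simp add: algebra_simps)
    then show ?thesis using w by (simp add: field_simps)
  qed
  have step: "m k \<le> 11 / 16 * M + 2 * e" for k
  proof -
    have b: "b k \<le> (w / 16 * M + e) * w ^ k"
      using bS[of k] d[of "Suc k"] abM[of "Suc k"] by (simp add: algebra_simps)
    have a: "a k \<le> ((1 / w + 1 / 16) * M + e) * w ^ k"
    proof (cases k)
      case 0
      have "0 \<le> (1 / w + 1 / 16) * M" using M0 w by simp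
      then show ?thesis using a0 0 by simp
    next
      case (Suc j)
      have "a k \<le> M * w ^ j + M * w ^ Suc j / 16 + e * w ^ Suc j"
        using aS[of j] nonneg(2)[of j] d[of "Suc j"] abM[of j] abM[of "Suc j"] Suc
        by (simp add: algebra_simps)
      also have "\<dots> = ((1 / w + 1 / 16) * M + e) * w ^ k"
        using w Suc by (simp add: field_simps)
      finally show ?thesis .
    qed
    have "a k + b k \<le> ((1 / w + 1 / 16 + w / 16) * M + 2 * e) * w ^ k"
      using a b by (simp add: algebra_simps)
    then have "m k \<le> (1 / w + 1 / 16 + w / 16) * M + 2 * e"
      using wpos[of k] by (simp add: m_def divide_le_eq)
    also have "\<dots> \<le> 11 / 16 * M + 2 * e"
      using coeff M0 by (intro add_right_mono mult_right_mono)
    finally show ?thesis .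
  qed
  have "M \<le> 11 / 16 * M + 2 * e" unfolding M_def by (rule cSUP_least) (use step in \<open>auto simp: M_def\<close>)
  then have "M \<le> 8 * e" using e by linarith
  then have "M * w ^ k \<le> 8 * e * w ^ k" using wpos[of k] by (intro mult_right_mono) auto
  then show ?thesis using abM[of k] by linarith
qed

text \<open>
  Index \<open>k\<close> counts steps into the past. The growth bound replaces the missing boundary condition at
  \<open>k = \<infinity>\<close> and makes the sequence unique. The maps depend on \<open>k\<close> so that the same existence
  result yields the derivative of an orbit, which solves a linear recursion along it.
\<close>

definition backward_orbit ::
  "(nat \<Rightarrow> 'a \<times> 'b \<Rightarrow> 'a::real_normed_vector) \<Rightarrow> (nat \<Rightarrow> 'a \<times> 'b \<Rightarrow> 'b::real_normed_vector) \<Rightarrow>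
    'b set \<Rightarrow> 'a \<Rightarrow> (nat \<Rightarrow> 'a \<times> 'b) \<Rightarrow> bool" where
  "backward_orbit f g S q z \<longleftrightarrow> fst (z 0) = q \<and>
     (\<forall>k. fst (z k) = fst (z (Suc k)) + f k (z (Suc k)) \<and> snd (z k) = g k (z (Suc k)) \<and> snd (z k) \<in> S) \<and>
     (\<exists>C. \<forall>k. norm (z k) \<le> C * 2 ^ k)"

lemma norm_prod_le: "norm (x :: 'a::real_normed_vector \<times> 'b::real_normed_vector) \<le> norm (fst x) + norm (snd x)"
  by (metis norm_Pair_le prod.collapse)

lemma norm_fst_le': "norm (fst x) \<le> norm x" by (metis norm_fst_le prod.collapse)
lemma norm_snd_le': "norm (snd x) \<le> norm x" by (metis norm_snd_le prod.collapse)

text \<open>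
  Bounded sequences are bounded continuous functions on the discrete space of natural numbers.
\<close>

lemma complete_bounded_sequences: "complete (UNIV :: (nat \<Rightarrow>\<^sub>C 'b::complete_space) set)"
proof (rule completeI)
  fix u :: "nat \<Rightarrow> (nat \<Rightarrow>\<^sub>C 'b)"
  assume "Cauchy u"
  then have "uniformly_Cauchy_on UNIV (\<lambda>n. apply_bcontfun (u n))"
    unfolding uniformly_Cauchy_on_def by (metis metric_CauchyD dist_fun_lt_imp_dist_val_lt)
  then obtain l where "uniform_limit UNIV (\<lambda>n. apply_bcontfun (u n)) l sequentially"
    using Cauchy_uniformly_convergent uniformly_convergent_on_def by blast
  then obtain l' where "u \<longlonglongrightarrow> l'"
    by (rule uniform_limit_bcontfunE) simp
  then show "\<exists>l\<in>UNIV. u \<longlonglongrightarrow> l" by blast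
qed

text \<open>
  The sequence is the fixed point of a contraction with factor \<open>11 / 16\<close>. The operator computes the
  first component from the more recent term, where no contraction of the map is available but the weight gains
  a factor 2, and the second component from the older term, where the weight loses a factor 2 but the map
  contracts by 16.
\<close>

lemma backward_orbit_exists:
  fixes f :: "nat \<Rightarrow> 'a::banach \<times> 'b::banach \<Rightarrow> 'a" and g :: "nat \<Rightarrow> 'a \<times> 'b \<Rightarrow> 'b"
  assumes S: "closed S" "0 \<in> S"
    and f: "\<And>k x y. snd x \<in> S \<Longrightarrow> snd y \<in> S \<Longrightarrow> norm (f k x - f k y) \<le> norm (x - y) / 16"
    and g: "\<And>k x y. snd x \<in> S \<Longrightarrow> snd y \<in> S \<Longrightarrow> norm (g k x - g k y) \<le> norm (x - y) / 16"
    and gS: "\<And>k x. snd x \<in> S \<Longrightarrow> g k x \<in> S"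
    and f0: "\<And>k. norm (f k 0) \<le> C" and g0: "\<And>k. norm (g k 0) \<le> C"
  shows "\<exists>z. backward_orbit f g S q z"
proof -
  define Z where "Z w k = 2 ^ k *\<^sub>R apply_bcontfun w k" for w :: "nat \<Rightarrow>\<^sub>C ('a \<times> 'b)" and k
  define D where "D = {w. \<forall>k. snd (Z w k) \<in> S}"
  define t where "t w k = (1 / 2 ^ k) *\<^sub>R
      ((case k of 0 \<Rightarrow> q | Suc j \<Rightarrow> fst (Z w j) - f j (Z w k)), g k (Z w (Suc k)))" for w k
  define T where "T w = Bcontfun (t w)" for w
  have D: "w \<in> D \<longleftrightarrow> (\<forall>k. snd (Z w k) \<in> S)" for w
    by (simp add: D_def)
  have Zn: "norm (Z w k) \<le> 2 ^ k * norm w" for w k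
    using norm_bounded[of w k] by (simp add: Z_def)
  have Zd: "norm (Z w k - Z v k) \<le> 2 ^ k * dist w v" for w v k
    using dist_bounded[of w k v] by (simp add: Z_def dist_norm flip: scaleR_diff_right)
  have "complete D"
  proof -
    have "closed D" unfolding closed_sequential_limits
    proof (intro allI impI, elim conjE)
      fix u l assume u: "\<forall>n. u n \<in> D" and lim: "u \<longlonglongrightarrow> l"
      have "(\<lambda>n. Z (u n) k) \<longlonglongrightarrow> Z l k" for k unfolding Z_def
        using tendsto_uniform_limitI[OF tendsto_bcontfun_uniform_limit[OF lim], of k]
        by (intro tendsto_intros) auto
      then have "(\<lambda>n. snd (Z (u n) k)) \<longlonglongrightarrow> snd (Z l k)" for k by (intro tendsto_snd)
      then have "snd (Z l k) \<in> S" for k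
        by (rule closed_sequentially[OF S(1), rotated]) (use u in \<open>auto simp: D\<close>)
      then show "l \<in> D" by (simp add: D)
    qed
    then show ?thesis using complete_closed_subset[OF _ _ complete_bounded_sequences] by blast
  qed
  have lipf: "norm (f k x) \<le> C + norm x / 16" if "snd x \<in> S" for k x
    using f[OF that, of 0 k] f0[of k] S(2) norm_triangle_ineq2[of "f k x" "f k 0"] by simp
  have lipg: "norm (g k x) \<le> C + norm x / 16" if "snd x \<in> S" for k x
    using g[OF that, of 0 k] g0[of k] S(2) norm_triangle_ineq2[of "g k x" "g k 0"] by simp
  have C0: "C \<ge> 0" using f0[of 0] norm_ge_zero order_trans by blast
  have tb: "t w \<in> bcontfun" if w: "w \<in> D" for w
  proof (rule bcontfun_normI)
    fix k :: nat
    have "norm (case k of 0 \<Rightarrow> q | Suc j \<Rightarrow> fst (Z w j) - f j (Z w k)) \<le> 2 ^ k * (norm q + 2 * norm w + C)"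
    proof (cases k)
      case 0 then show ?thesis using C0 by simp
    next
      case (Suc j)
      have "norm (fst (Z w j) - f j (Z w k)) \<le> norm (Z w j) + (C + norm (Z w k) / 16)"
        using norm_triangle_ineq4[of "fst (Z w j)" "f j (Z w k)"] norm_fst_le'[of "Z w j"]
          lipf[of "Z w k" j] w by (auto simp: D)
      also have "\<dots> \<le> 2 ^ j * norm w + C + 2 ^ k * norm w"
        using Zn[of w j] Zn[of w k] norm_ge_zero[of "Z w k"] by linarith
      also have "\<dots> \<le> 2 ^ k * (norm q + 2 * norm w + C)"
      proof -
        have "1 * C \<le> 2 ^ k * C" using C0 by (intro mult_right_mono) auto
        moreover have "2 ^ j * norm w \<le> 2 ^ k * norm w" using Suc by (intro mult_right_mono) auto
        moreover have "0 \<le> 2 ^ k * norm q" by simp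
        ultimately show ?thesis unfolding distrib_left by linarith
      qed
      finally show ?thesis using Suc by simp
    qed
    moreover have "norm (g k (Z w (Suc k))) \<le> 2 ^ k * (2 * norm w + C)"
    proof -
      have "1 * C \<le> 2 ^ k * C" using C0 by (intro mult_right_mono) auto
      moreover have "0 \<le> 2 ^ k * norm w" by simp
      moreover have "norm (g k (Z w (Suc k))) \<le> C + norm (Z w (Suc k)) / 16" using lipg w by (simp add: D)
      moreover have "norm (Z w (Suc k)) \<le> 2 * (2 ^ k * norm w)" using Zn[of w "Suc k"] by simp
      ultimately show ?thesis unfolding distrib_left by linarith
    qed
    ultimately have "norm ((case k of 0 \<Rightarrow> q | Suc j \<Rightarrow> fst (Z w j) - f j (Z w k)), g k (Z w (Suc k)))
        \<le> 2 ^ k * (norm q + 4 * norm w + 2 * C)"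
      by (intro order_trans[OF norm_Pair_le]) (simp add: algebra_simps)
    then show "norm (t w k) \<le> norm q + 4 * norm w + 2 * C"
      by (simp add: t_def divide_le_eq mult.commute del: scaleR_Pair)
  qed simp
  have apT: "apply_bcontfun (T w) = t w" if "w \<in> D" for w
    unfolding T_def by (rule Bcontfun_inverse[OF tb[OF that]])
  have ZT: "Z (T w) k = ((case k of 0 \<Rightarrow> q | Suc j \<Rightarrow> fst (Z w j) - f j (Z w k)), g k (Z w (Suc k)))"
    if "w \<in> D" for w k
    unfolding Z_def[of "T w"] apT[OF that] by (simp add: t_def)
  have TD: "T w \<in> D" if "w \<in> D" for w
    unfolding D using ZT[OF that] gS that by (auto simp: D)
  have contr: "dist (T w) (T v) \<le> 11 / 16 * dist w v" if w: "w \<in> D" and v: "v \<in> D" for w v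
  proof (rule dist_bound)
    fix k :: nat
    let ?d = "dist w v"
    let ?P = "\<lambda>w. (case k of 0 \<Rightarrow> q | Suc j \<Rightarrow> fst (Z w j) - f j (Z w k))"
    have "norm (?P w - ?P v) \<le> 2 ^ k * (9 / 16 * ?d)"
    proof (cases k)
      case 0 then show ?thesis by simp
    next
      case (Suc j)
      have "norm (?P w - ?P v) = norm ((fst (Z w j) - fst (Z v j)) - (f j (Z w k) - f j (Z v k)))"
        using Suc by (simp add: algebra_simps)
      also have "\<dots> \<le> norm (Z w j - Z v j) + norm (Z w k - Z v k) / 16"
        using norm_triangle_ineq4[of "fst (Z w j) - fst (Z v j)" "f j (Z w k) - f j (Z v k)"]
          norm_fst_le'[of "Z w j - Z v j"] f[of "Z w k" "Z v k" j] w v by (auto simp: D)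
      also have "\<dots> \<le> 2 ^ j * ?d + 2 ^ k * ?d / 16"
        using Zd[of w j v] Zd[of w k v] by linarith
      also have "\<dots> = 2 ^ k * (9 / 16 * ?d)" using Suc by simp
      finally show ?thesis .
    qed
    moreover have "norm (g k (Z w (Suc k)) - g k (Z v (Suc k))) \<le> 2 ^ k * (2 / 16 * ?d)"
      using g[of "Z w (Suc k)" "Z v (Suc k)" k] Zd[of w "Suc k" v] w v by (simp add: D)
    ultimately have "norm (Z (T w) k - Z (T v) k) \<le> 2 ^ k * (11 / 16 * ?d)"
      unfolding ZT[OF w] ZT[OF v] diff_Pair by (intro order_trans[OF norm_Pair_le]) simp
    then show "dist (apply_bcontfun (T w) k) (apply_bcontfun (T v) k) \<le> 11 / 16 * ?d"
      by (simp add: Z_def dist_norm flip: scaleR_diff_right)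
  qed
  have "\<exists>!w. w \<in> D \<and> T w = w"
  proof (rule Banach_fix[where c = "11 / 16"])
    show "D \<noteq> {}"
    proof -
      have "0 \<in> D" using S(2) by (simp add: D Z_def)
      then show ?thesis by auto
    qed
  qed (use \<open>complete D\<close> TD contr in auto)
  then obtain w where w: "w \<in> D" "T w = w" by auto
  have Zw: "Z w k = ((case k of 0 \<Rightarrow> q | Suc j \<Rightarrow> fst (Z w j) - f j (Z w k)), g k (Z w (Suc k)))" for k
    using ZT[OF w(1), of k] w(2) by simp
  have "backward_orbit f g S q (Z w)"
    unfolding backward_orbit_def
  proof (intro conjI allI exI)
    show "fst (Z w 0) = q" by (subst Zw) simp
    show "fst (Z w k) = fst (Z w (Suc k)) + f k (Z w (Suc k))" for k
      using arg_cong[OF Zw[of "Suc k"], of fst] by simp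
    show "snd (Z w k) = g k (Z w (Suc k))" for k
      using arg_cong[OF Zw[of k], of snd] by simp
    show "snd (Z w k) \<in> S" for k using w by (simp add: D)
    show "norm (Z w k) \<le> norm w * 2 ^ k" for k using Zn[of w k] by (simp add: mult.commute)
  qed
  then show ?thesis by blast
qed


section \<open>Invariant graphs of maps close to a translation\<close>

definition pair_blinfun ::
  "('a::real_normed_vector \<Rightarrow>\<^sub>L 'b::real_normed_vector) \<times> ('a \<Rightarrow>\<^sub>L 'c::real_normed_vector) \<Rightarrow> 'a \<Rightarrow>\<^sub>L ('b \<times> 'c)" where
  "pair_blinfun U = Blinfun (\<lambda>v. (blinfun_apply (fst U) v, blinfun_apply (snd U) v))"

lemma pair_blinfun_apply [simp]: "blinfun_apply (pair_blinfun U) v = (fst U v, snd U v)"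
  unfolding pair_blinfun_def
  by (subst bounded_linear_Blinfun_apply) (auto intro!: bounded_linear_Pair blinfun.bounded_linear_right)

lemma pair_blinfun_diff: "pair_blinfun (U - V) = pair_blinfun U - pair_blinfun V"
  by (rule blinfun_eqI) (simp add: blinfun.diff_left)

lemma norm_pair_blinfun: "norm (pair_blinfun U) \<le> norm U"
proof (rule norm_blinfun_bound)
  fix v
  have "norm (pair_blinfun U v) = sqrt ((norm (fst U v))\<^sup>2 + (norm (snd U v))\<^sup>2)"
    by (simp add: norm_Pair)
  also have "\<dots> \<le> sqrt ((norm (fst U) * norm v)\<^sup>2 + (norm (snd U) * norm v)\<^sup>2)"
    by (intro real_sqrt_le_mono add_mono power_mono norm_blinfun) auto
  also have "\<dots> = norm U * norm v"
    by (simp add: norm_prod_def power_mult_distrib real_sqrt_mult flip: distrib_right)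
  finally show "norm (pair_blinfun U v) \<le> norm U * norm v" .
qed simp

lemma norm_fst_compose: "norm (fst_blinfun o\<^sub>L (W :: 'c::real_normed_vector \<Rightarrow>\<^sub>L ('a::real_normed_vector \<times> 'b::real_normed_vector))) \<le> norm W"
  by (rule norm_blinfun_bound) (auto intro: order_trans[OF norm_fst_le' norm_blinfun])

lemma norm_snd_compose: "norm (snd_blinfun o\<^sub>L (W :: 'c::real_normed_vector \<Rightarrow>\<^sub>L ('a::real_normed_vector \<times> 'b::real_normed_vector))) \<le> norm W"
  by (rule norm_blinfun_bound) (auto intro: order_trans[OF norm_snd_le' norm_blinfun])

lemma linearization_error:
  fixes f :: "'a::real_normed_vector \<Rightarrow> 'b::real_normed_vector" and Df :: "'a \<Rightarrow> 'a \<Rightarrow>\<^sub>L 'b"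
  assumes S: "convex S" "x \<in> S" "y \<in> S"
    and deriv: "\<And>w. w \<in> S \<Longrightarrow> (f has_derivative Df w) (at w)"
    and M: "\<And>w. w \<in> S \<Longrightarrow> norm (w - x) \<le> norm (y - x) \<Longrightarrow> norm (Df w - Df x) \<le> M"
  shows "norm (f y - f x - Df x (y - x)) \<le> norm (y - x) * M"
proof (rule differentiable_bound_linearization[where S = "closed_segment x y" and ?x0.0 = x and f' = "\<lambda>w. blinfun_apply (Df w)"])
  show "x + t *\<^sub>R (y - x) \<in> closed_segment x y" if "t \<in> {0..1}" for t
    using that unfolding in_segment by (intro exI[of _ t]) (auto simp: algebra_simps)
  have sub: "w \<in> S" if "w \<in> closed_segment x y" for w
    using closed_segment_subset[OF S(2,3,1)] that by auto
  show "(f has_derivative blinfun_apply (Df w)) (at w within closed_segment x y)"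
    if "w \<in> closed_segment x y" for w
    using deriv[OF sub[OF that]] by (rule has_derivative_at_withinI)
  show "onorm (blinfun_apply (Df w) - blinfun_apply (Df x)) \<le> M" if w: "w \<in> closed_segment x y" for w
  proof -
    have "norm (Df w - Df x) \<le> M"
      using M[OF sub[OF w]] segment_bound1[OF w] by (simp add: norm_minus_commute)
    then show ?thesis by (simp add: norm_blinfun.rep_eq minus_blinfun.rep_eq fun_diff_def)
  qed
qed simp

lemmas blinfun_compose_diff =
  bounded_bilinear.diff_left[OF bounded_bilinear_blinfun_compose]
  bounded_bilinear.diff_right[OF bounded_bilinear_blinfun_compose]

text \<open>
  A \<open>C\<^sup>1\<close> perturbation of the map \<open>(q, b) \<mapsto> (q + tau, 0)\<close> on the strip \<open>norm b \<le> rho\<close>, which it maps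
  into itself. The perturbation has to be small in the \<open>C\<^sup>1\<close> sense only; \<open>rho\<close> may be tiny.
\<close>

locale near_translation =
  fixes G :: "'a::euclidean_space \<times> 'b::euclidean_space \<Rightarrow> 'a \<times> 'b"
    and DG :: "'a \<times> 'b \<Rightarrow> ('a \<times> 'b) \<Rightarrow>\<^sub>L ('a \<times> 'b)"
    and tau :: 'a and rho :: real
  assumes rho: "0 \<le> rho"
    and deriv: "\<And>z. norm (snd z) \<le> rho \<Longrightarrow> (G has_derivative DG z) (at z)"
    and DG_le: "\<And>z. norm (snd z) \<le> rho \<Longrightarrow> norm (DG z) \<le> 1 / 16"
    and DG_uc: "uniformly_continuous_on {z. norm (snd z) \<le> rho} DG"
    and G_strip: "\<And>z. norm (snd z) \<le> rho \<Longrightarrow> norm (snd (G z)) \<le> rho"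
begin

definition Psi :: "'a \<times> 'b \<Rightarrow> 'a \<times> 'b" where
  "Psi z = (fst z + tau + fst (G z), snd (G z))"

definition is_orbit :: "(nat \<Rightarrow> 'a \<times> 'b) \<Rightarrow> bool" where
  "is_orbit z \<longleftrightarrow> (\<forall>k. z k = Psi (z (Suc k)) \<and> norm (snd (z k)) \<le> rho) \<and> (\<exists>C. \<forall>k. norm (z k) \<le> C * 2 ^ k)"

lemma is_orbitD:
  assumes "is_orbit z"
  shows "z k = Psi (z (Suc k))" "norm (snd (z k)) \<le> rho" "\<exists>C. \<forall>k. norm (z k) \<le> C * 2 ^ k"
proof -
  note o = assms[unfolded is_orbit_def]
  show "z k = Psi (z (Suc k))" by (rule spec[OF conjunct1[OF o], THEN conjunct1])
  show "norm (snd (z k)) \<le> rho" by (rule spec[OF conjunct1[OF o], THEN conjunct2])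
  show "\<exists>C. \<forall>k. norm (z k) \<le> C * 2 ^ k" by (rule conjunct2[OF o])
qed

lemma is_orbitI:
  assumes "\<And>k. z k = Psi (z (Suc k))" "\<And>k. norm (snd (z k)) \<le> rho" "\<And>k. norm (z k) \<le> C * 2 ^ k"
  shows "is_orbit z"
  unfolding is_orbit_def by (intro conjI allI exI[of _ C] assms)

lemma strip_convex: "convex {z :: 'a \<times> 'b. norm (snd z) \<le> rho}"
proof -
  have "{z :: 'a \<times> 'b. norm (snd z) \<le> rho} = UNIV \<times> cball 0 rho" by (auto simp: mem_Times_iff)
  then show ?thesis by (simp add: convex_Times)
qed

lemma G_Lipschitz:
  assumes "norm (snd x) \<le> rho" "norm (snd y) \<le> rho"
  shows "norm (G x - G y) \<le> norm (x - y) / 16"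
  using differentiable_bound[OF strip_convex, of G "\<lambda>z. blinfun_apply (DG z)" "1 / 16" x y]
    deriv DG_le assms by (simp add: norm_blinfun.rep_eq has_derivative_at_withinI)

lemma Psi_eq_iff: "y = Psi z \<longleftrightarrow> fst y = fst z + (tau + fst (G z)) \<and> snd y = snd (G z)"
  by (simp add: Psi_def prod_eq_iff add.assoc)

lemma is_orbit_iff:
  "is_orbit z \<longleftrightarrow> backward_orbit (\<lambda>_ z. tau + fst (G z)) (\<lambda>_ z. snd (G z)) (cball 0 rho) (fst (z 0)) z"
  unfolding is_orbit_def backward_orbit_def Psi_eq_iff mem_cball_0 by blast

lemma orbit_exists: "\<exists>z. is_orbit z \<and> fst (z 0) = q"
proof -
  have *: "norm (fst (G x) - fst (G y)) \<le> norm (x - y) / 16"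
    "norm (snd (G x) - snd (G y)) \<le> norm (x - y) / 16"
    if "norm (snd x) \<le> rho" "norm (snd y) \<le> rho" for x y
    using G_Lipschitz[OF that] norm_fst_le'[of "G x - G y"] norm_snd_le'[of "G x - G y"] by auto
  have "\<exists>z. backward_orbit (\<lambda>_ z. tau + fst (G z)) (\<lambda>_ z. snd (G z)) (cball 0 rho) q z"
  proof (rule backward_orbit_exists[where C = "norm tau + norm (G 0)"])
    show "norm (tau + fst (G 0)) \<le> norm tau + norm (G 0)"
      using norm_triangle_ineq[of tau "fst (G 0)"] norm_fst_le'[of "G 0"] by linarith
    show "norm (snd (G 0)) \<le> norm tau + norm (G 0)"
      using norm_snd_le'[of "G 0"] norm_ge_zero[of tau] by linarith
  qed (use rho * G_strip in auto)
  then obtain z where z: "backward_orbit (\<lambda>_ z. tau + fst (G z)) (\<lambda>_ z. snd (G z)) (cball 0 rho) q z" ..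
  then have "fst (z 0) = q" unfolding backward_orbit_def by (rule conjunct1)
  with z show ?thesis by (intro exI[of _ z]) (simp add: is_orbit_iff)
qed

definition orbit :: "'a \<Rightarrow> nat \<Rightarrow> 'a \<times> 'b" where
  "orbit q = (SOME z. is_orbit z \<and> fst (z 0) = q)"

lemma orbit: "is_orbit (orbit q)" "fst (orbit q 0) = q"
  using someI_ex[OF orbit_exists[of q]] unfolding orbit_def by auto

lemma orbit_step: "orbit q k = Psi (orbit q (Suc k))" and orbit_strip: "norm (snd (orbit q k)) \<le> rho"
  by (rule is_orbitD[OF orbit(1)])+

text \<open>
  Two backward orbits are determined by their base points, in a Lipschitz way. Uniqueness of the orbit over
  a point, and hence the invariant graph, follow.
\<close>

lemma orbits_close:
  assumes y: "is_orbit y" and z: "is_orbit z"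
  shows "norm (y k - z k) \<le> 8 * norm (fst (y 0) - fst (z 0)) * 2 ^ k"
proof -
  define d where "d k = y k - z k" for k
  define r where "r k = G (y k) - G (z k)" for k
  have r: "norm (r k) \<le> norm (d k) / 16" for k
    unfolding r_def d_def by (intro G_Lipschitz is_orbitD(2) y z)
  have fd: "fst (d (Suc k)) = fst (d k) - fst (r (Suc k))" and sd: "snd (d k) = snd (r (Suc k))" for k
  proof -
    have "y k = Psi (y (Suc k))" "z k = Psi (z (Suc k))" by (rule is_orbitD[OF y], rule is_orbitD[OF z])
    then show "fst (d (Suc k)) = fst (d k) - fst (r (Suc k))" "snd (d k) = snd (r (Suc k))"
      unfolding Psi_eq_iff by (simp_all add: d_def r_def)
  qed
  obtain C1 C2 where C: "\<And>k. norm (y k) \<le> C1 * 2 ^ k" "\<And>k. norm (z k) \<le> C2 * 2 ^ k"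
    using is_orbitD(3)[OF y] is_orbitD(3)[OF z] by blast
  let ?e = "norm (fst (y 0) - fst (z 0))"
  have "norm (fst (d k)) + norm (snd (d k)) \<le> 8 * ?e * 2 ^ k"
  proof (rule weighted_sequence_bound[where d = "\<lambda>k. norm (d k)" and C = "2 * (C1 + C2)"])
    show "norm (d k) \<le> norm (fst (d k)) + norm (snd (d k))" for k by (rule norm_prod_le)
    show "norm (fst (d 0)) \<le> ?e" by (simp add: d_def)
    show "norm (fst (d (Suc k))) \<le> norm (fst (d k)) + norm (d (Suc k)) / 16 + ?e * 2 ^ Suc k" for k
    proof -
      have "0 \<le> ?e * 2 ^ Suc k" by simp
      moreover have "norm (fst (d (Suc k))) \<le> norm (fst (d k)) + norm (fst (r (Suc k)))"
        unfolding fd by (rule norm_triangle_ineq4)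
      ultimately show ?thesis using r[of "Suc k"] norm_fst_le'[of "r (Suc k)"] by linarith
    qed
    show "norm (snd (d k)) \<le> norm (d (Suc k)) / 16 + ?e * 2 ^ k" for k
    proof -
      have "0 \<le> ?e * 2 ^ k" by simp
      then show ?thesis using r[of "Suc k"] norm_snd_le'[of "r (Suc k)"] unfolding sd by linarith
    qed
    show "norm (fst (d k)) + norm (snd (d k)) \<le> 2 * (C1 + C2) * 2 ^ k" for k
    proof -
      have "norm (d k) \<le> norm (y k) + norm (z k)" unfolding d_def by (rule norm_triangle_ineq4)
      then have "norm (d k) \<le> (C1 + C2) * 2 ^ k" using C[of k] unfolding distrib_right by linarith
      then show ?thesis using norm_fst_le'[of "d k"] norm_snd_le'[of "d k"] by linarith
    qed
  qed auto
  then show ?thesis using norm_prod_le[of "d k"] by (simp add: d_def)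
qed

lemma orbit_unique:
  assumes "is_orbit z"
  shows "z = orbit (fst (z 0))"
proof
  fix k show "z k = orbit (fst (z 0)) k"
    using orbits_close[OF assms orbit(1)[of "fst (z 0)"], of k] orbit(2) by simp
qed

text \<open>
  Dropping the most recent point of an orbit leaves an orbit: the points over which orbits start are
  closed under going back in time, and all points of an orbit are of the form \<open>orbit q 0\<close>.
\<close>

lemma orbit_tail: "(\<lambda>k. orbit q (Suc k)) = orbit (fst (orbit q (Suc 0)))"
proof (rule orbit_unique[where z = "\<lambda>k. orbit q (Suc k)"])
  obtain C where C: "\<And>k. norm (orbit q k) \<le> C * 2 ^ k" using is_orbitD(3)[OF orbit(1)[of q]] by blast
  show "is_orbit (\<lambda>k. orbit q (Suc k))"
  proof (rule is_orbitI)
    show "norm (orbit q (Suc k)) \<le> (2 * C) * 2 ^ k" for k using C[of "Suc k"] by simp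
  qed (rule orbit_step orbit_strip)+
qed

text \<open>
  The modulus of continuity of \<open>DG\<close> along two orbits that separate like \<open>2 ^ k\<close>. Far in the
  past the orbits are far apart and only the bound on \<open>DG\<close> helps, but there \<open>2 ^ k\<close> is negligible
  against \<open>3 ^ k\<close>; finitely many indices remain, for which uniform continuity applies.
\<close>

lemma DG_gap:
  assumes "eps > 0"
  shows "\<exists>d>0. \<forall>k x y. norm (snd x) \<le> rho \<and> norm (snd y) \<le> rho \<and> norm (x - y) \<le> 8 * d * 2 ^ k \<longrightarrow>
           8 * 2 ^ k * norm (DG x - DG y) \<le> eps * 3 ^ k"
proof -
  \<comment> \<open>beyond \<open>K\<close> the trivial bound \<open>1 / 8\<close> on the gap suffices\<close>
  obtain K where "(2 / 3 :: real) ^ K < eps" using real_arch_pow_inv[OF assms, of "2/3"] by auto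
  have "eps / 8 > 0" using assms by simp
  then obtain d' where d': "d' > 0"
    and uc: "\<And>x y. norm (snd x) \<le> rho \<Longrightarrow> norm (snd y) \<le> rho \<Longrightarrow> dist x y < d' \<Longrightarrow> dist (DG x) (DG y) < eps / 8"
    using DG_uc unfolding uniformly_continuous_on_def mem_Collect_eq Ball_def by meson
  show ?thesis
  proof (rule exI[of _ "d' / (16 * 2 ^ K)"], intro conjI allI impI; (elim conjE)?)
    fix k :: nat and x y :: "'a \<times> 'b"
    assume x: "norm (snd x) \<le> rho" and y: "norm (snd y) \<le> rho"
      and d: "norm (x - y) \<le> 8 * (d' / (16 * 2 ^ K)) * 2 ^ k"
    show "8 * 2 ^ k * norm (DG x - DG y) \<le> eps * 3 ^ k"
    proof (cases "k \<le> K")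
      case True
      then have "(2::real) ^ k \<le> 2 ^ K" by simp
      then have "d' * 2 ^ k \<le> d' * 2 ^ K" using d' by (intro mult_left_mono) auto
      then have "8 * (d' / (16 * 2 ^ K)) * 2 ^ k \<le> d' / 2" by (simp add: field_simps)
      then have "norm (x - y) < d'" using d d' by linarith
      then have "norm (DG x - DG y) < eps / 8" using uc[OF x y] by (simp add: dist_norm)
      then have "8 * 2 ^ k * norm (DG x - DG y) \<le> 8 * 2 ^ k * (eps / 8)"
        by (intro mult_left_mono) auto
      also have "\<dots> = eps * 2 ^ k" by simp
      also have "\<dots> \<le> eps * 3 ^ k" using assms by (intro mult_left_mono power_mono) auto
      finally show ?thesis .
    next
      case False
      have "norm (DG x - DG y) \<le> 1 / 8"
        using norm_triangle_ineq4[of "DG x" "DG y"] DG_le[OF x] DG_le[OF y] by simp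
      then have "8 * 2 ^ k * norm (DG x - DG y) \<le> 8 * 2 ^ k * (1 / 8)" by (intro mult_left_mono) auto
      also have "\<dots> = (2 / 3) ^ k * 3 ^ k" by (simp add: power_divide)
      also have "\<dots> \<le> eps * 3 ^ k"
      proof (rule mult_right_mono)
        have "(2 / 3 :: real) ^ k \<le> (2 / 3) ^ K" using False by (intro power_decreasing) auto
        then show "(2 / 3 :: real) ^ k \<le> eps" using \<open>(2 / 3 :: real) ^ K < eps\<close> by linarith
      qed simp
      finally show ?thesis .
    qed
  qed (use d' in simp)
qed

text \<open>
  The derivative of \<open>q \<mapsto> orbit q\<close>: the operator-valued backward orbit of the linearized maps that
  starts at the identity.
\<close>

definition tangent_orbit :: "'a \<Rightarrow> nat \<Rightarrow> ('a \<Rightarrow>\<^sub>L 'a) \<times> ('a \<Rightarrow>\<^sub>L 'b)" where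
  "tangent_orbit q = (SOME U. backward_orbit
     (\<lambda>k U. fst_blinfun o\<^sub>L (DG (orbit q (Suc k)) o\<^sub>L pair_blinfun U))
     (\<lambda>k U. snd_blinfun o\<^sub>L (DG (orbit q (Suc k)) o\<^sub>L pair_blinfun U)) UNIV id_blinfun U)"

lemma tangent_orbit:
  "fst (tangent_orbit q 0) = id_blinfun"
  "fst (tangent_orbit q (Suc k)) = fst (tangent_orbit q k) -
     (fst_blinfun o\<^sub>L (DG (orbit q (Suc k)) o\<^sub>L pair_blinfun (tangent_orbit q (Suc k))))"
  "snd (tangent_orbit q k) = snd_blinfun o\<^sub>L (DG (orbit q (Suc k)) o\<^sub>L pair_blinfun (tangent_orbit q (Suc k)))"
  "\<exists>C. \<forall>k. norm (tangent_orbit q k) \<le> C * 2 ^ k"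
proof -
  have *: "norm (DG (orbit q k) o\<^sub>L (pair_blinfun U - pair_blinfun V)) \<le> norm (U - V) / 16" for k U V
  proof -
    have "norm (DG (orbit q k)) * norm (pair_blinfun (U - V)) \<le> (1 / 16) * norm (U - V)"
      by (intro mult_mono DG_le orbit_strip norm_pair_blinfun) auto
    then show ?thesis
      using norm_blinfun_compose[of "DG (orbit q k)" "pair_blinfun (U - V)"]
      by (simp add: pair_blinfun_diff)
  qed
  have "\<exists>U. backward_orbit
     (\<lambda>k U. fst_blinfun o\<^sub>L (DG (orbit q (Suc k)) o\<^sub>L pair_blinfun U))
     (\<lambda>k U. snd_blinfun o\<^sub>L (DG (orbit q (Suc k)) o\<^sub>L pair_blinfun U)) UNIV id_blinfun U"
  proof (rule backward_orbit_exists[where C = 0])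
    have 0: "pair_blinfun (0 :: ('a \<Rightarrow>\<^sub>L 'a) \<times> ('a \<Rightarrow>\<^sub>L 'b)) = 0"
      by (rule blinfun_eqI) (simp add: zero_prod_def)
    show "norm (fst_blinfun o\<^sub>L (DG (orbit q (Suc k)) o\<^sub>L pair_blinfun (0 :: ('a \<Rightarrow>\<^sub>L 'a) \<times> ('a \<Rightarrow>\<^sub>L 'b)))) \<le> 0"
      "norm (snd_blinfun o\<^sub>L (DG (orbit q (Suc k)) o\<^sub>L pair_blinfun (0 :: ('a \<Rightarrow>\<^sub>L 'a) \<times> ('a \<Rightarrow>\<^sub>L 'b)))) \<le> 0" for k
      unfolding 0 by simp_all
    fix k and U V :: "('a \<Rightarrow>\<^sub>L 'a) \<times> ('a \<Rightarrow>\<^sub>L 'b)"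
    let ?D = "DG (orbit q (Suc k))"
    show "norm ((fst_blinfun o\<^sub>L (?D o\<^sub>L pair_blinfun U)) - (fst_blinfun o\<^sub>L (?D o\<^sub>L pair_blinfun V))) \<le> norm (U - V) / 16"
      using norm_fst_compose[of "?D o\<^sub>L (pair_blinfun U - pair_blinfun V)"] *[of "Suc k" U V]
      by (simp add: blinfun_compose_diff)
    show "norm ((snd_blinfun o\<^sub>L (?D o\<^sub>L pair_blinfun U)) - (snd_blinfun o\<^sub>L (?D o\<^sub>L pair_blinfun V))) \<le> norm (U - V) / 16"
      using norm_snd_compose[of "?D o\<^sub>L (pair_blinfun U - pair_blinfun V)"] *[of "Suc k" U V]
      by (simp add: blinfun_compose_diff)
  qed auto
  note o = someI_ex[OF this, folded tangent_orbit_def, unfolded backward_orbit_def]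
  show "fst (tangent_orbit q 0) = id_blinfun" by (rule conjunct1[OF o])
  show "fst (tangent_orbit q (Suc k)) = fst (tangent_orbit q k) -
     (fst_blinfun o\<^sub>L (DG (orbit q (Suc k)) o\<^sub>L pair_blinfun (tangent_orbit q (Suc k))))"
    using spec[OF conjunct1[OF conjunct2[OF o]], of k, THEN conjunct1] unfolding eq_diff_eq by (rule sym)
  show "snd (tangent_orbit q k) = snd_blinfun o\<^sub>L (DG (orbit q (Suc k)) o\<^sub>L pair_blinfun (tangent_orbit q (Suc k)))"
    by (rule spec[OF conjunct1[OF conjunct2[OF o]], of k, THEN conjunct2, THEN conjunct1])
  show "\<exists>C. \<forall>k. norm (tangent_orbit q k) \<le> C * 2 ^ k" by (rule conjunct2[OF conjunct2[OF o]])
qed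

lemma tangent_compose_le:
  "norm (DG (orbit q k) o\<^sub>L pair_blinfun U) \<le> norm U / 16"
proof -
  have "norm (DG (orbit q k)) * norm (pair_blinfun U) \<le> (1 / 16) * norm U"
    by (intro mult_mono DG_le orbit_strip norm_pair_blinfun) auto
  then show ?thesis using norm_blinfun_compose[of "DG (orbit q k)" "pair_blinfun U"] by simp
qed

lemma tangent_orbit_growth: "norm (tangent_orbit q k) \<le> 8 * 2 ^ k"
proof -
  let ?U = "tangent_orbit q"
  obtain C where C: "\<And>k. norm (?U k) \<le> C * 2 ^ k" using tangent_orbit(4)[of q] by blast
  have "norm (fst (?U k)) + norm (snd (?U k)) \<le> 8 * 1 * 2 ^ k"
  proof (rule weighted_sequence_bound[where d = "\<lambda>k. norm (?U k)" and C = "2 * C"])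
    show "norm (?U k) \<le> norm (fst (?U k)) + norm (snd (?U k))" for k by (rule norm_prod_le)
    show "norm (fst (?U 0)) \<le> 1" by (simp add: tangent_orbit norm_blinfun_id_le)
    show "norm (fst (?U (Suc k))) \<le> norm (fst (?U k)) + norm (?U (Suc k)) / 16 + 1 * 2 ^ Suc k" for k
    proof -
      let ?R = "DG (orbit q (Suc k)) o\<^sub>L pair_blinfun (?U (Suc k))"
      have "norm (fst (?U (Suc k))) \<le> norm (fst (?U k)) + norm (fst_blinfun o\<^sub>L ?R)"
        unfolding tangent_orbit(2)[of q k] by (rule norm_triangle_ineq4)
      moreover have "(0::real) \<le> 1 * 2 ^ Suc k" by simp
      ultimately show ?thesis
        using norm_fst_compose[of ?R] tangent_compose_le[of q "Suc k" "?U (Suc k)"] by linarith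
    qed
    show "norm (snd (?U k)) \<le> norm (?U (Suc k)) / 16 + 1 * 2 ^ k" for k
    proof -
      let ?R = "DG (orbit q (Suc k)) o\<^sub>L pair_blinfun (?U (Suc k))"
      have "norm (snd (?U k)) = norm (snd_blinfun o\<^sub>L ?R)" unfolding tangent_orbit(3)[of q k] ..
      moreover have "(0::real) \<le> 1 * 2 ^ k" by simp
      ultimately show ?thesis
        using norm_snd_compose[of ?R] tangent_compose_le[of q "Suc k" "?U (Suc k)"] by linarith
    qed
    show "norm (fst (?U k)) + norm (snd (?U k)) \<le> 2 * C * 2 ^ k" for k
      using C[of k] norm_fst_le'[of "?U k"] norm_snd_le'[of "?U k"] by linarith
  qed auto
  then show ?thesis using norm_prod_le[of "?U k"] by simp
qed

text \<open>
  The remainder \<open>r\<close> of the first-order expansion of an orbit satisfies the linearized recursion up to the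
  Taylor error of \<open>G\<close>, which is small relative to \<open>3 ^ k\<close> by \<open>DG_gap\<close>.
\<close>

lemma orbit_derivative:
  "((\<lambda>q. orbit q n) has_derivative pair_blinfun (tangent_orbit q n)) (at q)"
  unfolding has_derivative_at_alt
proof (intro conjI allI impI)
  show "bounded_linear (pair_blinfun (tangent_orbit q n))" by (rule blinfun.bounded_linear_right)
  fix e :: real assume e: "e > 0"
  \<comment> \<open>24 is the constant 8 of the sequence bound times a factor 3 from the index shift\<close>
  define eps where "eps = e / (24 * 3 ^ n)"
  have eps: "eps > 0" using e by (simp add: eps_def)
  from DG_gap[OF eps] obtain d where d: "d > 0" and gap: "\<And>k x y. norm (snd x) \<le> rho \<Longrightarrow>
      norm (snd y) \<le> rho \<Longrightarrow> norm (x - y) \<le> 8 * d * 2 ^ k \<Longrightarrow> 8 * 2 ^ k * norm (DG x - DG y) \<le> eps * 3 ^ k"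
    by blast
  show "\<exists>d>0. \<forall>y. norm (y - q) < d \<longrightarrow>
      norm (orbit y n - orbit q n - pair_blinfun (tangent_orbit q n) (y - q)) \<le> e * norm (y - q)"
  proof (intro exI[of _ d] conjI allI impI d)
    fix y assume y: "norm (y - q) < d"
    define v where "v = y - q"
    define U where "U k = pair_blinfun (tangent_orbit q k) v" for k
    define r where "r k = orbit y k - orbit q k - U k" for k
    define s where "s k = G (orbit y k) - G (orbit q k) - DG (orbit q k) (U k)" for k
    have close: "norm (orbit y k - orbit q k) \<le> 8 * norm v * 2 ^ k" for k
      using orbits_close[OF orbit(1)[of y] orbit(1)[of q], of k] by (simp add: orbit(2) v_def)
    have err: "norm (G (orbit y k) - G (orbit q k) - DG (orbit q k) (orbit y k - orbit q k)) \<le> eps * norm v * 3 ^ k" for k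
    proof -
      have "norm (G (orbit y k) - G (orbit q k) - DG (orbit q k) (orbit y k - orbit q k))
        \<le> norm (orbit y k - orbit q k) * (eps * 3 ^ k / (8 * 2 ^ k))"
      proof (rule linearization_error[OF strip_convex])
        fix w assume "w \<in> {z. norm (snd z) \<le> rho}" and w2: "norm (w - orbit q k) \<le> norm (orbit y k - orbit q k)"
        then have w: "norm (snd w) \<le> rho" by simp
        have "8 * norm v * 2 ^ k \<le> 8 * d * 2 ^ k" using y by (simp add: v_def)
        then have "norm (w - orbit q k) \<le> 8 * d * 2 ^ k" using w2 close[of k] by linarith
        from gap[OF w orbit_strip this] show "norm (DG w - DG (orbit q k)) \<le> eps * 3 ^ k / (8 * 2 ^ k)"
          by (simp add: field_simps)
      qed (use orbit_strip deriv in auto)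
      also have "\<dots> \<le> 8 * norm v * 2 ^ k * (eps * 3 ^ k / (8 * 2 ^ k))"
        using close[of k] eps by (intro mult_right_mono) auto
      also have "\<dots> = eps * norm v * 3 ^ k" by simp
      finally show ?thesis .
    qed
    have s: "norm (s k) \<le> norm (r k) / 16 + eps * norm v * 3 ^ k" for k
    proof -
      have "s k = DG (orbit q k) (r k) + (G (orbit y k) - G (orbit q k) - DG (orbit q k) (orbit y k - orbit q k))"
        by (simp add: s_def r_def blinfun.diff_right)
      moreover have "norm (DG (orbit q k) (r k)) \<le> (1 / 16) * norm (r k)"
        by (intro order_trans[OF norm_blinfun] mult_right_mono DG_le orbit_strip) auto
      ultimately show ?thesis using err[of k] norm_triangle_ineq[of "DG (orbit q k) (r k)"
          "G (orbit y k) - G (orbit q k) - DG (orbit q k) (orbit y k - orbit q k)"] by simp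
    qed
    have fU: "fst (U (Suc k)) = fst (U k) - fst (DG (orbit q (Suc k)) (U (Suc k)))"
      and sU: "snd (U k) = snd (DG (orbit q (Suc k)) (U (Suc k)))" for k
    proof -
      have 1: "DG (orbit q (Suc k)) (U (Suc k)) = (DG (orbit q (Suc k)) o\<^sub>L pair_blinfun (tangent_orbit q (Suc k))) v"
        by (simp only: U_def blinfun_apply_blinfun_compose)
      show "fst (U (Suc k)) = fst (U k) - fst (DG (orbit q (Suc k)) (U (Suc k)))"
        using arg_cong[OF tangent_orbit(2)[of q k], of "\<lambda>W. blinfun_apply W v"] unfolding 1
        by (simp add: U_def blinfun.diff_left)
      show "snd (U k) = snd (DG (orbit q (Suc k)) (U (Suc k)))"
        using arg_cong[OF tangent_orbit(3)[of q k], of "\<lambda>W. blinfun_apply W v"] unfolding 1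
        by (simp add: U_def)
    qed
    have fr: "fst (r (Suc k)) = fst (r k) - fst (s (Suc k))" and sr: "snd (r k) = snd (s (Suc k))" for k
      using orbit_step[of y k, unfolded Psi_eq_iff] orbit_step[of q k, unfolded Psi_eq_iff] fU[of k] sU[of k]
      by (simp_all add: r_def s_def)
    have "norm (fst (r n)) + norm (snd (r n)) \<le> 8 * (3 * eps * norm v) * 3 ^ n"
    proof (rule weighted_sequence_bound[where d = "\<lambda>k. norm (r k)" and C = "32 * norm v"])
      show "norm (r k) \<le> norm (fst (r k)) + norm (snd (r k))" for k by (rule norm_prod_le)
      show "norm (fst (r 0)) \<le> 3 * eps * norm v"
        using eps by (simp add: r_def U_def orbit(2) tangent_orbit(1) v_def)
      show "norm (fst (r (Suc k))) \<le> norm (fst (r k)) + norm (r (Suc k)) / 16 + 3 * eps * norm v * 3 ^ Suc k" for k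
      proof -
        have "eps * norm v * 3 ^ Suc k \<le> 3 * eps * norm v * 3 ^ Suc k" using eps by simp
        moreover have "norm (fst (r (Suc k))) \<le> norm (fst (r k)) + norm (fst (s (Suc k)))"
          unfolding fr by (rule norm_triangle_ineq4)
        ultimately show ?thesis using s[of "Suc k"] norm_fst_le'[of "s (Suc k)"] by linarith
      qed
      show "norm (snd (r k)) \<le> norm (r (Suc k)) / 16 + 3 * eps * norm v * 3 ^ k" for k
        using s[of "Suc k"] norm_snd_le'[of "s (Suc k)"] unfolding sr by simp
      show "norm (fst (r k)) + norm (snd (r k)) \<le> 32 * norm v * 3 ^ k" for k
      proof -
        have "norm (U k) \<le> norm (pair_blinfun (tangent_orbit q k)) * norm v" unfolding U_def by (rule norm_blinfun)
        also have "\<dots> \<le> 8 * 2 ^ k * norm v"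
          by (intro mult_right_mono order_trans[OF norm_pair_blinfun tangent_orbit_growth]) simp
        also have "\<dots> = 8 * norm v * 2 ^ k" by simp
        finally have "norm (r k) \<le> 16 * norm v * 2 ^ k"
          using close[of k] norm_triangle_ineq4[of "orbit y k - orbit q k" "U k"] by (simp add: r_def)
        also have "\<dots> \<le> 16 * norm v * 3 ^ k" by (intro mult_left_mono power_mono) auto
        finally show ?thesis using norm_fst_le'[of "r k"] norm_snd_le'[of "r k"] by linarith
      qed
    qed (use eps in auto)
    then have "norm (r n) \<le> 8 * (3 * eps * norm v) * 3 ^ n" using norm_prod_le[of "r n"] by linarith
    also have "\<dots> = e * norm v" by (simp add: eps_def)
    finally show "norm (orbit y n - orbit q n - pair_blinfun (tangent_orbit q n) (y - q)) \<le> e * norm (y - q)"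
      by (simp add: r_def U_def v_def)
  qed
qed

lemma tangent_orbit_continuous: "continuous_on UNIV (\<lambda>q. tangent_orbit q n)"
  unfolding continuous_on_iff
proof (intro ballI allI impI)
  fix q and e :: real assume e: "0 < e"
  define eps where "eps = e / (48 * 3 ^ n)"
  have eps: "eps > 0" using e by (simp add: eps_def)
  from DG_gap[OF eps] obtain d where d: "d > 0" and gap: "\<And>k x y. norm (snd x) \<le> rho \<Longrightarrow>
      norm (snd y) \<le> rho \<Longrightarrow> norm (x - y) \<le> 8 * d * 2 ^ k \<Longrightarrow> 8 * 2 ^ k * norm (DG x - DG y) \<le> eps * 3 ^ k"
    by blast
  show "\<exists>d>0. \<forall>y\<in>UNIV. dist y q < d \<longrightarrow> dist (tangent_orbit y n) (tangent_orbit q n) < e"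
  proof (intro exI[of _ d] conjI ballI impI d)
    fix y assume y: "dist y q < d"
    let ?U = "tangent_orbit q" and ?V = "tangent_orbit y"
    define r where "r k = ?V k - ?U k" for k
    define s where "s k = (DG (orbit y k) o\<^sub>L pair_blinfun (?V k)) - (DG (orbit q k) o\<^sub>L pair_blinfun (?U k))" for k
    have s: "norm (s k) \<le> norm (r k) / 16 + eps * 3 ^ k" for k
    proof -
      have "norm (orbit y k - orbit q k) \<le> 8 * norm (y - q) * 2 ^ k"
        using orbits_close[OF orbit(1)[of y] orbit(1)[of q], of k] by (simp add: orbit(2))
      also have "\<dots> \<le> 8 * d * 2 ^ k" using y by (simp add: dist_norm)
      finally have "8 * 2 ^ k * norm (DG (orbit y k) - DG (orbit q k)) \<le> eps * 3 ^ k"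
        by (rule gap[OF orbit_strip orbit_strip])
      moreover have "norm ((DG (orbit y k) - DG (orbit q k)) o\<^sub>L pair_blinfun (?U k))
          \<le> norm (DG (orbit y k) - DG (orbit q k)) * (8 * 2 ^ k)"
        by (intro order_trans[OF norm_blinfun_compose] mult_left_mono order_trans[OF norm_pair_blinfun tangent_orbit_growth]) simp
      moreover have "s k = (DG (orbit y k) o\<^sub>L pair_blinfun (r k)) + ((DG (orbit y k) - DG (orbit q k)) o\<^sub>L pair_blinfun (?U k))"
        unfolding s_def r_def pair_blinfun_diff
        by (simp add: blinfun_compose_diff)
      ultimately show ?thesis
        using norm_triangle_ineq[of "DG (orbit y k) o\<^sub>L pair_blinfun (r k)" "(DG (orbit y k) - DG (orbit q k)) o\<^sub>L pair_blinfun (?U k)"]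
          tangent_compose_le[of y k "r k"] by (simp add: mult.commute)
    qed
    have fr: "fst (r (Suc k)) = fst (r k) - (fst_blinfun o\<^sub>L s (Suc k))" and sr: "snd (r k) = snd_blinfun o\<^sub>L s (Suc k)" for k
      using tangent_orbit(2,3)[of q k] tangent_orbit(2,3)[of y k]
      by (simp_all add: r_def s_def blinfun_compose_diff)
    have "norm (fst (r n)) + norm (snd (r n)) \<le> 8 * (3 * eps) * 3 ^ n"
    proof (rule weighted_sequence_bound[where d = "\<lambda>k. norm (r k)" and C = 32])
      show "norm (r k) \<le> norm (fst (r k)) + norm (snd (r k))" for k by (rule norm_prod_le)
      show "norm (fst (r 0)) \<le> 3 * eps" using eps by (simp add: r_def tangent_orbit(1))
      show "norm (fst (r (Suc k))) \<le> norm (fst (r k)) + norm (r (Suc k)) / 16 + 3 * eps * 3 ^ Suc k" for k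
      proof -
        have "eps * 3 ^ Suc k \<le> 3 * eps * 3 ^ Suc k" using eps by simp
        moreover have "norm (fst (r (Suc k))) \<le> norm (fst (r k)) + norm (fst_blinfun o\<^sub>L s (Suc k))"
          unfolding fr by (rule norm_triangle_ineq4)
        ultimately show ?thesis using s[of "Suc k"] norm_fst_compose[of "s (Suc k)"] by linarith
      qed
      show "norm (snd (r k)) \<le> norm (r (Suc k)) / 16 + 3 * eps * 3 ^ k" for k
        using s[of "Suc k"] norm_snd_compose[of "s (Suc k)"] unfolding sr by simp
      show "norm (fst (r k)) + norm (snd (r k)) \<le> 32 * 3 ^ k" for k
      proof -
        have "norm (r k) \<le> 16 * 2 ^ k"
          using tangent_orbit_growth[of q k] tangent_orbit_growth[of y k] norm_triangle_ineq4[of "?V k" "?U k"]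
          by (simp add: r_def)
        also have "\<dots> \<le> 16 * 3 ^ k" by (intro mult_left_mono power_mono) auto
        finally show ?thesis using norm_fst_le'[of "r k"] norm_snd_le'[of "r k"] by linarith
      qed
    qed (use eps in auto)
    then have "norm (r n) \<le> 8 * (3 * eps) * 3 ^ n" using norm_prod_le[of "r n"] by linarith
    also have "\<dots> = e / 2" by (simp add: eps_def)
    finally show "dist (tangent_orbit y n) (tangent_orbit q n) < e"
      using e by (simp add: r_def dist_norm)
  qed
qed

end


section \<open>Ordinary differential equations on a half line\<close>

lemma vector_derivative_imp_continuous_on:
  assumes "\<And>t. t \<in> S \<Longrightarrow> (f has_vector_derivative f' t) (at t within S)"
  shows "continuous_on S f"
  unfolding continuous_on_eq_continuous_within using assms has_vector_derivative_continuous by blast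

lemma at_within_half_line:
  fixes t :: real
  assumes "t < T"
  shows "at t within {0..T} = at t within {0..}"
  by (rule at_within_nhd[where S = "{..<T}"]) (use assms in auto)

text \<open>
  The mean value inequality in the form needed for curves on a closed interval, with one-sided derivatives
  at the ends.
\<close>

lemma increment_bound:
  fixes f :: "real \<Rightarrow> 'e::real_normed_vector"
  assumes "0 \<le> b"
    and f: "\<And>t. t \<in> {0..b} \<Longrightarrow> (f has_vector_derivative f' t) (at t within {0..b})"
    and phi: "\<And>t. (phi has_vector_derivative phi' t) (at t)"
    and le: "\<And>t. t \<in> {0..b} \<Longrightarrow> norm (f' t) \<le> phi' t"
  shows "norm (f b - f 0) \<le> phi b - phi 0"
proof (cases "b = 0")
  case False
  show ?thesis
  proof (rule differentiable_bound_general)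
    show "0 < b" using assms False by simp
    show "continuous_on {0..b} f"
      using f by (rule vector_derivative_imp_continuous_on)
    show "continuous_on {0..b} phi"
      using phi by (auto intro!: continuous_at_imp_continuous_on has_vector_derivative_continuous)
    show "(f has_vector_derivative f' t) (at t)" if "0 < t" "t < b" for t
      using f[of t] that by (simp add: at_within_interior[of t "{0..b}"])
  qed (use phi le in auto)
qed simp

lemma exp_primitive: "((\<lambda>t. c * exp (2 * L * t) / 2 + a * t) has_vector_derivative (L * (c * exp (2 * L * t)) + a)) (at t)"
  for L c a t :: real
  unfolding has_real_derivative_iff_has_vector_derivative[symmetric]
  by (auto intro!: derivative_eq_intros)

text \<open>
  A Gronwall estimate. At the maximum of \<open>exp (- 2 * L * t) * norm (y t)\<close> the mean value inequality bounds
  this maximum by half of itself plus the data, which avoids differentiating the norm.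
\<close>

lemma ode_bound:
  fixes y :: "real \<Rightarrow> 'e::real_normed_vector"
  assumes L: "0 \<le> L" and a: "0 \<le> a"
    and y: "\<And>t. t \<in> {0..T} \<Longrightarrow> (y has_vector_derivative y' t) (at t within {0..T})"
    and le: "\<And>t. t \<in> {0..T} \<Longrightarrow> norm (y' t) \<le> L * norm (y t) + a"
    and t: "t \<in> {0..T}"
  shows "norm (y t) \<le> 2 * (norm (y 0) + a * T) * exp (2 * L * t)"
proof -
  have cont: "continuous_on {0..T} (\<lambda>t. exp (- (2 * L * t)) * norm (y t))"
    by (intro continuous_intros vector_derivative_imp_continuous_on[OF y]) auto
  have "{0..T} \<noteq> {}" using t by auto
  from continuous_attains_sup[OF compact_Icc this cont]
  obtain s where s: "s \<in> {0..T}"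
    and max: "\<And>t. t \<in> {0..T} \<Longrightarrow> exp (- (2 * L * t)) * norm (y t) \<le> exp (- (2 * L * s)) * norm (y s)"
    by blast
  define M where "M = exp (- (2 * L * s)) * norm (y s)"
  have M0: "0 \<le> M" by (simp add: M_def)
  have yM: "norm (y t) \<le> M * exp (2 * L * t)" if "t \<in> {0..T}" for t
    using max[OF that] by (simp add: M_def exp_minus field_simps)
  have "norm (y s - y 0) \<le> (M * exp (2 * L * s) / 2 + a * s) - (M * exp (2 * L * 0) / 2 + a * 0)"
  proof (rule increment_bound[OF _ _ exp_primitive])
    fix r assume r: "r \<in> {0..s}"
    then have r': "r \<in> {0..T}" using s by auto
    show "(y has_vector_derivative y' r) (at r within {0..s})"
      by (rule has_vector_derivative_within_subset[OF y[OF r']]) (use s in auto)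
    show "norm (y' r) \<le> L * (M * exp (2 * L * r)) + a"
      using le[OF r'] mult_left_mono[OF yM[OF r'] L] by linarith
  qed (use s in auto)
  then have "norm (y s) \<le> norm (y 0) + M * exp (2 * L * s) / 2 + a * s"
    using norm_triangle_ineq2[of "y s" "y 0"] M0 by simp
  then have "M \<le> exp (- (2 * L * s)) * (norm (y 0) + M * exp (2 * L * s) / 2 + a * s)"
    unfolding M_def by (intro mult_left_mono) auto
  also have "\<dots> = exp (- (2 * L * s)) * (norm (y 0) + a * s) + M / 2"
    by (simp add: algebra_simps exp_minus)
  also have "exp (- (2 * L * s)) * (norm (y 0) + a * s) \<le> 1 * (norm (y 0) + a * T)"
    using L a s by (intro mult_mono add_left_mono mult_left_mono) auto
  finally have "M \<le> 2 * (norm (y 0) + a * T)" by linarith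
  then have "M * exp (2 * L * t) \<le> 2 * (norm (y 0) + a * T) * exp (2 * L * t)"
    by (intro mult_right_mono) auto
  then show ?thesis using yM[OF t] by linarith
qed

lemma ode_unique:
  fixes y z :: "real \<Rightarrow> 'e::real_normed_vector"
  assumes lip: "\<And>t. t \<in> {0..T} \<Longrightarrow> norm (G t (y t) - G t (z t)) \<le> L * norm (y t - z t)" and L: "0 \<le> L"
    and y: "\<And>t. t \<in> {0..T} \<Longrightarrow> (y has_vector_derivative G t (y t)) (at t within {0..T})"
    and z: "\<And>t. t \<in> {0..T} \<Longrightarrow> (z has_vector_derivative G t (z t)) (at t within {0..T})"
    and 0: "y 0 = z 0" and t: "t \<in> {0..T}"
  shows "y t = z t"
  using ode_bound[where y = "\<lambda>t. y t - z t" and y' = "\<lambda>t. G t (y t) - G t (z t)" and L = L and a = 0 and T = T, OF L]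
    has_vector_derivative_diff[OF y z] lip 0 t by simp

text \<open>
  Picard iteration in the norm \<open>sup\<^sub>t exp (- 2 * L * t) * norm (y t)\<close>, for which the integral operator
  contracts by \<open>1 / 2\<close> on the whole half line, so that no continuation argument is needed. For general
  Banach spaces, as it is also used for the operator-valued variational equation.
\<close>

lemma ode_exists:
  fixes G :: "real \<Rightarrow> 'e::banach \<Rightarrow> 'e"
  assumes cont: "continuous_on ({0..} \<times> UNIV) (\<lambda>(t, x). G t x)" and L: "0 < L"
    and lip: "\<And>t x y. 0 \<le> t \<Longrightarrow> norm (G t x - G t y) \<le> L * norm (x - y)"
    and G0: "\<And>t. 0 \<le> t \<Longrightarrow> norm (G t 0) \<le> C"
  shows "\<exists>y. y 0 = x \<and> (\<forall>t\<ge>0. (y has_vector_derivative G t (y t)) (at t within {0..}))"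
proof -
  \<comment> \<open>\<open>w\<close> is the rescaled solution, extended by a constant to negative times\<close>
  define Y where "Y w t = exp (2 * L * t) *\<^sub>R apply_bcontfun w t" for w :: "real \<Rightarrow>\<^sub>C 'e" and t
  define J where "J w s = integral {0..s} (\<lambda>r. G r (Y w r))" for w s
  define K where "K w t = exp (- (2 * L * max t 0)) *\<^sub>R (x + J w (max t 0))" for w t
  define T where "T w = Bcontfun (K w)" for w
  have cG: "continuous_on {0..s} (\<lambda>r. G r (Y w r))" for s w
  proof -
    have "continuous_on {0..s} ((\<lambda>(t, x). G t x) \<circ> (\<lambda>r. (r, Y w r)))"
      unfolding Y_def
      by (intro continuous_on_compose continuous_intros continuous_on_subset[OF cont]) auto
    then show ?thesis by (simp add: o_def)
  qed
  have J: "(J w has_vector_derivative G r (Y w r)) (at r within {0..s})" if "r \<in> {0..s}" for w r s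
    unfolding J_def by (rule integral_has_vector_derivative[OF cG that])
  have J0: "J w 0 = 0" for w by (simp add: J_def)
  have cJ: "continuous_on {0..} (J w)" for w
    unfolding continuous_on_eq_continuous_within
  proof
    fix r :: real assume "r \<in> {0..}"
    then have "continuous (at r within {0..r+1}) (J w)"
      by (intro has_vector_derivative_continuous[OF J]) auto
    then show "continuous (at r within {0..}) (J w)" by (simp add: at_within_half_line)
  qed
  have Yn: "norm (Y w t) \<le> norm w * exp (2 * L * t)" for w t
    using norm_bounded[of w t] by (simp add: Y_def mult.commute)
  have Yd: "norm (Y w t - Y v t) \<le> dist w v * exp (2 * L * t)" for w v t
    using dist_bounded[of w t v] by (simp add: Y_def dist_norm mult.commute flip: scaleR_diff_right)
  have C0: "0 \<le> C" using G0[of 0] norm_ge_zero order_trans by blast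
  have Kb: "K w \<in> bcontfun" for w
  proof (rule bcontfun_normI)
    show "continuous_on UNIV (K w)" unfolding K_def
      by (intro continuous_intros continuous_on_compose2[OF cJ]) auto
    fix t :: real
    define s where "s = max t 0"
    have s0: "0 \<le> s" by (simp add: s_def)
    have "norm (J w s - J w 0) \<le> (norm w * exp (2 * L * s) / 2 + C * s) - (norm w * exp (2 * L * 0) / 2 + C * 0)"
    proof (rule increment_bound[OF s0 J exp_primitive])
      fix r assume "r \<in> {0..s}"
      then have r: "0 \<le> r" by simp
      have "norm (G r (Y w r)) \<le> norm (G r (Y w r) - G r 0) + norm (G r 0)"
        by (metis diff_add_cancel norm_triangle_ineq)
      also have "\<dots> \<le> L * norm (Y w r) + C" using lip[OF r, of "Y w r" 0] G0[OF r] by simp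
      also have "\<dots> \<le> L * (norm w * exp (2 * L * r)) + C" using Yn[of w r] L by simp
      finally show "norm (G r (Y w r)) \<le> L * (norm w * exp (2 * L * r)) + C" .
    qed
    then have Js: "norm (J w s) \<le> norm w * exp (2 * L * s) / 2 + C * s"
      using norm_ge_zero[of w] unfolding J0 mult_zero_right exp_zero diff_zero by linarith
    have "2 * L * s \<le> exp (2 * L * s)" using exp_ge_add_one_self[of "2 * L * s"] by linarith
    then have sL: "s * exp (- (2 * L * s)) \<le> 1 / (2 * L)" using L by (simp add: exp_minus field_simps)
    have "norm (K w t) = exp (- (2 * L * s)) * norm (x + J w s)" by (simp add: K_def s_def)
    also have "\<dots> \<le> exp (- (2 * L * s)) * (norm x + (norm w * exp (2 * L * s) / 2 + C * s))"
      using norm_triangle_ineq[of x "J w s"] Js by (intro mult_left_mono) auto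
    also have "\<dots> = exp (- (2 * L * s)) * norm x + norm w / 2 + C * (s * exp (- (2 * L * s)))"
      by (simp add: algebra_simps exp_minus)
    also have "\<dots> \<le> 1 * norm x + norm w / 2 + C * (1 / (2 * L))"
      using L s0 C0 sL by (intro add_mono mult_right_mono mult_left_mono) auto
    finally show "norm (K w t) \<le> norm x + norm w / 2 + C * (1 / (2 * L))" by simp
  qed
  have apT: "apply_bcontfun (T w) = K w" for w unfolding T_def by (rule Bcontfun_inverse[OF Kb])
  have contr: "dist (T w) (T v) \<le> 1 / 2 * dist w v" for w v
  proof (rule dist_bound)
    fix t :: real
    define s where "s = max t 0"
    have s0: "0 \<le> s" by (simp add: s_def)
    have "norm ((J w s - J v s) - (J w 0 - J v 0)) \<le> (dist w v * exp (2 * L * s) / 2 + 0 * s) - (dist w v * exp (2 * L * 0) / 2 + 0 * 0)"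
    proof (rule increment_bound[OF s0 has_vector_derivative_diff[OF J J] exp_primitive])
      fix r assume "r \<in> {0..s}"
      then have r: "0 \<le> r" by simp
      have "norm (G r (Y w r) - G r (Y v r)) \<le> L * norm (Y w r - Y v r)" by (rule lip[OF r])
      also have "\<dots> \<le> L * (dist w v * exp (2 * L * r))" using Yd[of w r v] L by simp
      finally show "norm (G r (Y w r) - G r (Y v r)) \<le> L * (dist w v * exp (2 * L * r)) + 0" by simp
    qed auto
    then have "norm (J w s - J v s) \<le> dist w v * exp (2 * L * s) / 2" 
      using zero_le_dist[of w v] unfolding J0 mult_zero_right mult_zero_left exp_zero diff_zero by linarith
    then have "exp (- (2 * L * s)) * norm (J w s - J v s) \<le> exp (- (2 * L * s)) * (dist w v * exp (2 * L * s) / 2)"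
      by (intro mult_left_mono) auto
    also have "\<dots> = 1 / 2 * dist w v" by (simp add: exp_minus)
    finally show "dist (apply_bcontfun (T w) t) (apply_bcontfun (T v) t) \<le> 1 / 2 * dist w v"
      by (simp add: apT K_def dist_norm s_def flip: scaleR_diff_right)
  qed
  have "\<exists>!w. T w = w"
    by (rule banach_fix_type[where c = "1 / 2"]) (use contr in auto)
  then obtain w where w: "T w = w" by blast
  have Y: "Y w t = x + J w t" if "0 \<le> t" for t
  proof -
    have "apply_bcontfun w t = K w t" using apT[of w] w by simp
    then show ?thesis using that by (simp add: Y_def K_def exp_minus)
  qed
  show ?thesis
  proof (intro exI[of _ "Y w"] conjI allI impI)
    show "Y w 0 = x" by (simp add: Y J0)
    fix t :: real assume t: "0 \<le> t"
    have "((\<lambda>t. x + J w t) has_vector_derivative 0 + G t (Y w t)) (at t within {0..t+1})"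
      using t by (intro has_vector_derivative_add has_vector_derivative_const J) auto
    then have "(Y w has_vector_derivative G t (Y w t)) (at t within {0..t+1})"
      using t by (subst has_vector_derivative_cong_ev[where g = "\<lambda>t. x + J w t"]) (auto simp: Y eventually_at_filter)
    then show "(Y w has_vector_derivative G t (Y w t)) (at t within {0..})"
      by (simp add: at_within_half_line)
  qed
qed


section \<open>Flows and their derivatives\<close>

text \<open>
  Fields with bounded and uniformly continuous derivative. Forward time is enough: a point of an invariant graph
  is reached by forward orbits from its past.
\<close>

locale C1_field =
  fixes F :: "'e::euclidean_space \<Rightarrow> 'e" and DF :: "'e \<Rightarrow> 'e \<Rightarrow>\<^sub>L 'e" and L :: real
  assumes L: "0 < L"
    and F_deriv: "\<And>z. (F has_derivative DF z) (at z)"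
    and DF_le: "\<And>z. norm (DF z) \<le> L"
    and DF_uc: "uniformly_continuous_on UNIV DF"
begin

lemma F_Lipschitz: "norm (F x - F y) \<le> L * norm (x - y)"
  using differentiable_bound[OF convex_UNIV, of F "\<lambda>z. blinfun_apply (DF z)" L x y] F_deriv DF_le
  by (simp add: norm_blinfun.rep_eq)

lemma F_continuous: "continuous_on S F"
  using F_deriv by (meson continuous_at_imp_continuous_on has_derivative_continuous)

definition flow :: "real \<Rightarrow> 'e \<Rightarrow> 'e" where
  "flow t z = (SOME y. y 0 = z \<and> (\<forall>t\<ge>0. (y has_vector_derivative F (y t)) (at t within {0..}))) t"

lemma flow_0 [simp]: "flow 0 z = z"
  and flow_deriv: "0 \<le> t \<Longrightarrow> ((\<lambda>t. flow t z) has_vector_derivative F (flow t z)) (at t within {0..})"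
proof -
  have "\<exists>y. y 0 = z \<and> (\<forall>t\<ge>0. (y has_vector_derivative F (y t)) (at t within {0..}))"
  proof (rule ode_exists[where G = "\<lambda>_. F" and C = "norm (F 0)"])
    show "continuous_on ({0..} \<times> UNIV) (\<lambda>(t::real, x). F x)"
      unfolding case_prod_unfold by (intro continuous_on_compose2[OF F_continuous[of UNIV]] continuous_intros) auto
  qed (use L F_Lipschitz in auto)
  from someI_ex[OF this] show "flow 0 z = z"
    "0 \<le> t \<Longrightarrow> ((\<lambda>t. flow t z) has_vector_derivative F (flow t z)) (at t within {0..})"
    unfolding flow_def by auto
qed

lemma flow_deriv_Icc:
  assumes "t \<in> {0..T}"
  shows "((\<lambda>t. flow t z) has_vector_derivative F (flow t z)) (at t within {0..T})"
  by (rule has_vector_derivative_within_subset[OF flow_deriv]) (use assms in auto)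

lemma flow_unique:
  assumes y: "\<And>t. t \<in> {0..T} \<Longrightarrow> (y has_vector_derivative F (y t)) (at t within {0..T})" and t: "t \<in> {0..T}"
  shows "y t = flow t (y 0)"
  by (rule ode_unique[where G = "\<lambda>_. F" and L = L and T = T])
    (use F_Lipschitz L y flow_deriv_Icc t in auto)

lemma flow_add:
  assumes "0 \<le> s" "0 \<le> t"
  shows "flow (t + s) z = flow t (flow s z)"
proof -
  have "flow (t + s) z = flow t (flow (0 + s) z)"
  proof (rule flow_unique[where T = t and y = "\<lambda>t. flow (t + s) z"])
    fix r assume r: "r \<in> {0..t}"
    have "((\<lambda>t. flow t z) has_vector_derivative F (flow (r + s) z)) (at (r + s) within (\<lambda>r. r + s) ` {0..t})"
      by (rule has_vector_derivative_within_subset[OF flow_deriv]) (use assms r in auto)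
    then have "((\<lambda>t. flow t z) \<circ> (\<lambda>r. r + s) has_vector_derivative 1 *\<^sub>R F (flow (r + s) z)) (at r within {0..t})"
      by (intro vector_diff_chain_within) (auto intro!: derivative_eq_intros)
    then show "((\<lambda>t. flow (t + s) z) has_vector_derivative F (flow (r + s) z)) (at r within {0..t})"
      by (simp add: o_def)
  qed (use assms in auto)
  then show ?thesis by simp
qed

lemma flow_Lipschitz:
  assumes "t \<in> {0..T}"
  shows "norm (flow t x - flow t z) \<le> 2 * exp (2 * L * T) * norm (x - z)"
proof -
  have "norm (flow t x - flow t z) \<le> 2 * (norm (flow 0 x - flow 0 z) + 0 * T) * exp (2 * L * t)"
    by (rule ode_bound[OF _ _ has_vector_derivative_diff[OF flow_deriv_Icc flow_deriv_Icc]])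
      (use F_Lipschitz L assms in auto)
  also have "\<dots> \<le> 2 * (norm (flow 0 x - flow 0 z) + 0 * T) * exp (2 * L * T)"
    using L assms by (intro mult_left_mono) auto
  finally show ?thesis by (simp add: mult_ac)
qed

lemma flow_displacement:
  assumes "0 \<le> t" and M: "\<And>x. norm (F x) \<le> M"
  shows "norm (flow t z - z) \<le> M * t"
  using increment_bound[OF assms(1) flow_deriv_Icc, of "\<lambda>t. M * t" "\<lambda>_. M" z] M
  by (auto intro!: derivative_eq_intros simp flip: has_real_derivative_iff_has_vector_derivative)

lemma flow_continuous: "continuous_on {0..} (\<lambda>t. flow t z)"
  using flow_deriv by (intro vector_derivative_imp_continuous_on) auto

lemma DF_continuous: "continuous_on UNIV DF"
  using DF_uc by (rule uniformly_continuous_imp_continuous)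

text \<open>
  The solution of the variational equation along the orbit of \<open>z\<close>, starting at the identity.
\<close>

definition dflow :: "real \<Rightarrow> 'e \<Rightarrow> 'e \<Rightarrow>\<^sub>L 'e" where
  "dflow t z = (SOME W. W 0 = id_blinfun \<and>
     (\<forall>t\<ge>0. (W has_vector_derivative (DF (flow t z) o\<^sub>L W t)) (at t within {0..}))) t"

lemma dflow_0 [simp]: "dflow 0 z = id_blinfun"
  and dflow_deriv: "0 \<le> t \<Longrightarrow> ((\<lambda>t. dflow t z) has_vector_derivative (DF (flow t z) o\<^sub>L dflow t z)) (at t within {0..})"
proof -
  have "\<exists>W. W 0 = id_blinfun \<and> (\<forall>t\<ge>0. (W has_vector_derivative (DF (flow t z) o\<^sub>L W t)) (at t within {0..}))"
  proof (rule ode_exists[where G = "\<lambda>t W. DF (flow t z) o\<^sub>L W" and C = 0])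
    show "continuous_on ({0..} \<times> UNIV) (\<lambda>(t, W). DF (flow t z) o\<^sub>L (W :: 'e \<Rightarrow>\<^sub>L 'e))"
      unfolding case_prod_unfold
      by (intro bounded_bilinear.continuous_on[OF bounded_bilinear_blinfun_compose]
          continuous_on_compose2[OF DF_continuous] continuous_on_compose2[OF flow_continuous] continuous_intros) auto
    show "norm ((DF (flow t z) o\<^sub>L V) - (DF (flow t z) o\<^sub>L W)) \<le> L * norm (V - W)" for t and V W :: "'e \<Rightarrow>\<^sub>L 'e"
      unfolding bounded_bilinear.diff_right[OF bounded_bilinear_blinfun_compose, symmetric]
      by (rule order_trans[OF norm_blinfun_compose]) (intro mult_right_mono DF_le norm_ge_zero)
  qed (use L in auto)
  from someI_ex[OF this] show "dflow 0 z = id_blinfun"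
    "0 \<le> t \<Longrightarrow> ((\<lambda>t. dflow t z) has_vector_derivative (DF (flow t z) o\<^sub>L dflow t z)) (at t within {0..})"
    unfolding dflow_def by auto
qed

lemma dflow_deriv_Icc:
  assumes "t \<in> {0..T}"
  shows "((\<lambda>t. dflow t z) has_vector_derivative (DF (flow t z) o\<^sub>L dflow t z)) (at t within {0..T})"
  by (rule has_vector_derivative_within_subset[OF dflow_deriv]) (use assms in auto)

lemma dflow_apply_deriv_Icc:
  assumes "t \<in> {0..T}"
  shows "((\<lambda>t. dflow t z v) has_vector_derivative DF (flow t z) (dflow t z v)) (at t within {0..T})"
  using bounded_linear.has_vector_derivative[OF blinfun.bounded_linear_left dflow_deriv_Icc[OF assms]] by simp

lemma DF_compose_le: "norm (DF x o\<^sub>L W) \<le> L * norm (W :: 'e \<Rightarrow>\<^sub>L 'e)"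
  by (rule order_trans[OF norm_blinfun_compose]) (intro mult_right_mono DF_le norm_ge_zero)

lemma dflow_le:
  assumes "t \<in> {0..T}"
  shows "norm (dflow t z) \<le> 2 * exp (2 * L * T)"
proof -
  have "norm (dflow t z) \<le> 2 * (norm (dflow 0 z) + 0 * T) * exp (2 * L * t)"
    by (rule ode_bound[OF _ _ dflow_deriv_Icc]) (use DF_compose_le L assms in auto)
  also have "\<dots> \<le> 2 * exp (2 * L * T)"
    using L assms norm_blinfun_id_le[where 'a = 'e] by (simp add: mult_le_one mult_mono)
  finally show ?thesis .
qed

lemma F_linearization_error:
  assumes "0 < e"
  shows "\<exists>d>0. \<forall>x y. norm (y - x) < d \<longrightarrow> norm (F y - F x - DF x (y - x)) \<le> e * norm (y - x)"
proof -
  obtain d where d: "d > 0" and uc: "\<And>x y. dist x y < d \<Longrightarrow> dist (DF x) (DF y) < e"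
    using DF_uc[unfolded uniformly_continuous_on_def, rule_format, OF assms] by auto
  have "norm (F y - F x - DF x (y - x)) \<le> norm (y - x) * e" if xy: "norm (y - x) < d" for x y
  proof (rule linearization_error[OF convex_UNIV])
    fix w assume "norm (w - x) \<le> norm (y - x)"
    then show "norm (DF w - DF x) \<le> e" using uc[of w x] xy by (simp add: norm_minus_commute dist_norm)
  qed (use F_deriv in auto)
  then show ?thesis using d by (auto simp: mult.commute)
qed

text \<open>
  The remainder of the expansion of the flow solves the variational equation up to the Taylor error
  of the field, which is small relative to the distance of the two orbits.
\<close>

lemma flow_has_derivative:
  assumes T: "0 \<le> T"
  shows "((\<lambda>z. flow T z) has_derivative dflow T z) (at z)"
  unfolding has_derivative_at_alt
proof (intro conjI allI impI)
  show "bounded_linear (dflow T z)" by (rule blinfun.bounded_linear_right)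
  fix e :: real assume e: "e > 0"
  define K where "K = 2 * exp (2 * L * T)"
  have K: "K > 0" by (simp add: K_def)
  define e' where "e' = e / (K * K * (T + 1))"
  have e': "e' > 0" using e K T by (simp add: e'_def)
  obtain d where d: "d > 0"
    and lin: "\<And>x y. norm (y - x) < d \<Longrightarrow> norm (F y - F x - DF x (y - x)) \<le> e' * norm (y - x)"
    using F_linearization_error[OF e'] by blast
  show "\<exists>d>0. \<forall>y. norm (y - z) < d \<longrightarrow> norm (flow T y - flow T z - dflow T z (y - z)) \<le> e * norm (y - z)"
  proof (intro exI[of _ "d / K"] conjI allI impI)
    show "d / K > 0" using d K by simp
    fix y assume y: "norm (y - z) < d / K"
    let ?v = "y - z"
    define r where "r t = flow t y - flow t z - dflow t z ?v" for t
    define r' where "r' t = F (flow t y) - F (flow t z) - DF (flow t z) (dflow t z ?v)" for t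
    have r: "(r has_vector_derivative r' t) (at t within {0..T})" if "t \<in> {0..T}" for t
      unfolding r_def r'_def
      by (intro has_vector_derivative_diff flow_deriv_Icc dflow_apply_deriv_Icc that)
    have r'_le: "norm (r' t) \<le> L * norm (r t) + e' * K * norm ?v" if t: "t \<in> {0..T}" for t
    proof -
      let ?w = "flow t y - flow t z"
      have w: "norm ?w \<le> K * norm ?v" using flow_Lipschitz[OF t] by (simp add: K_def)
      also have "\<dots> < d" using y K by (simp add: field_simps)
      finally have "norm (F (flow t y) - F (flow t z) - DF (flow t z) ?w) \<le> e' * norm ?w" by (rule lin)
      also have "\<dots> \<le> e' * (K * norm ?v)" using w e' by simp
      finally have 1: "norm (F (flow t y) - F (flow t z) - DF (flow t z) ?w) \<le> e' * K * norm ?v" by simp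
      have "norm (DF (flow t z) (r t)) \<le> L * norm (r t)"
        by (intro order_trans[OF norm_blinfun] mult_right_mono DF_le norm_ge_zero)
      moreover have "r' t = DF (flow t z) (r t) + (F (flow t y) - F (flow t z) - DF (flow t z) ?w)"
        by (simp add: r_def r'_def blinfun.diff_right)
      ultimately show ?thesis using 1
        norm_triangle_ineq[of "DF (flow t z) (r t)" "F (flow t y) - F (flow t z) - DF (flow t z) ?w"] by simp
    qed
    have "norm (r T) \<le> 2 * (norm (r 0) + e' * K * norm ?v * T) * exp (2 * L * T)"
      by (rule ode_bound[OF _ _ r r'_le]) (use L T e' K in auto)
    also have "\<dots> = 2 * (e' * K * norm ?v * T) * (K / 2)"
      by (simp add: r_def K_def)
    also have "\<dots> = e' * K * K * (norm ?v * T)" by simp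
    also have "e' * K * K = e / (T + 1)" using K by (simp add: e'_def)
    also have "e / (T + 1) * (norm ?v * T) = e * norm ?v * (T / (T + 1))" by simp
    also have "\<dots> \<le> e * norm ?v * 1" using e T by (intro mult_left_mono) auto
    finally show "norm (flow T y - flow T z - dflow T z (y - z)) \<le> e * norm (y - z)" by (simp add: r_def)
  qed
qed

end

text \<open>
  Fields that are \<open>C\<^sup>1\<close>-close have flows that are \<open>C\<^sup>1\<close>-close on bounded time intervals, uniformly in the
  initial points, which may also differ slightly. The bound \<open>d\<close> depends on the perturbed field
  only through the common constant \<open>L\<close>: only the modulus of continuity of \<open>DF\<close> enters.
\<close>

lemma flow_perturbation:
  fixes F :: "'e::euclidean_space \<Rightarrow> 'e"
  assumes "C1_field F DF L" and T: "0 \<le> T" and e: "0 < e"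
  shows "\<exists>d>0. \<forall>F' DF' y z t. C1_field F' DF' L \<longrightarrow>
    (\<forall>x. norm (F' x - F x) \<le> d \<and> norm (DF' x - DF x) \<le> d) \<longrightarrow> norm (y - z) \<le> d \<longrightarrow> t \<in> {0..T} \<longrightarrow>
    norm (C1_field.flow F' t y - C1_field.flow F t z) \<le> e \<and>
    norm (C1_field.dflow F' DF' t y - C1_field.dflow F DF t z) \<le> e"
proof -
  interpret F: C1_field F DF L by fact
  define K where "K = 2 * exp (2 * L * T)"
  have K: "K > 0" by (simp add: K_def)
  define m where "m = e / (T + 1) / (2 * K * K)"
  have m: "m > 0" using e K T by (simp add: m_def)
  obtain d0 where d0: "d0 > 0" and uc: "\<And>x y. dist x y < d0 \<Longrightarrow> dist (DF x) (DF y) < m"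
    using F.DF_uc[unfolded uniformly_continuous_on_def, rule_format, OF m] by auto
  define d where "d = min m (min e (d0 / 2) / (K * (T + 1)))"
  have d: "d > 0" using m e d0 K T by (simp add: d_def)
  have dm: "d \<le> m" by (simp add: d_def)
  have dK: "(1 + T) * d * K \<le> min e (d0 / 2)"
  proof -
    have "d \<le> min e (d0 / 2) / (K * (T + 1))" by (simp add: d_def)
    then show ?thesis using K T by (simp add: pos_le_divide_eq mult_ac add_ac)
  qed
  show ?thesis
  proof (intro exI[of _ d] conjI[OF d] allI impI)
    fix F' DF' and y z :: 'e and t :: real
    assume "C1_field F' DF' L" and close: "\<forall>x. norm (F' x - F x) \<le> d \<and> norm (DF' x - DF x) \<le> d"
      and yz: "norm (y - z) \<le> d" and t: "t \<in> {0..T}"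
    interpret F': C1_field F' DF' L by fact
    have c: "norm (F'.flow t y - F.flow t z) \<le> min e (d0 / 2)" if t: "t \<in> {0..T}" for t
    proof -
      have "norm (F'.flow t y - F.flow t z) \<le> 2 * (norm (F'.flow 0 y - F.flow 0 z) + d * T) * exp (2 * L * t)"
      proof (rule ode_bound[OF _ _ has_vector_derivative_diff[OF F'.flow_deriv_Icc F.flow_deriv_Icc] _ t])
        fix t
        show "norm (F' (F'.flow t y) - F (F.flow t z)) \<le> L * norm (F'.flow t y - F.flow t z) + d"
          using norm_triangle_ineq[of "F' (F'.flow t y) - F (F'.flow t y)" "F (F'.flow t y) - F (F.flow t z)"]
            close[rule_format, of "F'.flow t y"] F.F_Lipschitz[of "F'.flow t y" "F.flow t z"] by simp
      qed (use F.L d in auto)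
      also have "\<dots> \<le> 2 * (d + d * T) * exp (2 * L * T)"
        using F.L t yz d T by (intro mult_mono) auto
      also have "\<dots> = (1 + T) * d * K" by (simp add: K_def algebra_simps)
      finally show ?thesis using dK by linarith
    qed
    have 1: "norm (F'.flow t y - F.flow t z) \<le> e" using c[OF t] by simp
    have "norm (F'.dflow t y - F.dflow t z) \<le> 2 * (norm (F'.dflow 0 y - F.dflow 0 z) + 2 * m * K * T) * exp (2 * L * t)"
    proof (rule ode_bound[OF _ _ has_vector_derivative_diff[OF F'.dflow_deriv_Icc F.dflow_deriv_Icc] _ t])
      fix t assume t: "t \<in> {0..T}"
      let ?A = "DF' (F'.flow t y)" and ?B = "DF (F.flow t z)" and ?V = "F'.dflow t y" and ?W = "F.dflow t z"
      have "norm (?A - ?B) \<le> norm (?A - DF (F'.flow t y)) + norm (DF (F'.flow t y) - ?B)"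
        using norm_triangle_ineq[of "?A - DF (F'.flow t y)" "DF (F'.flow t y) - ?B"] by simp
      also have "\<dots> \<le> m + m"
      proof (rule add_mono)
        show "norm (?A - DF (F'.flow t y)) \<le> m" using close dm order_trans by blast
        show "norm (DF (F'.flow t y) - ?B) \<le> m"
          using uc[of "F'.flow t y" "F.flow t z"] c[OF t] d0 by (simp add: dist_norm)
      qed
      finally have "norm ((?A - ?B) o\<^sub>L ?W) \<le> 2 * m * K"
        using F.dflow_le[OF t, of z] K m
        by (intro order_trans[OF norm_blinfun_compose] mult_mono) (auto simp: K_def)
      moreover have "norm (?A o\<^sub>L (?V - ?W)) \<le> L * norm (?V - ?W)" by (rule F'.DF_compose_le)
      moreover have "(?A o\<^sub>L ?V) - (?B o\<^sub>L ?W) = (?A o\<^sub>L (?V - ?W)) + ((?A - ?B) o\<^sub>L ?W)"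
        by (simp add: blinfun_compose_diff)
      ultimately show "norm ((?A o\<^sub>L ?V) - (?B o\<^sub>L ?W)) \<le> L * norm (?V - ?W) + 2 * m * K"
        using norm_triangle_ineq[of "?A o\<^sub>L (?V - ?W)" "(?A - ?B) o\<^sub>L ?W"] by simp
    qed (use F.L m K in auto)
    also have "\<dots> \<le> 2 * (2 * m * K * T) * exp (2 * L * T)"
      using F.L t m K T by (auto intro!: mult_left_mono)
    also have "\<dots> = 2 * (2 * m * K * T) * (K / 2)" by (simp add: K_def)
    also have "\<dots> = m * (2 * K * K) * T" by simp
    also have "m * (2 * K * K) = e / (T + 1)"
      using K by (subst nonzero_eq_divide_eq[symmetric]) (auto simp: m_def)
    also have "e / (T + 1) * T = e * (T / (T + 1))" by simp
    also have "\<dots> \<le> e * 1" using e T by (intro mult_left_mono) auto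
    finally show "norm (F'.flow t y - F.flow t z) \<le> e \<and> norm (F'.dflow t y - F.dflow t z) \<le> e"
      using 1 by simp
  qed
qed


section \<open>Calculus on the torus and its cotangent bundle\<close>

text \<open>
  Each point can be moved into \<open>K\<close> by a symmetry of \<open>g\<close>, or has a neighbourhood on which \<open>g\<close> is
  constant. This covers periodic functions, and functions on the cotangent bundle that are periodic in the
  base and constant for large momenta.
\<close>

lemma uniformly_continuous_periodic:
  fixes g :: "'e::euclidean_space \<Rightarrow> 'f::metric_space"
  assumes g: "continuous_on UNIV g" and K: "compact K"
    and period: "\<And>z. (\<exists>m. z + m \<in> K \<and> (\<forall>y. g (y + m) = g y)) \<or> (\<forall>y. dist z y < 1 \<longrightarrow> g y = c)"
  shows "uniformly_continuous_on UNIV g" "bounded (range g)"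
proof -
  obtain B where B: "\<And>z. z \<in> K \<Longrightarrow> norm z \<le> B"
    using compact_imp_bounded[OF K] unfolding bounded_iff by blast
  have "uniformly_continuous_on (cball 0 (B + 1)) g"
    by (rule compact_uniformly_continuous[OF continuous_on_subset[OF g]]) auto
  show "uniformly_continuous_on UNIV g" unfolding uniformly_continuous_on_def
  proof (intro allI impI)
    fix e :: real assume e: "e > 0"
    obtain d where d: "d > 0" and uc: "\<And>x y. x \<in> cball 0 (B + 1) \<Longrightarrow> y \<in> cball 0 (B + 1) \<Longrightarrow> dist y x < d \<Longrightarrow> dist (g y) (g x) < e"
      using \<open>uniformly_continuous_on (cball 0 (B + 1)) g\<close>[unfolded uniformly_continuous_on_def, rule_format, OF e]
      by blast
    show "\<exists>d>0. \<forall>x\<in>UNIV. \<forall>x'\<in>UNIV. dist x' x < d \<longrightarrow> dist (g x') (g x) < e"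
    proof (intro exI[of _ "min d 1"] conjI ballI impI)
      fix x y :: 'e assume xy: "dist y x < min d 1"
      from period[of x] show "dist (g y) (g x) < e"
      proof (elim disjE exE conjE)
        fix m assume m: "x + m \<in> K" "\<forall>y. g (y + m) = g y"
        have "norm (y + m) \<le> norm (x + m) + norm (y - x)"
          using norm_triangle_ineq[of "x + m" "y - x"] by (simp add: add.commute)
        then have "norm (y + m) \<le> B + 1" using B[OF m(1)] xy by (simp add: dist_norm)
        then have "dist (g (y + m)) (g (x + m)) < e"
          using uc[of "x + m" "y + m"] B[OF m(1)] xy by simp
        then show ?thesis using m(2) by simp
      next
        assume "\<forall>y. dist x y < 1 \<longrightarrow> g y = c"
        then show ?thesis using xy e by (simp add: dist_commute)
      qed
    qed (use d in auto)
  qed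
  have "range g \<subseteq> insert c (g ` K)"
  proof clarify
    fix z assume "g z \<notin> g ` K"
    then show "g z = c" using period[of z] by (metis dist_self image_eqI zero_less_one)
  qed
  moreover have "bounded (insert c (g ` K))"
    using compact_imp_bounded[OF compact_continuous_image[OF continuous_on_subset[OF g] K]] by simp
  ultimately show "bounded (range g)" by (rule bounded_subset[rotated])
qed

lemma int_vec_reduce: "\<exists>m. int_vec m \<and> x + m \<in> cbox 0 (1 :: real ^ 'n)"
proof (intro exI conjI)
  show "int_vec (\<chi> i. - of_int \<lfloor>x $ i\<rfloor>)" by (simp add: int_vec_def)
  show "x + (\<chi> i. - of_int \<lfloor>x $ i\<rfloor>) \<in> cbox 0 1"
    by (auto simp: mem_box_cart frac_def[symmetric] less_imp_le[OF frac_lt_1])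
qed

lemma int_vec_uminus: "int_vec m \<Longrightarrow> int_vec (- m)"
  by (simp add: int_vec_def)

lemma uniformly_continuous_torus:
  fixes g :: "real ^ 'n \<Rightarrow> 'f::metric_space"
  assumes g: "continuous_on UNIV g" and period: "\<And>x m. int_vec m \<Longrightarrow> g (x + m) = g x"
  shows "uniformly_continuous_on UNIV g" "bounded (range g)"
proof -
  have *: "(\<exists>m. z + m \<in> cbox 0 1 \<and> (\<forall>y. g (y + m) = g y)) \<or> (\<forall>y. dist z y < 1 \<longrightarrow> g y = undefined)" for z
    using int_vec_reduce[of z] period by blast
  show "uniformly_continuous_on UNIV g" "bounded (range g)"
    using uniformly_continuous_periodic[OF g compact_cbox *] by blast+
qed

lemma uniformly_continuous_cotangent:
  fixes g :: "(real ^ 'n) \<times> (real ^ 'n) \<Rightarrow> 'f::metric_space"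
  assumes g: "continuous_on UNIV g" and period: "\<And>x p m. int_vec m \<Longrightarrow> g (x + m, p) = g (x, p)"
    and support: "\<And>x p. R \<le> norm p \<Longrightarrow> g (x, p) = c"
  shows "uniformly_continuous_on UNIV g" "bounded (range g)"
proof -
  have *: "(\<exists>m. z + m \<in> cbox 0 1 \<times> cball 0 (R + 1) \<and> (\<forall>y. g (y + m) = g y)) \<or> (\<forall>y. dist z y < 1 \<longrightarrow> g y = c)" for z
  proof (cases "norm (snd z) \<le> R + 1")
    case True
    obtain m where m: "int_vec m" "fst z + m \<in> cbox 0 1" using int_vec_reduce by blast
    then have "z + (m, 0) \<in> cbox 0 1 \<times> cball 0 (R + 1)" using True by (cases z) auto
    moreover have "\<forall>y. g (y + (m, 0)) = g y" using period[OF m(1)] by auto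
    ultimately show ?thesis by (intro disjI1 exI[of _ "(m, 0)"] conjI)
  next
    case False
    have "g y = c" if "dist z y < 1" for y
    proof -
      have "norm (snd z - snd y) < 1"
        using that norm_snd_le'[of "z - y"] by (simp add: dist_norm)
      then have "R \<le> norm (snd y)" using False norm_triangle_ineq2[of "snd z" "snd y"] by linarith
      then show ?thesis using support[of "snd y" "fst y"] by simp
    qed
    then show ?thesis by blast
  qed
  show "uniformly_continuous_on UNIV g" "bounded (range g)"
    using uniformly_continuous_periodic[OF g compact_Times[OF compact_cbox compact_cball] *] by blast+
qed

text \<open>
  The derivative as a bounded linear map, so that its continuity is continuity in the operator norm.
\<close>

definition D :: "('a::euclidean_space \<Rightarrow> 'b::real_normed_vector) \<Rightarrow> 'a \<Rightarrow> 'a \<Rightarrow>\<^sub>L 'b" where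
  "D f z = Blinfun (frechet_derivative f (at z))"

lemma D_eqI:
  assumes "(f has_derivative blinfun_apply A) (at z)"
  shows "D f z = A"
  unfolding D_def frechet_derivative_at[OF assms, symmetric] by (rule blinfun_apply_inverse)

lemma D_apply: "f differentiable at z \<Longrightarrow> blinfun_apply (D f z) = frechet_derivative f (at z)"
  unfolding D_def
  by (rule bounded_linear_Blinfun_apply[OF has_derivative_bounded_linear]) (simp add: frechet_derivative_works)

lemma C_class_Suc_D: "C_class (Suc k) f \<Longrightarrow> C_class k f"
proof (induction k arbitrary: f)
  case 0
  then show ?case
    by (auto intro!: continuous_at_imp_continuous_on differentiable_imp_continuous_within)
next
  case (Suc k)
  have "C_class (Suc k) (\<lambda>z. frechet_derivative f (at z) v)" for v
    using Suc.prems by (subst (asm) C_class.simps(2)) blast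
  then show ?case using Suc by (simp del: C_class.simps(1))
qed

lemma C_class_antimono: "C_class n f \<Longrightarrow> k \<le> n \<Longrightarrow> C_class k f"
  by (induction n) (auto simp: le_Suc_eq dest: C_class_Suc_D simp del: C_class.simps)

lemma C1_D:
  assumes "C_class 1 f"
  shows "(f has_derivative D f z) (at z)" "continuous_on UNIV (D f)" "continuous_on S f"
proof -
  have diff: "f differentiable at z" for z using assms by simp
  show "(f has_derivative D f z) (at z)" for z
    unfolding D_apply[OF diff] using diff by (simp add: frechet_derivative_works)
  show "continuous_on UNIV (D f)"
    using assms by (intro continuous_on_blinfun_componentwise) (simp add: D_apply diff)
  show "continuous_on S f"
    using C_class_Suc_D[of 0 f] assms by (auto intro: continuous_on_subset)
qed

lemma C1_I:
  assumes "\<And>z. (f has_derivative blinfun_apply (A z)) (at z)" "continuous_on UNIV A"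
  shows "C_class 1 f"
proof -
  have "frechet_derivative f (at z) = blinfun_apply (A z)" for z
    using frechet_derivative_at[OF assms(1)] by simp
  then show ?thesis using assms
    by (auto intro: differentiableI intro!: continuous_intros)
qed

lemma C2_differentiable: "C_class 2 H \<Longrightarrow> H differentiable at z"
  and C2_directional: "C_class 2 H \<Longrightarrow> C_class 1 (\<lambda>z. frechet_derivative H (at z) v)"
  and C1_differentiable: "C_class 1 f \<Longrightarrow> f differentiable at z"
  unfolding numeral_2_eq_2 One_nat_def C_class.simps(2) by blast+

text \<open>
  Two applications of the mean value theorem express the second difference of \<open>H\<close>, which is symmetric in
  \<open>u\<close> and \<open>v\<close>, by a mixed second derivative nearby.
\<close>

lemma second_difference:
  fixes H :: "'a::euclidean_space \<Rightarrow> real"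
  assumes "C_class 2 H" and h: "0 < h"
  shows "\<exists>s t. 0 < s \<and> s < h \<and> 0 < t \<and> t < h \<and>
    H (z + h *\<^sub>R u + h *\<^sub>R v) - H (z + h *\<^sub>R u) - H (z + h *\<^sub>R v) + H z =
    h * h * frechet_derivative (\<lambda>y. frechet_derivative H (at y) u) (at (z + s *\<^sub>R u + t *\<^sub>R v)) v"
proof -
  have C1: "C_class 1 H" using C_class_antimono[OF assms(1), of 1] by simp
  have dH: "(H has_derivative frechet_derivative H (at y)) (at y)" for y
    by (rule frechet_derivative_works[THEN iffD1]) (rule C1_differentiable[OF C1])
  have dDH: "((\<lambda>y. frechet_derivative H (at y) u) has_derivative
      frechet_derivative (\<lambda>y. frechet_derivative H (at y) u) (at y)) (at y)" for y
    by (rule frechet_derivative_works[THEN iffD1]) (rule C1_differentiable[OF C2_directional[OF assms(1)]])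
  have line: "((\<lambda>s. f (a + s *\<^sub>R w)) has_real_derivative f' (a + s *\<^sub>R w) w) (at s)"
    if f: "\<And>y. (f has_derivative f' y) (at y)" for f f' a w s and y :: 'a
  proof -
    have "((\<lambda>s. a + s *\<^sub>R w) has_derivative (\<lambda>h. h *\<^sub>R w)) (at s)"
      by (auto intro!: derivative_eq_intros)
    from has_derivative_compose[OF this f]
    have "((\<lambda>s. f (a + s *\<^sub>R w)) has_derivative (\<lambda>h. f' (a + s *\<^sub>R w) (h *\<^sub>R w))) (at s)" .
    then show ?thesis
      using linear_cmul[OF has_derivative_linear[OF f[of "a + s *\<^sub>R w"]]]
      by (simp add: has_field_derivative_def mult_commute_abs)
  qed
  have "\<exists>s. s > 0 \<and> s < h \<and> (H (z + h *\<^sub>R v + h *\<^sub>R u) - H (z + h *\<^sub>R u)) - (H (z + h *\<^sub>R v + 0 *\<^sub>R u) - H (z + 0 *\<^sub>R u)) =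
      (h - 0) * (frechet_derivative H (at (z + h *\<^sub>R v + s *\<^sub>R u)) u - frechet_derivative H (at (z + s *\<^sub>R u)) u)"
    using h by (intro MVT2) (auto intro!: DERIV_diff line dH)
  then obtain s where s: "s > 0" "s < h" and 1: "H (z + h *\<^sub>R u + h *\<^sub>R v) - H (z + h *\<^sub>R u) - H (z + h *\<^sub>R v) + H z =
      h * (frechet_derivative H (at (z + s *\<^sub>R u + h *\<^sub>R v)) u - frechet_derivative H (at (z + s *\<^sub>R u + 0 *\<^sub>R v)) u)"
    by (auto simp: algebra_simps)
  have "\<exists>t. t > 0 \<and> t < h \<and> frechet_derivative H (at (z + s *\<^sub>R u + h *\<^sub>R v)) u - frechet_derivative H (at (z + s *\<^sub>R u + 0 *\<^sub>R v)) u =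
      (h - 0) * frechet_derivative (\<lambda>y. frechet_derivative H (at y) u) (at (z + s *\<^sub>R u + t *\<^sub>R v)) v"
    using h by (intro MVT2) (auto intro!: line dDH)
  then show ?thesis using s unfolding 1 by auto
qed

lemma second_derivative_symmetric:
  fixes H :: "'a::euclidean_space \<Rightarrow> real"
  assumes "C_class 2 H"
  shows "frechet_derivative (\<lambda>y. frechet_derivative H (at y) u) (at z) v =
         frechet_derivative (\<lambda>y. frechet_derivative H (at y) v) (at z) u"
proof -
  define S where "S u v y = frechet_derivative (\<lambda>y. frechet_derivative H (at y) u) (at y) v" for u v y
  have cS: "continuous_on UNIV (S u v)" for u v
    unfolding S_def using assms by (simp add: numeral_2_eq_2)
  have near: "\<exists>d>0. \<forall>h s t. 0 < h \<longrightarrow> h < d \<longrightarrow> 0 < s \<longrightarrow> s < h \<longrightarrow> 0 < t \<longrightarrow> t < h \<longrightarrow>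
      \<bar>S u v (z + s *\<^sub>R u + t *\<^sub>R v) - S u v z\<bar> < e" if e: "e > 0" for e u v
  proof -
    obtain d where d: "d > 0" and c: "\<And>y. dist y z < d \<Longrightarrow> dist (S u v y) (S u v z) < e"
      using cS[of u v, unfolded continuous_on_iff, rule_format, of z e] e by auto
    show ?thesis
    proof (intro exI[of _ "d / (norm u + norm v + 1)"] conjI allI impI)
      show pos: "d / (norm u + norm v + 1) > 0" using d by (simp add: add_nonneg_pos)
      fix h s t assume *: "0 < h" "h < d / (norm u + norm v + 1)" "0 < s" "s < h" "0 < t" "t < h"
      have n: "0 < norm u + norm v + 1" by (simp add: add_nonneg_pos)
      have "norm (s *\<^sub>R u + t *\<^sub>R v) \<le> s * norm u + t * norm v"
        using norm_triangle_ineq[of "s *\<^sub>R u" "t *\<^sub>R v"] * by simp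
      also have "\<dots> \<le> h * norm u + h * norm v" using * by (intro add_mono mult_right_mono) auto
      also have "\<dots> \<le> h * (norm u + norm v + 1)" using * by (simp add: distrib_left)
      also have "\<dots> < d" using *(2) n by (simp add: pos_less_divide_eq)
      finally show "\<bar>S u v (z + s *\<^sub>R u + t *\<^sub>R v) - S u v z\<bar> < e"
        using c[of "z + s *\<^sub>R u + t *\<^sub>R v"] by (simp add: dist_norm add.assoc)
    qed
  qed
  have "\<bar>S u v z - S v u z\<bar> \<le> e" if e: "e > 0" for e
  proof -
    have e2: "e / 2 > 0" using e by simp
    obtain d1 where d1: "d1 > 0" "\<forall>h s t. 0 < h \<longrightarrow> h < d1 \<longrightarrow> 0 < s \<longrightarrow> s < h \<longrightarrow> 0 < t \<longrightarrow> t < h \<longrightarrow>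
      \<bar>S u v (z + s *\<^sub>R u + t *\<^sub>R v) - S u v z\<bar> < e / 2" using near[OF e2, of u v] by blast
    obtain d2 where d2: "d2 > 0" "\<forall>h s t. 0 < h \<longrightarrow> h < d2 \<longrightarrow> 0 < s \<longrightarrow> s < h \<longrightarrow> 0 < t \<longrightarrow> t < h \<longrightarrow>
      \<bar>S v u (z + s *\<^sub>R v + t *\<^sub>R u) - S v u z\<bar> < e / 2" using near[OF e2, of v u] by blast
    define h where "h = min d1 d2 / 2"
    have h: "0 < h" "h < d1" "h < d2" using d1 d2 by (auto simp: h_def)
    obtain s t where st: "0 < s" "s < h" "0 < t" "t < h"
      "H (z + h *\<^sub>R u + h *\<^sub>R v) - H (z + h *\<^sub>R u) - H (z + h *\<^sub>R v) + H z = h * h * S u v (z + s *\<^sub>R u + t *\<^sub>R v)"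
      using second_difference[OF assms h(1), of z u v] unfolding S_def by blast
    obtain s' t' where st': "0 < s'" "s' < h" "0 < t'" "t' < h"
      "H (z + h *\<^sub>R v + h *\<^sub>R u) - H (z + h *\<^sub>R v) - H (z + h *\<^sub>R u) + H z = h * h * S v u (z + s' *\<^sub>R v + t' *\<^sub>R u)"
      using second_difference[OF assms h(1), of z v u] unfolding S_def by blast
    have "h * h * S u v (z + s *\<^sub>R u + t *\<^sub>R v) = h * h * S v u (z + s' *\<^sub>R v + t' *\<^sub>R u)"
      using st(5) st'(5) by (simp add: algebra_simps)
    then have "S u v (z + s *\<^sub>R u + t *\<^sub>R v) = S v u (z + s' *\<^sub>R v + t' *\<^sub>R u)" using h by simp
    moreover have "\<bar>S u v (z + s *\<^sub>R u + t *\<^sub>R v) - S u v z\<bar> < e / 2" using d1(2) h st by blast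
    moreover have "\<bar>S v u (z + s' *\<^sub>R v + t' *\<^sub>R u) - S v u z\<bar> < e / 2" using d2(2) h st' by blast
    ultimately show ?thesis by linarith
  qed
  then have "\<bar>S u v z - S v u z\<bar> \<le> 0" by (rule field_le_epsilon) simp
  then show ?thesis by (simp add: S_def)
qed



section \<open>Conformally symplectic fields\<close>

text \<open>
  The complex structure that turns the symplectic form into the inner product.
\<close>

definition J :: "(real ^ 'n) \<times> (real ^ 'n) \<Rightarrow> (real ^ 'n) \<times> (real ^ 'n)" where
  "J w = (- snd w, fst w)"

lemma norm_J [simp]: "norm (J w) = norm w"
  by (simp add: J_def norm_prod_def add.commute)

lemma J_J [simp]: "J (J w) = - w"
  by (simp add: J_def prod_eq_iff)

lemma symp_form_inner: "symp_form a b = a \<bullet> J b"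
  unfolding symp_form_def J_def inner_prod_def inner_vec_def sum.distrib[symmetric]
  by (rule sum.cong) (simp_all add: mult.commute)

lemma symp_form_swap: "symp_form a b = - symp_form b a"
  unfolding symp_form_def sum_negf[symmetric] by (rule sum.cong) (simp_all add: mult.commute)

lemma vec_axis_sum: "(v :: real ^ 'n) = (\<Sum>i\<in>UNIV. v $ i *\<^sub>R axis i 1)"
  by (simp add: vec_eq_iff axis_def if_distrib cong: if_cong)

text \<open>
  Testing the field against a vector avoids coordinates: the Hamiltonian part is \<open>dH\<close> composed with \<open>J\<close>.
\<close>

lemma cs_field_inner:
  fixes H :: "(real ^ 'n) \<times> (real ^ 'n) \<Rightarrow> real"
  assumes "H differentiable at z"
  shows "cs_field H lam z \<bullet> w = frechet_derivative H (at z) (J w) - lam * (snd z \<bullet> snd w)"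
proof -
  let ?D = "frechet_derivative H (at z)"
  have lin: "linear ?D" using assms by (simp add: frechet_derivative_works has_derivative_linear)
  have p: "(\<Sum>i\<in>UNIV. ?D (0, axis i 1) * v $ i) = ?D (0, v)" for v :: "real ^ 'n"
  proof -
    have "(0, v) = (\<Sum>i\<in>UNIV. v $ i *\<^sub>R (0 :: real ^ 'n, axis i 1))"
      by (subst (1) vec_axis_sum[of v]) (simp add: prod_eq_iff fst_sum snd_sum)
    then show ?thesis by (simp add: linear_sum[OF lin] linear_cmul[OF lin] mult.commute del: scaleR_Pair)
  qed
  have x: "(\<Sum>i\<in>UNIV. ?D (axis i 1, 0) * v $ i) = ?D (v, 0)" for v :: "real ^ 'n"
  proof -
    have "(v, 0) = (\<Sum>i\<in>UNIV. v $ i *\<^sub>R (axis i 1, 0 :: real ^ 'n))"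
      by (subst (1) vec_axis_sum[of v]) (simp add: prod_eq_iff fst_sum snd_sum)
    then show ?thesis by (simp add: linear_sum[OF lin] linear_cmul[OF lin] mult.commute del: scaleR_Pair)
  qed
  have "?D (J w) = ?D (0, fst w) - ?D (snd w, 0)"
    by (simp add: J_def flip: linear_diff[OF lin])
  then show ?thesis
    using p[of "fst w"] x[of "snd w"]
    by (simp add: cs_field_def inner_prod_def H_p_def H_x_def inner_vec_def sum_subtractf sum_negf
        sum_distrib_left algebra_simps)
qed

lemma C1_componentwise:
  fixes f :: "'a::euclidean_space \<Rightarrow> 'b::euclidean_space"
  assumes "\<And>b. C_class 1 (\<lambda>z. f z \<bullet> b)"
  shows "C_class 1 f" "D f z u \<bullet> b = frechet_derivative (\<lambda>z. f z \<bullet> b) (at z) u"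
proof -
  have diff: "f differentiable at z" for z
    using assms differentiable_componentwise_within[of f z UNIV] by simp
  have fr: "frechet_derivative (\<lambda>z. f z \<bullet> b) (at z) u = frechet_derivative f (at z) u \<bullet> b" for z u b
  proof -
    have "((\<lambda>z. f z \<bullet> b) has_derivative (\<lambda>u. frechet_derivative f (at z) u \<bullet> b)) (at z)"
      using diff[of z] by (intro has_derivative_inner_left) (simp add: frechet_derivative_works)
    from fun_cong[OF frechet_derivative_at[OF this], of u] show ?thesis by simp
  qed
  show "C_class 1 f" unfolding One_nat_def C_class.simps
  proof (intro conjI allI diff)
    show "continuous_on UNIV (\<lambda>z. frechet_derivative f (at z) v)" for v
      using assms unfolding One_nat_def C_class.simps fr
      by (subst continuous_on_componentwise) blast
  qed
  show "D f z u \<bullet> b = frechet_derivative (\<lambda>z. f z \<bullet> b) (at z) u"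
    unfolding fr D_apply[OF diff] ..
qed

lemma C1_diff:
  assumes "C_class 1 f" "C_class 1 g"
  shows "C_class 1 (\<lambda>z. f z - g z)"
  by (rule C1_I[where A = "\<lambda>z. D f z - D g z"])
    (use C1_D[OF assms(1)] C1_D[OF assms(2)] in
      \<open>auto intro!: continuous_intros has_derivative_diff simp: minus_blinfun.rep_eq\<close>)

lemma cs_field_C1:
  fixes H :: "(real ^ 'n) \<times> (real ^ 'n) \<Rightarrow> real"
  assumes H: "C_class 2 H"
  shows "C_class 1 (cs_field H lam)"
    and "D (cs_field H lam) z u \<bullet> w =
      frechet_derivative (\<lambda>y. frechet_derivative H (at y) (J w)) (at z) u - lam * (snd u \<bullet> snd w)"
proof -
  have dH: "H differentiable at y" for y by (rule C2_differentiable[OF H])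
  have c: "C_class 1 (\<lambda>y. frechet_derivative H (at y) (J w))" for w
    by (rule C2_directional[OF H])
  have l: "((\<lambda>z::(real ^ 'n) \<times> (real ^ 'n). lam * (snd z \<bullet> snd w)) has_derivative (\<lambda>u. lam * (snd u \<bullet> snd w))) (at z)" for w z
    by (auto intro!: derivative_eq_intros)
  have lC: "C_class 1 (\<lambda>z::(real ^ 'n) \<times> (real ^ 'n). lam * (snd z \<bullet> snd w))" for w
  proof -
    have "frechet_derivative (\<lambda>z::(real ^ 'n) \<times> (real ^ 'n). lam * (snd z \<bullet> snd w)) (at z) = (\<lambda>u. lam * (snd u \<bullet> snd w))" for z
      by (rule frechet_derivative_at[OF l, symmetric])
    then show ?thesis unfolding One_nat_def C_class.simps
      by (intro conjI allI differentiableI[OF l]) simp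
  qed
  have *: "C_class 1 (\<lambda>z. cs_field H lam z \<bullet> w)" for w
    unfolding cs_field_inner[OF dH] by (rule C1_diff[OF c lC])
  show "C_class 1 (cs_field H lam)" using * by (rule C1_componentwise)
  have "((\<lambda>z. frechet_derivative H (at z) (J w) - lam * (snd z \<bullet> snd w)) has_derivative
      (\<lambda>u. frechet_derivative (\<lambda>y. frechet_derivative H (at y) (J w)) (at z) u - lam * (snd u \<bullet> snd w))) (at z)"
    by (intro has_derivative_diff l frechet_derivative_works[THEN iffD1]) (rule C1_differentiable[OF c])
  from fun_cong[OF frechet_derivative_at[OF this], of u]
  show "D (cs_field H lam) z u \<bullet> w =
      frechet_derivative (\<lambda>y. frechet_derivative H (at y) (J w)) (at z) u - lam * (snd u \<bullet> snd w)"
    unfolding C1_componentwise(2)[OF *] cs_field_inner[OF dH] by simp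
qed

lemma frechet_derivative_linear_direction:
  fixes H :: "'a::euclidean_space \<Rightarrow> real"
  assumes H: "C_class 2 H"
  shows "frechet_derivative (\<lambda>y. frechet_derivative H (at y) (- w)) (at z) u =
    - frechet_derivative (\<lambda>y. frechet_derivative H (at y) w) (at z) u"
proof -
  have lin: "linear (frechet_derivative H (at y))" for y
    by (rule linear_frechet_derivative[OF C2_differentiable[OF H]])
  have "((\<lambda>y. frechet_derivative H (at y) w) has_derivative
      frechet_derivative (\<lambda>y. frechet_derivative H (at y) w) (at z)) (at z)"
    by (rule frechet_derivative_works[THEN iffD1]) (rule C1_differentiable[OF C2_directional[OF H]])
  from fun_cong[OF frechet_derivative_at[OF has_derivative_minus[OF this]], of u]
  show ?thesis by (simp add: linear_neg[OF lin] fun_eq_iff)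
qed

text \<open>
  Infinitesimal conformal symplecticity: the Hamiltonian part cancels because second derivatives of \<open>H\<close> commute,
  and the friction contributes the factor \<open>- lam\<close>.
\<close>

lemma cs_field_conformal:
  fixes H :: "(real ^ 'n) \<times> (real ^ 'n) \<Rightarrow> real"
  assumes H: "C_class 2 H"
  shows "symp_form (D (cs_field H lam) z u) v + symp_form u (D (cs_field H lam) z v) = - lam * symp_form u v"
proof -
  let ?S = "\<lambda>u v. frechet_derivative (\<lambda>y. frechet_derivative H (at y) u) (at z) v"
  have 1: "symp_form (D (cs_field H lam) z u) v = - ?S v u - lam * (snd u \<bullet> fst v)" for u v
    unfolding symp_form_inner cs_field_C1(2)[OF H] J_J frechet_derivative_linear_direction[OF H]
    by (simp add: J_def)
  have "symp_form u (D (cs_field H lam) z v) = ?S u v + lam * (snd v \<bullet> fst u)"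
    using 1[of v u] symp_form_swap[of u "D (cs_field H lam) z v"] by simp
  moreover have f: "symp_form u v = snd u \<bullet> fst v - fst u \<bullet> snd v"
    by (simp add: symp_form_inner J_def inner_prod_def)
  ultimately show ?thesis
    unfolding f 1[of u v] second_derivative_symmetric[OF H, of u z v] by (simp add: algebra_simps inner_commute)
qed

lemma cs_field_periodic:
  assumes "hamiltonian r H" "int_vec m"
  shows "cs_field H lam (x + m, p) = cs_field H lam (x, p)"
proof -
  have shift: "(H has_derivative A) (at (x, p))"
    if m: "int_vec m" and A: "(H has_derivative A) (at (x + m, p))" for A x m
  proof -
    have "((\<lambda>z. z + (m, 0)) has_derivative (\<lambda>u. u)) (at (x, p))"
      by (auto intro!: derivative_eq_intros)
    from has_derivative_compose[OF this, of H A] A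
    have "((\<lambda>z. H (z + (m, 0))) has_derivative A) (at (x, p))" by simp
    moreover have "(\<lambda>z. H (z + (m, 0))) = H" using assms(1) m by (auto simp: hamiltonian_def)
    ultimately show ?thesis by simp
  qed
  have "(H has_derivative A) (at (x + m, p)) \<longleftrightarrow> (H has_derivative A) (at (x, p))" for A
    using shift[OF assms(2), of A x] shift[OF int_vec_uminus[OF assms(2)], of A "x + m"] by auto
  then have "frechet_derivative H (at (x + m, p)) = frechet_derivative H (at (x, p))"
    by (simp add: frechet_derivative_def)
  then show ?thesis by (simp add: cs_field_def H_p_def H_x_def)
qed


lemma D_shift:
  assumes f: "C_class 1 f" and shift: "\<And>z. f (z + c) = f z + d"
  shows "D f (z + c) = D f z"
proof -
  have "((\<lambda>z. z + c) has_derivative (\<lambda>u. u)) (at z)"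
    by (auto intro!: derivative_eq_intros)
  from has_derivative_compose[OF this C1_D(1)[OF f]]
  have "((\<lambda>z. f z + d) has_derivative D f (z + c)) (at z)" by (simp add: shift)
  from has_derivative_diff[OF this has_derivative_const[of d]]
  have "(f has_derivative D f (z + c)) (at z)" by simp
  then show ?thesis using D_eqI by metis
qed

lemma D_periodic:
  assumes "C_class 1 f" "\<And>z. f (z + c) = f z"
  shows "D f (z + c) = D f z"
  by (rule D_shift[where d = 0]) (use assms in simp_all)


section \<open>Cut-off fields\<close>

text \<open>
  The square of the positive part is \<open>C\<^sup>1\<close>; nesting it twice gives a \<open>C\<^sup>1\<close> function that equals 1
  on the negative axis and 0 beyond 1.
\<close>

lemma pos_square_deriv: "((\<lambda>u::real. (max 0 u)\<^sup>2) has_real_derivative 2 * max 0 u) (at u)"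
proof -
  consider "u > 0" | "u < 0" | "u = 0" by linarith
  then show ?thesis
  proof cases
    case 1
    have "((\<lambda>u::real. u\<^sup>2) has_real_derivative 2 * max 0 u) (at u)"
      using 1 by (auto intro!: derivative_eq_intros)
    then show ?thesis
      by (rule has_field_derivative_transform_within_open[where S = "{0<..}"]) (use 1 in auto)
  next
    case 2
    have "((\<lambda>u::real. 0) has_real_derivative 2 * max 0 u) (at u)" using 2 by simp
    then show ?thesis
      by (rule has_field_derivative_transform_within_open[where S = "{..<0}"]) (use 2 in auto)
  next
    case 3
    have "((\<lambda>h::real. (max 0 h)\<^sup>2 / h) \<longlongrightarrow> 0) (at 0)"
    proof (rule tendsto_rabs_zero_cancel, rule tendsto_sandwich[of "\<lambda>_. 0" _ _ "\<lambda>h. \<bar>h\<bar>"])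
      show "\<forall>\<^sub>F h in at (0::real). \<bar>(max 0 h)\<^sup>2 / h\<bar> \<le> \<bar>h\<bar>"
        by (rule always_eventually) (auto simp: max_def power2_eq_square)
      show "((\<lambda>h::real. \<bar>h\<bar>) \<longlongrightarrow> 0) (at 0)" by (auto intro!: tendsto_eq_intros)
    qed auto
    then show ?thesis unfolding 3 has_field_derivative_iff by simp
  qed
qed

definition cut_profile :: "real \<Rightarrow> real" where
  "cut_profile u = (max 0 (1 - (max 0 u)\<^sup>2))\<^sup>2"

definition cut_profile' :: "real \<Rightarrow> real" where
  "cut_profile' u = 2 * max 0 (1 - (max 0 u)\<^sup>2) * (0 - 2 * max 0 u)"

lemma cut_profile_deriv: "(cut_profile has_real_derivative cut_profile' u) (at u)"
  unfolding cut_profile_def cut_profile'_def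
  by (rule DERIV_chain2[OF pos_square_deriv DERIV_diff[OF DERIV_const pos_square_deriv]])

text \<open>
  For \<open>0 \<le> R1 < R\<close>, a cut-off in the momentum that equals 1 for \<open>norm p \<le> R1\<close> and 0 for \<open>norm p \<ge> R\<close>.
\<close>

definition bump :: "real \<Rightarrow> real \<Rightarrow> 'a::euclidean_space \<Rightarrow> real" where
  "bump R1 R p = cut_profile ((p \<bullet> p - R1\<^sup>2) / (R\<^sup>2 - R1\<^sup>2))"

definition dbump :: "real \<Rightarrow> real \<Rightarrow> 'a::euclidean_space \<Rightarrow> 'a \<Rightarrow>\<^sub>L real" where
  "dbump R1 R p = (cut_profile' ((p \<bullet> p - R1\<^sup>2) / (R\<^sup>2 - R1\<^sup>2)) * (2 / (R\<^sup>2 - R1\<^sup>2))) *\<^sub>R blinfun_inner_right p"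

lemma cut_profile_range: "0 \<le> cut_profile u" "cut_profile u \<le> 1"
  unfolding cut_profile_def by (simp, rule power_le_one) auto

lemma bump_range: "0 \<le> bump R1 R p" "bump R1 R p \<le> 1"
  unfolding bump_def by (rule cut_profile_range)+

lemma bump_deriv:
  assumes "R1\<^sup>2 < R\<^sup>2"
  shows "(bump R1 R has_derivative dbump R1 R p) (at p)"
proof -
  have 1: "((\<lambda>p. (p \<bullet> p - R1\<^sup>2) / (R\<^sup>2 - R1\<^sup>2)) has_derivative (\<lambda>v. 2 * (p \<bullet> v) / (R\<^sup>2 - R1\<^sup>2))) (at p)"
    using assms by (auto intro!: derivative_eq_intros simp: inner_commute divide_simps)
  have "((\<lambda>p. cut_profile ((p \<bullet> p - R1\<^sup>2) / (R\<^sup>2 - R1\<^sup>2))) has_derivative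
     (\<lambda>v. cut_profile' ((p \<bullet> p - R1\<^sup>2) / (R\<^sup>2 - R1\<^sup>2)) * (2 * (p \<bullet> v) / (R\<^sup>2 - R1\<^sup>2)))) (at p)"
    by (rule has_derivative_compose[OF 1 cut_profile_deriv[unfolded has_field_derivative_def]])
  then show ?thesis
    unfolding bump_def[abs_def] dbump_def by (simp add: scaleR_blinfun.rep_eq mult.assoc)
qed

lemma dbump_continuous: "continuous_on S (dbump R1 R)"
  unfolding dbump_def[abs_def] cut_profile'_def divide_inverse by (intro continuous_intros)

lemma bump_inside:
  assumes "norm p \<le> R1" "R1 < R"
  shows "bump R1 R p = 1" "dbump R1 R p = 0"
proof -
  have R1: "0 \<le> R1" using assms norm_ge_zero order_trans by blast
  have "p \<bullet> p \<le> R1\<^sup>2" using assms by (simp add: dot_square_norm power_mono)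
  moreover have "R1\<^sup>2 < R\<^sup>2" using assms R1 by (intro power_strict_mono) auto
  ultimately have "(p \<bullet> p - R1\<^sup>2) / (R\<^sup>2 - R1\<^sup>2) \<le> 0" by (simp add: divide_nonpos_pos)
  then show "bump R1 R p = 1" "dbump R1 R p = 0"
    by (simp_all add: bump_def dbump_def cut_profile_def cut_profile'_def)
qed

lemma bump_outside:
  assumes "R \<le> norm p" "0 \<le> R1" "R1 < R"
  shows "bump R1 R p = 0" "dbump R1 R p = 0"
proof -
  have "R\<^sup>2 \<le> p \<bullet> p" using assms by (simp add: dot_square_norm power_mono)
  moreover have "R1\<^sup>2 < R\<^sup>2" using assms by (intro power_strict_mono) auto
  ultimately have 1: "1 \<le> (p \<bullet> p - R1\<^sup>2) / (R\<^sup>2 - R1\<^sup>2)" by (simp add: pos_le_divide_eq)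
  then have "1 \<le> (max 0 ((p \<bullet> p - R1\<^sup>2) / (R\<^sup>2 - R1\<^sup>2)))\<^sup>2" by (intro one_le_power) auto
  then show "bump R1 R p = 0" "dbump R1 R p = 0"
    by (simp_all add: bump_def dbump_def cut_profile_def cut_profile'_def)
qed

definition cut :: "real \<Rightarrow> real \<Rightarrow> ((real ^ 'n) \<times> (real ^ 'n) \<Rightarrow> (real ^ 'n) \<times> (real ^ 'n)) \<Rightarrow>
    (real ^ 'n) \<times> (real ^ 'n) \<Rightarrow> (real ^ 'n) \<times> (real ^ 'n)" where
  "cut R1 R X z = bump R1 R (snd z) *\<^sub>R X z"

definition dcut :: "real \<Rightarrow> real \<Rightarrow> ((real ^ 'n) \<times> (real ^ 'n) \<Rightarrow> (real ^ 'n) \<times> (real ^ 'n)) \<Rightarrow>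
    (real ^ 'n) \<times> (real ^ 'n) \<Rightarrow> ((real ^ 'n) \<times> (real ^ 'n)) \<Rightarrow>\<^sub>L ((real ^ 'n) \<times> (real ^ 'n))" where
  "dcut R1 R X z = bump R1 R (snd z) *\<^sub>R D X z +
     (blinfun_scaleR_left (X z) o\<^sub>L (dbump R1 R (snd z) o\<^sub>L snd_blinfun))"

lemma cut_deriv:
  assumes X: "C_class 1 X" and R: "0 \<le> R1" "R1 < R"
  shows "(cut R1 R X has_derivative dcut R1 R X z) (at z)"
proof -
  have "R1\<^sup>2 < R\<^sup>2" using R by (intro power_strict_mono) auto
  from has_derivative_compose[OF has_derivative_snd[OF has_derivative_ident] bump_deriv[OF this]]
  have "((\<lambda>z. bump R1 R (snd z)) has_derivative (\<lambda>u. dbump R1 R (snd z) (snd u))) (at z)" .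
  from has_derivative_scaleR[OF this C1_D(1)[OF X, of z]]
  show ?thesis
    unfolding cut_def[abs_def]
    by (rule has_derivative_eq_rhs) (simp add: dcut_def fun_eq_iff blinfun.add_left blinfun.scaleR_left)
qed

lemma dcut_continuous:
  assumes X: "C_class 1 X" and R: "0 \<le> R1" "R1 < R"
  shows "continuous_on UNIV (dcut R1 R X)"
proof -
  have "R1\<^sup>2 < R\<^sup>2" using R by (intro power_strict_mono) auto
  then have "continuous_on UNIV (bump R1 R :: real ^ 'n \<Rightarrow> real)"
    using bump_deriv has_derivative_continuous by (blast intro: continuous_at_imp_continuous_on)
  then have b: "continuous_on UNIV (\<lambda>z::(real ^ 'n) \<times> (real ^ 'n). bump R1 R (snd z))"
    by (rule continuous_on_compose2) (auto intro: continuous_intros)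
  have db: "continuous_on UNIV (\<lambda>z::(real ^ 'n) \<times> (real ^ 'n). dbump R1 R (snd z))"
    by (rule continuous_on_compose2[OF dbump_continuous]) (auto intro: continuous_intros)
  have sl: "continuous_on UNIV (\<lambda>z. blinfun_scaleR_left (X z))"
    by (intro bounded_linear.continuous_on[OF bounded_linear_blinfun_scaleR_left] C1_D(3)[OF X])
  show ?thesis unfolding dcut_def[abs_def]
    by (intro continuous_on_add continuous_on_scaleR b C1_D(2)[OF X] db sl continuous_on_const
        bounded_bilinear.continuous_on[OF bounded_bilinear_blinfun_compose])
qed

lemma cut_regular:
  assumes X: "C_class 1 X" and R: "0 \<le> R1" "R1 < R"
    and period: "\<And>x p m. int_vec m \<Longrightarrow> X (x + m, p) = X (x, p)"
  shows "uniformly_continuous_on UNIV (dcut R1 R X)" "bounded (range (dcut R1 R X))" "bounded (range (cut R1 R X))"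
proof -
  have DX: "D X (x + m, p) = D X (x, p)" if "int_vec m" for x p m
    using D_periodic[OF X, of "(m, 0)" "(x, p)"] period[OF that] by (auto simp: case_prod_unfold)
  show "uniformly_continuous_on UNIV (dcut R1 R X)" "bounded (range (dcut R1 R X))"
    by (rule uniformly_continuous_cotangent[OF dcut_continuous[OF X R], where R = R and c = 0],
        simp add: dcut_def period DX, simp add: dcut_def bump_outside R)+
  have "continuous_on UNIV (cut R1 R X)"
    using cut_deriv[OF X R] has_derivative_continuous by (blast intro: continuous_at_imp_continuous_on)
  then show "bounded (range (cut R1 R X))"
    by (rule uniformly_continuous_cotangent[where R = R and c = 0])
       (simp_all add: cut_def period bump_outside R)
qed


section \<open>Perturbed fields\<close>

lemma C_class_add_scaled:
  fixes f g :: "'a::euclidean_space \<Rightarrow> real"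
  assumes "C_class k f" "C_class k g"
  shows "C_class k (\<lambda>z. f z + c * g z)"
  using assms
proof (induction k arbitrary: f g)
  case 0
  then show ?case by (auto intro!: continuous_intros)
next
  case (Suc k)
  have f: "f differentiable at z" "C_class k (\<lambda>z. frechet_derivative f (at z) v)"
    and g: "g differentiable at z" "C_class k (\<lambda>z. frechet_derivative g (at z) v)" for z v
    using Suc.prems by simp_all
  have d: "((\<lambda>z. f z + c * g z) has_derivative (\<lambda>v. frechet_derivative f (at z) v + c * frechet_derivative g (at z) v)) (at z)" for z
    by (intro has_derivative_add has_derivative_mult_right frechet_derivative_works[THEN iffD1] f g)
  have "frechet_derivative (\<lambda>z. f z + c * g z) (at z) = (\<lambda>v. frechet_derivative f (at z) v + c * frechet_derivative g (at z) v)" for z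
    by (rule frechet_derivative_at[OF d, symmetric])
  then show ?case using differentiableI[OF d] Suc.IH[OF f(2) g(2)] by simp
qed

lemma cs_field_add_scaled:
  fixes H H1 :: "(real ^ 'n) \<times> (real ^ 'n) \<Rightarrow> real"
  assumes H: "C_class 2 H" and H1: "C_class 2 H1"
  shows "cs_field (\<lambda>z. H z + e * H1 z) lam = (\<lambda>z. cs_field H lam z + e *\<^sub>R cs_field H1 0 z)"
proof
  fix z
  note dH = C2_differentiable[OF H, of z] and dH1 = C2_differentiable[OF H1, of z]
  have d: "((\<lambda>z. H z + e * H1 z) has_derivative (\<lambda>v. frechet_derivative H (at z) v + e * frechet_derivative H1 (at z) v)) (at z)"
    by (intro has_derivative_add has_derivative_mult_right frechet_derivative_works[THEN iffD1] dH dH1)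
  have "cs_field (\<lambda>z. H z + e * H1 z) lam z \<bullet> w = (cs_field H lam z + e *\<^sub>R cs_field H1 0 z) \<bullet> w" for w
    unfolding cs_field_inner[OF differentiableI[OF d]] inner_add_left inner_scaleR_left cs_field_inner[OF dH] cs_field_inner[OF dH1]
      frechet_derivative_at[OF d, symmetric] by simp
  then show "cs_field (\<lambda>z. H z + e * H1 z) lam z = cs_field H lam z + e *\<^sub>R cs_field H1 0 z"
    using vector_eq_rdot by blast
qed

text \<open>
  Applied to \<open>J X\<close> for the value \<open>X\<close> of the field itself, the bound on \<open>dH1\<close> gives
  \<open>norm X ^ 2 \<le> norm X\<close>; the same for the derivative.
\<close>

lemma cs_field_le:
  fixes H1 :: "(real ^ 'n) \<times> (real ^ 'n) \<Rightarrow> real"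
  assumes H1: "C_class 2 H1" and C2: "C2_norm_le H1 S 1" and z: "z \<in> S"
  shows "norm (cs_field H1 0 z) \<le> 1" "norm (D (cs_field H1 0) z) \<le> 1"
proof -
  let ?X = "cs_field H1 0 z"
  have "(norm ?X)\<^sup>2 = frechet_derivative H1 (at z) (J ?X)"
    using cs_field_inner[OF C2_differentiable[OF H1], where z = z and lam = 0 and w = ?X] by (simp add: dot_square_norm)
  also have "\<dots> \<le> 1 * norm (J ?X)" using C2 z unfolding C2_norm_le_def by (metis abs_le_D1)
  finally have "norm ?X * norm ?X \<le> 1 * norm ?X" by (simp add: power2_eq_square)
  then show "norm ?X \<le> 1" by (metis mult_right_le_imp_le norm_ge_zero order_le_less zero_le_one)
  show "norm (D (cs_field H1 0) z) \<le> 1"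
  proof (rule norm_blinfun_bound)
    fix u
    let ?Y = "D (cs_field H1 0) z u"
    have "(norm ?Y)\<^sup>2 = frechet_derivative (\<lambda>y. frechet_derivative H1 (at y) (J ?Y)) (at z) u"
      using cs_field_C1(2)[OF H1, where lam = 0 and z = z and u = u and w = ?Y] by (simp add: dot_square_norm)
    also have "\<dots> \<le> 1 * norm (J ?Y) * norm u" using C2 z unfolding C2_norm_le_def by (metis abs_le_D1)
    finally have "norm ?Y * norm ?Y \<le> norm u * norm ?Y" by (simp add: power2_eq_square mult.commute)
    then show "norm ?Y \<le> 1 * norm u" by (metis mult_1 mult_right_le_imp_le norm_ge_zero order_le_less)
  qed simp
qed

text \<open>
  The field depends linearly on the Hamiltonian, so the cut-off fields of \<open>H + e * H1\<close> and \<open>H\<close> differ by \<open>e\<close> times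
  the cut-off Hamiltonian field of \<open>H1\<close>, which is controlled by the \<open>C\<^sup>2\<close> norm of \<open>H1\<close> on the support of the
  cut-off. One constant \<open>L\<close> serves all perturbations.
\<close>

lemma perturbed_cut_field:
  fixes H :: "(real ^ 'n) \<times> (real ^ 'n) \<Rightarrow> real"
  assumes H: "hamiltonian 2 H" and R: "0 \<le> R1" "R1 < R"
  shows "\<exists>L C. C1_field (cut R1 R (cs_field H lam)) (dcut R1 R (cs_field H lam)) L \<and>
    (\<forall>H1 e. hamiltonian 2 H1 \<longrightarrow> C2_norm_le H1 {(x, p). norm p \<le> R} 1 \<longrightarrow> 0 < e \<longrightarrow> e \<le> 1 \<longrightarrow>
      (let X = cs_field (\<lambda>z. H z + e * H1 z) lam in C1_field (cut R1 R X) (dcut R1 R X) L \<and>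
      (\<forall>z. norm (cut R1 R X z - cut R1 R (cs_field H lam) z) \<le> e * C \<and>
           norm (dcut R1 R X z - dcut R1 R (cs_field H lam) z) \<le> e * C)))"
proof -
  let ?X = "cs_field H lam"
  have H2: "C_class 2 H" using H by (simp add: hamiltonian_def)
  note X = cs_field_C1(1)[OF H2, of lam]
  note reg = cut_regular[OF X R cs_field_periodic[OF H]]
  obtain B where B: "\<And>z. norm (dcut R1 R ?X z) \<le> B" using reg(2) unfolding bounded_iff by auto
  obtain b where b: "\<And>p. norm (dbump R1 R p :: (real ^ 'n) \<Rightarrow>\<^sub>L real) \<le> b"
  proof -
    have "bounded (dbump R1 R ` cball (0 :: real ^ 'n) R)"
      by (intro compact_imp_bounded compact_continuous_image dbump_continuous compact_cball)
    then obtain b where "\<forall>p\<in>cball 0 R. norm (dbump R1 R p :: (real ^ 'n) \<Rightarrow>\<^sub>L real) \<le> b"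
      unfolding bounded_iff by auto
    then have "norm (dbump R1 R p :: (real ^ 'n) \<Rightarrow>\<^sub>L real) \<le> b" if "norm p \<le> R" for p
      using that by simp
    then have "norm (dbump R1 R p :: (real ^ 'n) \<Rightarrow>\<^sub>L real) \<le> max b 0" for p
      using bump_outside(2)[of R p R1] R by (cases "norm p \<le> R") (auto simp: le_max_iff_disj)
    then show ?thesis by (rule that)
  qed
  have b0: "0 \<le> b" using b[of 0] norm_ge_zero order_trans by blast
  have B0: "0 \<le> B" using B[of 0] norm_ge_zero order_trans by blast
  define L where "L = B + (1 + b) + 1"
  have field: "C1_field (cut R1 R Y) (dcut R1 R Y) L"
    if "C_class 1 Y" "\<And>x p m. int_vec m \<Longrightarrow> Y (x + m, p) = Y (x, p)" "\<And>z. norm (dcut R1 R Y z) \<le> L" for Y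
    by unfold_locales (use cut_deriv[OF that(1) R] cut_regular[OF that(1) R that(2)] that(3) b0 B0 in \<open>auto simp: L_def\<close>)
  show ?thesis
  proof (rule exI[of _ L], rule exI[of _ "1 + b"], intro conjI allI impI)
    show "C1_field (cut R1 R ?X) (dcut R1 R ?X) L"
    proof (rule field[OF X cs_field_periodic[OF H]])
      show "norm (dcut R1 R ?X z) \<le> L" for z using B[of z] b0 by (simp add: L_def)
    qed
    fix H1 :: "(real ^ 'n) \<times> (real ^ 'n) \<Rightarrow> real" and e :: real
    assume H1: "hamiltonian 2 H1" and C2: "C2_norm_le H1 {(x, p). norm p \<le> R} 1" and e: "0 < e" "e \<le> 1"
    let ?X1 = "cs_field H1 0"
    have H12: "C_class 2 H1" using H1 by (simp add: hamiltonian_def)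
    note X1 = cs_field_C1(1)[OF H12, of 0]
    define X' where "X' = cs_field (\<lambda>z. H z + e * H1 z) lam"
    have H': "hamiltonian 2 (\<lambda>z. H z + e * H1 z)"
      using H H1 C_class_add_scaled[OF H2 H12] by (simp add: hamiltonian_def)
    have X'eq: "X' = (\<lambda>z. ?X z + e *\<^sub>R ?X1 z)" unfolding X'_def by (rule cs_field_add_scaled[OF H2 H12])
    have C1X': "C_class 1 X'" unfolding X'_def
      by (rule cs_field_C1(1)) (use H' in \<open>simp add: hamiltonian_def\<close>)
    have DX': "D X' z = D ?X z + e *\<^sub>R D ?X1 z" for z
    proof (rule D_eqI)
      have "((\<lambda>z. ?X z + e *\<^sub>R ?X1 z) has_derivative (\<lambda>v. D ?X z v + e *\<^sub>R D ?X1 z v)) (at z)"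
        by (intro has_derivative_add has_derivative_scaleR_right C1_D(1)[OF X] C1_D(1)[OF X1])
      then show "(X' has_derivative blinfun_apply (D ?X z + e *\<^sub>R D ?X1 z)) (at z)"
        unfolding X'eq by (simp add: plus_blinfun.rep_eq scaleR_blinfun.rep_eq)
    qed
    have c: "cut R1 R X' z - cut R1 R ?X z = e *\<^sub>R cut R1 R ?X1 z" for z
      by (simp add: cut_def X'eq algebra_simps)
    have dc: "dcut R1 R X' z - dcut R1 R ?X z = e *\<^sub>R dcut R1 R ?X1 z" for z
      unfolding dcut_def DX' fun_cong[OF X'eq, of z]
      by (rule blinfun_eqI) (simp add: blinfun.bilinear_simps algebra_simps)
    have 1: "norm (cut R1 R ?X1 z) \<le> 1 + b" and 2: "norm (dcut R1 R ?X1 z) \<le> 1 + b" for z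
    proof -
      consider "norm (snd z) \<le> R" | "R \<le> norm (snd z)" by linarith
      then have "norm (cut R1 R ?X1 z) \<le> 1 + b \<and> norm (dcut R1 R ?X1 z) \<le> 1 + b"
      proof cases
        case 1
        then have "z \<in> {(x, p). norm p \<le> R}" by auto
        note le = cs_field_le[OF H12 C2 this]
        have "bump R1 R (snd z) * norm (?X1 z) \<le> 1 * 1"
          using le bump_range[of R1 R "snd z"] by (intro mult_mono) auto
        then have "norm (cut R1 R ?X1 z) \<le> 1 + b"
          using b0 bump_range[of R1 R "snd z"] by (simp add: cut_def)
        moreover have "norm (bump R1 R (snd z) *\<^sub>R D ?X1 z) \<le> 1 * 1"
          using le bump_range[of R1 R "snd z"] unfolding norm_scaleR by (intro mult_mono) auto
        moreover have "norm (blinfun_scaleR_left (?X1 z) o\<^sub>L (dbump R1 R (snd z) o\<^sub>L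
            (snd_blinfun :: ((real ^ 'n) \<times> (real ^ 'n)) \<Rightarrow>\<^sub>L (real ^ 'n)))) \<le> b"
        proof (rule norm_blinfun_bound[OF b0])
          fix u :: "(real ^ 'n) \<times> (real ^ 'n)"
          have "norm (dbump R1 R (snd z) (snd u)) \<le> b * norm u"
            using b b0 norm_snd_le'[of u] by (intro order_trans[OF norm_blinfun] mult_mono) auto
          then have "norm (dbump R1 R (snd z) (snd u)) * norm (?X1 z) \<le> b * norm u * 1"
            using le b0 by (intro mult_mono) auto
          then show "norm ((blinfun_scaleR_left (?X1 z) o\<^sub>L (dbump R1 R (snd z) o\<^sub>L snd_blinfun)) u) \<le> b * norm u"
            by simp
        qed
        ultimately show ?thesis unfolding dcut_def
          using norm_triangle_ineq[of "bump R1 R (snd z) *\<^sub>R D ?X1 z"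
            "blinfun_scaleR_left (?X1 z) o\<^sub>L (dbump R1 R (snd z) o\<^sub>L snd_blinfun)"]
          by - (rule conjI; linarith)
      next
        case 2
        then show ?thesis using bump_outside[OF 2 R] b0 by (simp add: cut_def dcut_def)
      qed
      then show "norm (cut R1 R ?X1 z) \<le> 1 + b" "norm (dcut R1 R ?X1 z) \<le> 1 + b" by auto
    qed
    have "norm (dcut R1 R X' z) \<le> L" for z
    proof -
      have "norm (dcut R1 R X' z) \<le> norm (dcut R1 R ?X z) + e * norm (dcut R1 R ?X1 z)"
        using norm_triangle_sub[of "dcut R1 R X' z" "dcut R1 R ?X z"] e unfolding dc by simp
      also have "\<dots> \<le> B + 1 * (1 + b)" using B[of z] 2[of z] e by (intro add_mono mult_mono) auto
      finally show ?thesis by (simp add: L_def)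
    qed
    then have "C1_field (cut R1 R X') (dcut R1 R X') L"
      using cs_field_periodic[OF H'] by (intro field[OF C1X']) (auto simp: X'_def)
    moreover have "norm (cut R1 R X' z - cut R1 R ?X z) \<le> e * (1 + b)" "norm (dcut R1 R X' z - dcut R1 R ?X z) \<le> e * (1 + b)" for z
      using 1[of z] 2[of z] e by (simp_all add: c dc)
    ultimately show "let X = cs_field (\<lambda>z. H z + e * H1 z) lam in C1_field (cut R1 R X) (dcut R1 R X) L \<and>
      (\<forall>z. norm (cut R1 R X z - cut R1 R ?X z) \<le> e * (1 + b) \<and> norm (dcut R1 R X z - dcut R1 R ?X z) \<le> e * (1 + b))"
      by (simp add: X'_def Let_def)
  qed
qed

lemma symp_form_has_derivative:
  assumes "(u has_vector_derivative u') (at t within S)" "(v has_vector_derivative v') (at t within S)"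
  shows "((\<lambda>t. symp_form (u t) (v t)) has_vector_derivative (symp_form u' (v t) + symp_form (u t) v')) (at t within S)"
proof -
  have "bounded_linear (J :: (real ^ 'n) \<times> (real ^ 'n) \<Rightarrow> _)" unfolding J_def[abs_def]
    by (intro bounded_linear_Pair bounded_linear_minus bounded_linear_snd bounded_linear_fst)
  from bounded_linear.has_vector_derivative[OF this assms(2)]
  have "((\<lambda>t. u t \<bullet> J (v t)) has_vector_derivative (u t \<bullet> J v' + u' \<bullet> J (v t))) (at t within S)"
    by (rule bounded_bilinear.has_vector_derivative[OF bounded_bilinear_inner assms(1)])
  then show ?thesis by (simp add: symp_form_inner add.commute)
qed

lemma symp_form_le: "\<bar>symp_form u v\<bar> \<le> norm u * norm v"
  unfolding symp_form_inner using Cauchy_Schwarz_ineq2[of u "J v"] by simp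

text \<open>
  As long as an orbit stays where the cut-off equals 1, the product of \<open>exp (lam * t)\<close> and the symplectic
  form of two solutions of the variational equation is constant.
\<close>

lemma dflow_conformal:
  fixes H :: "(real ^ 'n) \<times> (real ^ 'n) \<Rightarrow> real"
  assumes H: "C_class 2 H" and R: "R1 < R"
    and field: "C1_field (cut R1 R (cs_field H lam)) (dcut R1 R (cs_field H lam)) L" and T: "0 \<le> T"
    and inside: "\<And>t. t \<in> {0..T} \<Longrightarrow> norm (snd (C1_field.flow (cut R1 R (cs_field H lam)) t z)) \<le> R1"
  defines "W \<equiv> C1_field.dflow (cut R1 R (cs_field H lam)) (dcut R1 R (cs_field H lam))"
  shows "symp_form (W T z u) (W T z v) = exp (- (lam * T)) * symp_form u v"
proof -
  interpret C1_field "cut R1 R (cs_field H lam)" "dcut R1 R (cs_field H lam)" L by fact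
  let ?s = "\<lambda>t. symp_form (dflow t z u) (dflow t z v)"
  have W: "((\<lambda>t. dflow t z w) has_vector_derivative D (cs_field H lam) (flow t z) (dflow t z w)) (at t within {0..T})"
    if "t \<in> {0..T}" for t w
    using dflow_apply_deriv_Icc[OF that, of z w] bump_inside[OF inside[OF that] R] by (simp add: dcut_def)
  have "norm (exp (lam * T) * ?s T - exp (lam * 0) * ?s 0) \<le> 0 - 0"
  proof (rule increment_bound[OF T])
    fix t assume t: "t \<in> {0..T}"
    have e: "((\<lambda>t. exp (lam * t)) has_vector_derivative lam * exp (lam * t)) (at t within {0..T})"
      unfolding has_real_derivative_iff_has_vector_derivative[symmetric]
      by (auto intro!: derivative_eq_intros)
    have "((\<lambda>t. exp (lam * t) * ?s t) has_vector_derivative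
        exp (lam * t) * (- lam * ?s t) + lam * exp (lam * t) * ?s t) (at t within {0..T})"
      using has_vector_derivative_mult[OF e symp_form_has_derivative[OF W[OF t] W[OF t]]]
      unfolding cs_field_conformal[OF H] .
    then show "((\<lambda>t. exp (lam * t) * ?s t) has_vector_derivative 0) (at t within {0..T})" by simp
  qed (auto intro: derivative_eq_intros)
  then have "exp (lam * T) * ?s T = symp_form u v" by simp
  then show ?thesis unfolding W_def by (simp add: exp_minus field_simps)
qed


section \<open>The unperturbed torus\<close>

lemma C1_Lipschitz:
  fixes f :: "'a::euclidean_space \<Rightarrow> 'b::real_normed_vector"
  assumes f: "C_class 1 f" and B: "\<And>z. norm (D f z) \<le> B"
  shows "norm (f x - f y) \<le> B * norm (x - y)"
  using differentiable_bound[OF convex_UNIV, of f "\<lambda>z. blinfun_apply (D f z)" B x y] C1_D(1)[OF f] B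
  by (simp add: norm_blinfun.rep_eq)

lemma exp_decay_zero:
  fixes a C r :: real
  assumes "0 \<le> a" "0 \<le> r" "r < 1" "\<And>k::nat. a \<le> C * r ^ k"
  shows "a = 0"
proof -
  have "(\<lambda>k. C * r ^ k) \<longlonglongrightarrow> C * 0" using assms by (intro tendsto_intros LIMSEQ_power_zero) simp
  then have "a \<le> C * 0" by (rule LIMSEQ_le_const) (use assms in auto)
  then show ?thesis using assms by simp
qed

text \<open>
  The torus as the graph of \<open>P\<close>, parametrized by \<open>x \<mapsto> (zeta x, P (zeta x))\<close>, with room between the largest
  momentum \<open>R0\<close> on it and the radius \<open>R1\<close> up to which the field is not modified.
\<close>

locale kam_setting =
  fixes H :: "(real ^ 'n) \<times> (real ^ 'n) \<Rightarrow> real" and lam :: real and omega :: "real ^ 'n"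
    and P zeta eta :: "real ^ 'n \<Rightarrow> real ^ 'n" and R0 R1 R L :: real
  assumes lam: "0 < lam" and H: "hamiltonian 2 H"
    and R0: "0 \<le> R0" and R01: "R0 < R1" and R1: "R1 < R" and P_le: "\<And>x. norm (P x) \<le> R0"
    and P: "C_class 1 P" and P_period: "\<And>x m. int_vec m \<Longrightarrow> P (x + m) = P x"
    and zeta: "C_class 1 zeta" and zeta_shift: "\<And>x m. int_vec m \<Longrightarrow> zeta (x + m) = zeta x + m"
    and zeta_bij: "bij zeta" and zeta_imm: "\<And>x v. D zeta x v = 0 \<Longrightarrow> v = 0"
    and eta: "C_class 1 eta" and eta_eq: "\<And>x. eta x = P (zeta x)"
    and rotation: "\<And>x t. cs_flow H lam t (zeta x, eta x) (zeta (x + t *\<^sub>R omega), eta (x + t *\<^sub>R omega))"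
    and field: "C1_field (cut R1 R (cs_field H lam)) (dcut R1 R (cs_field H lam)) L"
begin

interpretation F0: C1_field "cut R1 R (cs_field H lam)" "dcut R1 R (cs_field H lam)" L
  by (rule field)

lemma H2: "C_class 2 H" using H by (simp add: hamiltonian_def)

lemma eta_period: "int_vec m \<Longrightarrow> eta (x + m) = eta x"
  by (simp add: eta_eq zeta_shift P_period)

definition K :: "real ^ 'n \<Rightarrow> (real ^ 'n) \<times> (real ^ 'n)" where
  "K x = (zeta x, eta x)"

definition DK :: "real ^ 'n \<Rightarrow> real ^ 'n \<Rightarrow> (real ^ 'n) \<times> (real ^ 'n)" where
  "DK x v = (D zeta x v, D eta x v)"

lemma K_deriv: "(K has_derivative DK x) (at x)"
  unfolding K_def[abs_def] DK_def[abs_def]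
  by (intro has_derivative_Pair C1_D(1) zeta eta)

lemma D_eta: "D eta x v = D P (zeta x) (D zeta x v)"
proof -
  have "(eta has_derivative (\<lambda>v. D P (zeta x) (D zeta x v))) (at x)"
    using has_derivative_compose[OF C1_D(1)[OF zeta] C1_D(1)[OF P]] by (simp add: eta_eq[abs_def])
  from has_derivative_unique[OF this C1_D(1)[OF eta]] show ?thesis by metis
qed

text \<open>
  The definition of the flow provides for each time its own solution curve. By uniqueness they fit together to
  the curve \<open>t \<mapsto> K (x + t *\<^sub>R omega)\<close>. As these curves might leave the region of the given cut-off, uniqueness
  is applied to the field cut off outside a ball that contains them.
\<close>

lemma orbit_on_torus:
  assumes T: "0 \<le> T"
  shows "F0.flow T (K x) = K (x + T *\<^sub>R omega)"
proof -
  let ?X = "cs_field H lam"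
  obtain c where c0: "c 0 = K x" and cT: "c T = K (x + T *\<^sub>R omega)"
    and c: "\<And>s. s \<in> {0..T} \<Longrightarrow> (c has_vector_derivative ?X (c s)) (at s within {0..T})"
    using rotation[of T x] T unfolding cs_flow_def K_def closed_segment_eq_real_ivl by auto
  have on: "c s = K (x + s *\<^sub>R omega)" if s: "s \<in> {0..T}" for s
  proof -
    have "0 \<le> s" using s by simp
    then obtain e where e0: "e 0 = K x" and es: "e s = K (x + s *\<^sub>R omega)"
      and e: "\<And>r. r \<in> {0..s} \<Longrightarrow> (e has_vector_derivative ?X (e r)) (at r within {0..s})"
      using rotation[of s x] unfolding cs_flow_def K_def closed_segment_eq_real_ivl by auto
    have c': "(c has_vector_derivative ?X (c r)) (at r within {0..s})" if "r \<in> {0..s}" for r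
      by (rule has_vector_derivative_within_subset[OF c]) (use that s in auto)
    have "bounded (c ` {0..s} \<union> e ` {0..s})"
      by (intro bounded_Un[THEN iffD2] conjI compact_imp_bounded compact_continuous_image
          vector_derivative_imp_continuous_on[OF c'] vector_derivative_imp_continuous_on[OF e] compact_Icc)
    then obtain b where b: "\<And>z. z \<in> c ` {0..s} \<union> e ` {0..s} \<Longrightarrow> norm z \<le> b"
      unfolding bounded_iff by blast
    have "norm (c 0) \<le> b" by (rule b) (use s in auto)
    then have b0: "0 \<le> b" by (rule order_trans[OF norm_ge_zero])
    obtain L' where "C1_field (cut b (b + 1) ?X) (dcut b (b + 1) ?X) L'"
      using perturbed_cut_field[OF H b0, of "b + 1" lam] by auto
    then interpret B: C1_field "cut b (b + 1) ?X" "dcut b (b + 1) ?X" L' .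
    have in_b: "cut b (b + 1) ?X z = ?X z" if "norm z \<le> b" for z
      using bump_inside(1)[of "snd z" b "b + 1"] norm_snd_le'[of z] that by (simp add: cut_def)
    have "c s = B.flow s (c 0)"
      by (rule B.flow_unique[where T = s]) (use c' b in_b \<open>0 \<le> s\<close> in auto)
    moreover have "e s = B.flow s (e 0)"
      by (rule B.flow_unique[where T = s]) (use e b in_b \<open>0 \<le> s\<close> in auto)
    ultimately show ?thesis using c0 e0 es by simp
  qed
  have "c T = F0.flow T (c 0)"
  proof (rule F0.flow_unique[where T = T])
    fix s assume s: "s \<in> {0..T}"
    have n: "norm (snd (c s)) \<le> R1" using on[OF s] P_le[of "zeta (x + s *\<^sub>R omega)"] R01
      by (simp add: K_def eta_eq)
    have "cut R1 R ?X (c s) = ?X (c s)" using bump_inside(1)[OF n R1] by (simp add: cut_def)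
    then show "(c has_vector_derivative cut R1 R ?X (c s)) (at s within {0..T})" using c[OF s] by simp
  qed (use T in auto)
  then show ?thesis using c0 cT by simp
qed

lemma inside_torus: "0 \<le> t \<Longrightarrow> norm (snd (F0.flow t (K x))) \<le> R1"
  using orbit_on_torus[of t x] P_le[of "zeta (x + t *\<^sub>R omega)"] R01 by (simp add: K_def eta_eq)

text \<open>
  Differentiating the conjugacy: tangent vectors of the torus are transported by the derivative of the
  parametrization and stay bounded for all times.
\<close>

lemma dflow_on_torus:
  assumes T: "0 \<le> T"
  shows "F0.dflow T (K x) (DK x v) = DK (x + T *\<^sub>R omega) v"
proof -
  have "((\<lambda>x. F0.flow T (K x)) has_derivative (\<lambda>v. F0.dflow T (K x) (DK x v))) (at x)"
    by (rule has_derivative_compose[OF K_deriv F0.flow_has_derivative[OF T]])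
  moreover have "((\<lambda>x. K (x + T *\<^sub>R omega)) has_derivative (\<lambda>v. DK (x + T *\<^sub>R omega) v)) (at x)"
    by (rule has_derivative_compose[OF _ K_deriv]) (auto intro!: derivative_eq_intros)
  ultimately have "(\<lambda>v. F0.dflow T (K x) (DK x v)) = DK (x + T *\<^sub>R omega)"
    unfolding orbit_on_torus[OF T] by (rule has_derivative_unique)
  then show ?thesis by metis
qed

lemma D_bounded:
  "\<exists>B>0. \<forall>x. norm (D zeta x) \<le> B \<and> norm (D eta x) \<le> B \<and> norm (D P x) \<le> B"
proof -
  have per: "D zeta (x + m) = D zeta x" "D eta (x + m) = D eta x" "D P (x + m) = D P x" if "int_vec m" for x m
    using D_shift[OF zeta zeta_shift[OF that]] D_periodic[OF eta eta_period[OF that]]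
      D_periodic[OF P P_period[OF that]] by auto
  obtain B1 B2 B3 where "\<And>x. norm (D zeta x) \<le> B1" "\<And>x. norm (D eta x) \<le> B2" "\<And>x. norm (D P x) \<le> B3"
    using uniformly_continuous_torus(2)[OF C1_D(2)[OF zeta] per(1)]
      uniformly_continuous_torus(2)[OF C1_D(2)[OF eta] per(2)]
      uniformly_continuous_torus(2)[OF C1_D(2)[OF P] per(3)]
    unfolding bounded_iff by auto
  then show ?thesis by (intro exI[of _ "max 1 (max B1 (max B2 B3))"]) (auto simp: le_max_iff_disj)
qed

text \<open>
  The unperturbed torus is Lagrangian. The symplectic form of two tangent vectors is \<open>exp (- lam * k)\<close>
  times that of their preimages under the time \<open>k\<close> flow, and these preimages are bounded.
\<close>

lemma P_symmetric:
  "symp_form (v, D P x v) (w, D P x w) = 0"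
proof -
  obtain B where B: "B > 0" "\<And>x. norm (D zeta x) \<le> B" "\<And>x. norm (D eta x) \<le> B"
    using D_bounded by blast
  have DKn: "norm (DK x v) \<le> 2 * B * norm v" for x v
  proof -
    have "norm (D zeta x v) \<le> B * norm v" "norm (D eta x v) \<le> B * norm v"
      by (rule order_trans[OF norm_blinfun mult_right_mono[OF _ norm_ge_zero]], rule B)+
    then show ?thesis unfolding DK_def using norm_Pair_le[of "D zeta x v" "D eta x v"] by linarith
  qed
  have K0: "symp_form (DK y v) (DK y w) = 0" for y v w
  proof -
    have "\<bar>symp_form (DK y v) (DK y w)\<bar> \<le> ((2 * B * norm v) * (2 * B * norm w)) * exp (- lam) ^ k" for k :: nat
    proof -
      let ?y = "y - real k *\<^sub>R omega"
      have "symp_form (DK y v) (DK y w) = symp_form (F0.dflow k (K ?y) (DK ?y v)) (F0.dflow k (K ?y) (DK ?y w))"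
        using dflow_on_torus[of "real k" ?y] by simp
      also have "\<dots> = exp (- (lam * k)) * symp_form (DK ?y v) (DK ?y w)"
        by (rule dflow_conformal[OF H2 R1 field]) (use inside_torus in auto)
      finally have "\<bar>symp_form (DK y v) (DK y w)\<bar> = exp (- (lam * k)) * \<bar>symp_form (DK ?y v) (DK ?y w)\<bar>"
        by (simp add: abs_mult)
      also have "\<dots> \<le> exp (- (lam * k)) * ((2 * B * norm v) * (2 * B * norm w))"
        using B by (intro mult_left_mono order_trans[OF symp_form_le] mult_mono DKn) auto
      also have "exp (- (lam * k)) = exp (- lam) ^ k" by (simp add: exp_of_nat_mult[symmetric] mult.commute)
      finally show ?thesis by (simp add: mult.commute)
    qed
    from exp_decay_zero[OF _ _ _ this] show ?thesis using lam by simp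
  qed
  obtain y where y: "x = zeta y" using zeta_bij by (metis bij_pointE)
  have lin: "linear (blinfun_apply (D zeta y))" by (simp add: blinfun.bounded_linear_right bounded_linear.linear)
  have "inj (D zeta y)" using zeta_imm by (simp add: linear_injective_0[OF lin])
  then have "surj (D zeta y)" by (rule linear_inj_imp_surj[OF lin])
  then obtain v' w' where "v = D zeta y v'" "w = D zeta y w'" by (metis surjD)
  then show ?thesis using K0[of y v' w'] y by (simp add: DK_def D_eta)
qed

definition Z :: "real ^ 'n \<Rightarrow> real ^ 'n" where "Z = inv zeta"

lemma Z_zeta [simp]: "Z (zeta x) = x" and zeta_Z [simp]: "zeta (Z x) = x"
  using zeta_bij unfolding Z_def by (simp_all add: bij_is_inj bij_is_surj surj_f_inv_f)

lemma Z_shift: "int_vec m \<Longrightarrow> Z (x + m) = Z x + m"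
  by (metis Z_zeta zeta_Z zeta_shift)

lemma P_eq: "P x = eta (Z x)" by (simp add: eta_eq)

lemma zeta_expands: "\<exists>k>0. \<forall>x v. norm v \<le> k * norm (D zeta x v)"
proof -
  let ?S = "cbox 0 1 \<times> sphere 0 1 :: ((real ^ 'n) \<times> (real ^ 'n)) set"
  have cont: "continuous_on ?S (\<lambda>(x, v). norm (D zeta x v))" unfolding case_prod_unfold
    by (intro continuous_intros continuous_on_compose2[OF C1_D(2)[OF zeta]]) auto
  have "axis undefined 1 \<in> sphere 0 (1 :: real) \<inter> (UNIV :: (real ^ 'n) set)" by simp
  moreover have "0 \<in> cbox 0 (1 :: real ^ 'n)" by (simp add: mem_box_cart)
  ultimately have "?S \<noteq> {}" by blast
  from continuous_attains_inf[OF compact_Times[OF compact_cbox compact_sphere] this cont]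
  obtain x0 v0 where 0: "(x0, v0) \<in> ?S" and min: "\<And>x v. (x, v) \<in> ?S \<Longrightarrow> norm (D zeta x0 v0) \<le> norm (D zeta x v)"
    by auto
  define m where "m = norm (D zeta x0 v0)"
  have m: "m > 0" unfolding m_def using zeta_imm[of x0 v0] 0 by auto
  have "norm v \<le> 1 / m * norm (D zeta x v)" for x v
  proof (cases "v = 0")
    case False
    obtain k where k: "int_vec k" "x + k \<in> cbox 0 1" using int_vec_reduce by blast
    have "D zeta (x + k) = D zeta x" using D_shift[OF zeta zeta_shift[OF k(1)]] by simp
    then have "m \<le> norm (D zeta x ((1 / norm v) *\<^sub>R v))"
      using min[of "x + k" "(1 / norm v) *\<^sub>R v"] k False by (simp add: m_def)
    then have "m \<le> norm (D zeta x v) / norm v" by (simp add: blinfun.scaleR_right)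
    then show ?thesis using m False by (simp add: field_simps)
  qed simp
  then show ?thesis using m by (intro exI[of _ "1 / m"]) auto
qed

text \<open>
  The derivative of the inverse is bounded because \<open>zeta\<close> expands uniformly, and then continuous by
  \<open>A y - A x = A y (D zeta (Z x) - D zeta (Z y)) A x\<close>.
\<close>

lemma Z_C1: "C_class 1 Z" and D_Z: "D zeta (Z x) (D Z x v) = v"
proof -
  have ex: "\<exists>A. (Z has_derivative blinfun_apply A) (at x) \<and> (\<forall>v. D zeta (Z x) (A v) = v)" for x
  proof -
    have lin: "linear (blinfun_apply (D zeta (Z x)))" by (simp add: blinfun.bounded_linear_right bounded_linear.linear)
    have "inj (D zeta (Z x))" using zeta_imm by (simp add: linear_injective_0[OF lin])
    then obtain g where g: "linear g" "\<And>v. D zeta (Z x) (g v) = v" "\<And>v. g (D zeta (Z x) v) = v"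
      using linear_injective_isomorphism[OF lin] by blast
    have bl: "bounded_linear g" using g(1) by (simp add: linear_conv_bounded_linear)
    have "(Z has_derivative g) (at (zeta (Z x)))"
    proof (rule has_derivative_inverse_strong[where S = UNIV and f = zeta and x = "Z x" and f' = "D zeta (Z x)"])
      show "(zeta has_derivative D zeta (Z x)) (at (Z x))" by (rule C1_D(1)[OF zeta])
    qed (use C1_D(3)[OF zeta] g in \<open>auto simp: fun_eq_iff\<close>)
    then show ?thesis using g by (intro exI[of _ "Blinfun g"]) (simp add: bounded_linear_Blinfun_apply[OF bl])
  qed
  then obtain A where A: "\<And>x. (Z has_derivative blinfun_apply (A x)) (at x)" "\<And>x v. D zeta (Z x) (A x v) = v"
    by metis
  obtain k where k: "k > 0" "\<And>x v. norm v \<le> k * norm (D zeta x v)" using zeta_expands by blast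
  have An: "norm (A x) \<le> k" for x
    by (rule norm_blinfun_bound) (use k(1) k(2)[of "A x _" "Z x"] A(2) in auto)
  have Zc: "continuous_on UNIV Z"
    using A(1) has_derivative_continuous by (blast intro: continuous_at_imp_continuous_on)
  have cD: "continuous_on UNIV (\<lambda>x. D zeta (Z x))"
    by (rule continuous_on_compose2[OF C1_D(2)[OF zeta] Zc]) simp
  have "continuous_on UNIV A" unfolding continuous_on_iff
  proof (intro ballI allI impI)
    fix x and e :: real assume e: "e > 0"
    then have "e / (k * k) > 0" using k by simp
    then obtain d where d: "d > 0" "\<And>y. dist y x < d \<Longrightarrow> dist (D zeta (Z y)) (D zeta (Z x)) < e / (k * k)"
      using cD[unfolded continuous_on_iff, rule_format, of x "e / (k * k)"] by auto
    have "dist (A y) (A x) < e" if y: "dist y x < d" for y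
    proof -
      have D: "D zeta (Z y) (A y v - A x v) = (D zeta (Z x) - D zeta (Z y)) (A x v)" for v
        by (simp add: blinfun.bilinear_simps A(2))
      have eq: "A y v - A x v = A y ((D zeta (Z x) - D zeta (Z y)) (A x v))" for v
      proof -
        let ?w = "A y v - A x v - A y ((D zeta (Z x) - D zeta (Z y)) (A x v))"
        have "D zeta (Z y) ?w = 0" by (simp only: blinfun.diff_right[of _ "A y v - A x v"] D A(2) diff_self)
        then have "?w = 0" by (rule zeta_imm)
        then show ?thesis by simp
      qed
      have "norm (A y - A x) \<le> k * (norm (D zeta (Z x) - D zeta (Z y)) * k)"
      proof (rule norm_blinfun_bound)
        fix v
        have "norm ((A y - A x) v) = norm (A y ((D zeta (Z x) - D zeta (Z y)) (A x v)))"
          by (simp only: minus_blinfun.rep_eq eq)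
        also have "\<dots> \<le> k * (norm (D zeta (Z x) - D zeta (Z y)) * (k * norm v))"
          by (intro order_trans[OF norm_blinfun] mult_mono An order_refl) (use k(1) in auto)
        finally show "norm ((A y - A x) v) \<le> k * (norm (D zeta (Z x) - D zeta (Z y)) * k) * norm v"
          by (simp add: mult.assoc)
      qed (use k in auto)
      also have "\<dots> < k * (e / (k * k) * k)"
        using d(2)[OF y] k by (intro mult_strict_left_mono mult_strict_right_mono) (auto simp: dist_norm norm_minus_commute)
      finally show ?thesis using k by (simp add: dist_norm)
    qed
    then show "\<exists>d>0. \<forall>y\<in>UNIV. dist y x < d \<longrightarrow> dist (A y) (A x) < e" using d by blast
  qed
  then show "C_class 1 Z" by (rule C1_I[OF A(1)])
  show "D zeta (Z x) (D Z x v) = v" using D_eqI[OF A(1)] A(2) by simp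
qed

lemma D_Z': "D Z (zeta x) (D zeta x v) = v"
proof -
  have "D zeta x (D Z (zeta x) (D zeta x v) - v) = 0"
    using D_Z[of "zeta x" "D zeta x v"] by (simp add: blinfun.diff_right)
  then show ?thesis using zeta_imm by fastforce
qed

text \<open>
  The derivatives of the chart \<open>kap (x, p) = (zeta x, eta x + c *\<^sub>R p)\<close> around the torus and of its inverse \<open>kinv\<close>.
  They depend on the base point only.
\<close>

definition Dkap :: "real \<Rightarrow> real ^ 'n \<Rightarrow> ((real ^ 'n) \<times> (real ^ 'n)) \<Rightarrow>\<^sub>L ((real ^ 'n) \<times> (real ^ 'n))" where
  "Dkap c x = pair_blinfun (D zeta x o\<^sub>L fst_blinfun, (D eta x o\<^sub>L fst_blinfun) + c *\<^sub>R snd_blinfun)"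

definition Dkinv :: "real \<Rightarrow> real ^ 'n \<Rightarrow> ((real ^ 'n) \<times> (real ^ 'n)) \<Rightarrow>\<^sub>L ((real ^ 'n) \<times> (real ^ 'n))" where
  "Dkinv c x = pair_blinfun (D Z x o\<^sub>L fst_blinfun, (1 / c) *\<^sub>R (snd_blinfun - (D P x o\<^sub>L fst_blinfun)))"

text \<open>
  In the chart, the time \<open>T\<close> map has at points of the torus the derivative \<open>(v, w) \<mapsto> (v + s, n / c)\<close> with \<open>s\<close> and \<open>n\<close>
  linear in \<open>w\<close>. The shear \<open>s\<close> carries the factor \<open>c\<close> of the chart. The normal part \<open>n\<close> is found by
  pairing with a tangent vector: since the torus is Lagrangian, the symplectic form of the tangent vector over
  \<open>n\<close> with the image of \<open>w\<close> is \<open>- norm n ^ 2\<close>, while conformal symplecticity transports it back to time 0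
  with the factor \<open>exp (- lam * T)\<close>.
\<close>

lemma torus_linearization:
  assumes T: "0 \<le> T" and c: "0 < c" and B: "0 < B" "\<And>x. norm (D zeta x) \<le> B" "\<And>x. norm (D Z x) \<le> B"
  shows "norm ((Dkinv c (zeta (x + T *\<^sub>R omega)) o\<^sub>L (F0.dflow T (K x) o\<^sub>L Dkap c x)) - pair_blinfun (fst_blinfun, 0))
    \<le> B * (2 * exp (2 * L * T)) * c + B * B * exp (- (lam * T))"
proof (rule norm_blinfun_bound)
  let ?x = "x + T *\<^sub>R omega"
  let ?M = "F0.dflow T (K x)"
  fix w :: "(real ^ 'n) \<times> (real ^ 'n)"
  define a where "a = fst (?M (0, c *\<^sub>R snd w))"
  define b where "b = snd (?M (0, c *\<^sub>R snd w))"
  define n where "n = b - D P (zeta ?x) a"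
  have ab: "?M (0, c *\<^sub>R snd w) = (a, b)" by (simp add: a_def b_def)
  have "Dkap c x w = DK x (fst w) + (0, c *\<^sub>R snd w)"
    by (simp add: Dkap_def DK_def blinfun.bilinear_simps)
  then have "?M (Dkap c x w) = DK ?x (fst w) + (a, b)"
    by (simp only: blinfun.add_right dflow_on_torus[OF T] ab)
  then have eq: "((Dkinv c (zeta ?x) o\<^sub>L (?M o\<^sub>L Dkap c x)) - pair_blinfun (fst_blinfun, 0)) w = (D Z (zeta ?x) a, (1 / c) *\<^sub>R n)"
    by (simp add: Dkinv_def DK_def blinfun.bilinear_simps D_Z' D_eta n_def prod_eq_iff algebra_simps)
  have "norm (a, b) \<le> (2 * exp (2 * L * T)) * norm (0 :: real ^ 'n, c *\<^sub>R snd w)"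
    unfolding ab[symmetric] by (intro order_trans[OF norm_blinfun] mult_right_mono F0.dflow_le) (use T in auto)
  also have "norm (0 :: real ^ 'n, c *\<^sub>R snd w) \<le> c * norm w"
    using norm_snd_le'[of w] c by (simp add: norm_Pair)
  finally have "norm (a, b) \<le> (2 * exp (2 * L * T)) * (c * norm w)" by simp
  then have "norm a \<le> (2 * exp (2 * L * T)) * (c * norm w)"
    using norm_fst_le'[of "(a, b)"] by simp
  then have 1: "norm (D Z (zeta ?x) a) \<le> B * (2 * exp (2 * L * T) * (c * norm w))"
    by (intro order_trans[OF norm_blinfun] mult_mono B) (use B in auto)
  define v where "v = D Z (zeta ?x) n"
  have v: "D zeta ?x v = n" unfolding v_def using D_Z[of "zeta ?x" n] by simp
  have "symp_form (DK ?x v) (a, b) = exp (- (lam * T)) * symp_form (DK x v) (0, c *\<^sub>R snd w)"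
    unfolding dflow_on_torus[OF T, symmetric] ab[symmetric]
    by (rule dflow_conformal[OF H2 R1 field T]) (use inside_torus in auto)
  moreover have "symp_form (DK ?x v) (a, b) = - (norm n)\<^sup>2"
  proof -
    have "symp_form (n, D P (zeta ?x) n) (a, D P (zeta ?x) a) = 0" by (rule P_symmetric)
    then have "D P (zeta ?x) n \<bullet> a = n \<bullet> D P (zeta ?x) a"
      by (simp add: symp_form_inner J_def inner_prod_def)
    then show ?thesis
      by (simp add: symp_form_inner J_def inner_prod_def DK_def v D_eta n_def power2_norm_eq_inner inner_diff_right inner_diff_left inner_commute)
  qed
  moreover have "symp_form (DK x v) (0, c *\<^sub>R snd w) = - c * (D zeta x v \<bullet> snd w)"
    by (simp add: symp_form_inner J_def inner_prod_def DK_def)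
  ultimately have "(norm n)\<^sup>2 = exp (- (lam * T)) * c * (D zeta x v \<bullet> snd w)" by simp
  also have "\<dots> \<le> exp (- (lam * T)) * c * (B * (B * norm n) * norm w)"
  proof -
    have "D zeta x v \<bullet> snd w \<le> norm (D zeta x v) * norm (snd w)" by (rule norm_cauchy_schwarz)
    also have "\<dots> \<le> B * (B * norm n) * norm w"
    proof (intro mult_mono norm_snd_le')
      show "norm (D zeta x v) \<le> B * (B * norm n)" unfolding v_def
        by (intro order_trans[OF norm_blinfun] mult_mono B order_refl) (use B in auto)
    qed (use B in auto)
    finally show ?thesis using c by (intro mult_left_mono) auto
  qed
  finally have "norm n * norm n \<le> (B * B * exp (- (lam * T)) * c * norm w) * norm n"
    by (simp add: power2_eq_square mult_ac)
  then have "norm n \<le> B * B * exp (- (lam * T)) * c * norm w"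
    using B c by (cases "n = 0") auto
  then have 2: "norm ((1 / c) *\<^sub>R n) \<le> B * B * exp (- (lam * T)) * norm w"
    using c by (simp add: field_simps)
  show "norm (((Dkinv c (zeta ?x) o\<^sub>L (?M o\<^sub>L Dkap c x)) - pair_blinfun (fst_blinfun, 0)) w)
      \<le> (B * (2 * exp (2 * L * T)) * c + B * B * exp (- (lam * T))) * norm w"
    unfolding eq using norm_Pair_le[of "D Z (zeta ?x) a" "(1 / c) *\<^sub>R n"] 1 2 by (simp add: algebra_simps)
qed (use B c in auto)

lemma D_Z_le: "\<exists>B. \<forall>x. norm (D Z x) \<le> B"
proof -
  obtain k where k: "k > 0" "\<And>x v. norm v \<le> k * norm (D zeta x v)" using zeta_expands by blast
  have "norm (D Z x) \<le> k" for x
    by (rule norm_blinfun_bound) (use k(1) k(2)[of "D Z x _" "Z x"] D_Z in auto)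
  then show ?thesis by blast
qed

lemma Dkap_regular: "bounded (range (Dkap c))"
proof (rule uniformly_continuous_torus(2))
  show "continuous_on UNIV (Dkap c)"
    by (rule continuous_on_blinfun_componentwise)
      (simp add: Dkap_def blinfun.bilinear_simps, intro continuous_intros C1_D(2)[OF zeta] C1_D(2)[OF eta])
  show "Dkap c (x + m) = Dkap c x" if "int_vec m" for x m
    using D_shift[OF zeta zeta_shift[OF that]] D_periodic[OF eta eta_period[OF that]] by (simp add: Dkap_def)
qed

lemma Dkinv_regular: "uniformly_continuous_on UNIV (Dkinv c)" "bounded (range (Dkinv c))"
proof -
  have c: "continuous_on UNIV (Dkinv c)"
    by (rule continuous_on_blinfun_componentwise)
      (simp add: Dkinv_def blinfun.bilinear_simps, intro continuous_intros C1_D(2)[OF Z_C1] C1_D(2)[OF P])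
  have p: "Dkinv c (x + m) = Dkinv c x" if "int_vec m" for x m
    using D_shift[OF Z_C1 Z_shift[OF that]] D_periodic[OF P P_period[OF that]] by (simp add: Dkinv_def)
  show "uniformly_continuous_on UNIV (Dkinv c)" "bounded (range (Dkinv c))"
    using uniformly_continuous_torus[OF c p] by blast+
qed

end


section \<open>The invariant graph of a perturbed system\<close>

lemma C1_I':
  assumes "\<And>z. (f has_derivative A z) (at z)" "\<And>v. continuous_on UNIV (\<lambda>z. A z v)"
  shows "C_class 1 f"
proof -
  have "frechet_derivative f (at z) = A z" for z
    using frechet_derivative_at[OF assms(1)] by simp
  then show ?thesis using differentiableI[OF assms(1)] assms(2) by simp
qed

lemma C1_compose:
  assumes f: "C_class 1 f" and g: "C_class 1 g"
  shows "C_class 1 (\<lambda>z. f (g z))" "D (\<lambda>z. f (g z)) z = D f (g z) o\<^sub>L D g z"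
proof -
  have d: "((\<lambda>z. f (g z)) has_derivative (\<lambda>v. D f (g z) (D g z v))) (at z)" for z
    by (rule has_derivative_compose[OF C1_D(1)[OF g] C1_D(1)[OF f]])
  show "C_class 1 (\<lambda>z. f (g z))"
    by (rule C1_I'[OF d])
      (intro continuous_intros continuous_on_compose2[OF C1_D(2)[OF f] C1_D(3)[OF g]] C1_D(2)[OF g]; simp)
  show "D (\<lambda>z. f (g z)) z = D f (g z) o\<^sub>L D g z"
    using d by (intro D_eqI) (simp add: blinfun_compose.rep_eq o_def)
qed

text \<open>
  Multiplication by a cut-off reduces the strip to the case of functions that vanish for large momenta.
\<close>

lemma uniformly_continuous_strip:
  fixes g :: "(real ^ 'n) \<times> (real ^ 'n) \<Rightarrow> 'f::real_normed_vector"
  assumes g: "continuous_on UNIV g" and period: "\<And>x p m. int_vec m \<Longrightarrow> g (x + m, p) = g (x, p)" and r: "0 \<le> r"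
  shows "uniformly_continuous_on {z. norm (snd z) \<le> r} g"
proof -
  let ?g = "\<lambda>z. bump r (r + 1) (snd z) *\<^sub>R g z"
  have "r\<^sup>2 < (r + 1)\<^sup>2" using r by (intro power_strict_mono) auto
  then have "continuous_on UNIV (bump r (r + 1) :: real ^ 'n \<Rightarrow> real)"
    using bump_deriv has_derivative_continuous by (blast intro: continuous_at_imp_continuous_on)
  then have b: "continuous_on UNIV (\<lambda>z::(real ^ 'n) \<times> (real ^ 'n). bump r (r + 1) (snd z))"
    by (rule continuous_on_compose2) (auto intro: continuous_intros)
  have "uniformly_continuous_on UNIV ?g"
    by (rule uniformly_continuous_cotangent[where R = "r + 1" and c = 0])
      (use r in \<open>auto intro!: continuous_on_scaleR b g simp: period bump_outside\<close>)
  note uc = this[unfolded uniformly_continuous_on_def, rule_format]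
  have eq: "?g z = g z" if "norm (snd z) \<le> r" for z
    using bump_inside(1)[OF that, of "r + 1"] by simp
  show ?thesis unfolding uniformly_continuous_on_def
  proof (intro allI impI)
    fix e :: real assume "e > 0"
    from uc[OF this] obtain d where d: "d > 0" "\<And>x y. dist y x < d \<Longrightarrow> dist (?g y) (?g x) < e"
      by blast
    show "\<exists>d>0. \<forall>x\<in>{z. norm (snd z) \<le> r}. \<forall>y\<in>{z. norm (snd z) \<le> r}. dist y x < d \<longrightarrow> dist (g y) (g x) < e"
    proof (intro exI[of _ d] conjI d(1) ballI impI)
      fix x y :: "(real ^ 'n) \<times> (real ^ 'n)"
      assume "x \<in> {z. norm (snd z) \<le> r}" "y \<in> {z. norm (snd z) \<le> r}" "dist y x < d"
      then show "dist (g y) (g x) < e" using d(2)[where x = x and y = y] eq[of x] eq[of y] by simp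
    qed
  qed
qed

lemma (in C1_field) dflow_continuous:
  assumes T: "0 \<le> T"
  shows "continuous_on UNIV (dflow T)"
  unfolding continuous_on_iff
proof (intro ballI allI impI)
  fix z and e :: real assume e: "0 < e"
  then have e2: "0 < e / 2" by simp
  obtain d where d: "d > 0" and close: "\<And>y. norm (y - z) \<le> d \<Longrightarrow> norm (dflow T y - dflow T z) \<le> e / 2"
    using flow_perturbation[OF C1_field_axioms T e2] C1_field_axioms T by (metis atLeastAtMost_iff cancel_comm_monoid_add_class.diff_cancel norm_zero order_le_less order_refl)
  show "\<exists>d>0. \<forall>y\<in>UNIV. dist y z < d \<longrightarrow> dist (dflow T y) (dflow T z) < e"
  proof (intro exI[of _ d] conjI d ballI impI)
    fix y assume "dist y z < d"
    then show "dist (dflow T y) (dflow T z) < e" using close[of y] e by (simp add: dist_norm)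
  qed
qed

text \<open>
  A perturbed Hamiltonian whose time \<open>T\<close> map in the chart is close to \<open>(x, p) \<mapsto> (x + T *\<^sub>R omega, 0)\<close>: in
  derivative on the strip of width \<open>rho\<close>, and in value on the torus itself. The condition
  \<open>4 * exp (- (lam * T)) < 1\<close> says that the symplectic form contracts faster than the square of the growth rate 2
  of backward orbits.
\<close>

locale perturbed_kam = kam_setting H lam omega P zeta eta R0 R1 R L
  for H :: "(real ^ 'n) \<times> (real ^ 'n) \<Rightarrow> real" and lam omega P zeta eta R0 R1 R L +
  fixes H' :: "(real ^ 'n) \<times> (real ^ 'n) \<Rightarrow> real" and T c rho :: real
  assumes H': "hamiltonian 2 H'"
    and field': "C1_field (cut R1 R (cs_field H' lam)) (dcut R1 R (cs_field H' lam)) L"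
    and T: "0 < T" and c: "0 < c" and rho: "0 < rho" and crho: "R0 + c * rho \<le> R1"
    and contraction: "4 * exp (- (lam * T)) < 1"
    and near: "\<And>x p. norm p \<le> rho \<Longrightarrow>
      norm ((Dkinv c (fst (C1_field.flow (cut R1 R (cs_field H' lam)) T (zeta x, eta x + c *\<^sub>R p))) o\<^sub>L
        (C1_field.dflow (cut R1 R (cs_field H' lam)) (dcut R1 R (cs_field H' lam)) T (zeta x, eta x + c *\<^sub>R p) o\<^sub>L Dkap c x))
        - pair_blinfun (fst_blinfun, 0)) \<le> 1 / 16"
    and base: "\<And>x y. y = C1_field.flow (cut R1 R (cs_field H' lam)) T (K x) \<Longrightarrow>
      norm ((1 / c) *\<^sub>R (snd y - P (fst y))) \<le> rho / 4"
begin

interpretation F: C1_field "cut R1 R (cs_field H' lam)" "dcut R1 R (cs_field H' lam)" L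
  by (rule field')

lemma H'2: "C_class 2 H'" using H' by (simp add: hamiltonian_def)

definition kap :: "(real ^ 'n) \<times> (real ^ 'n) \<Rightarrow> (real ^ 'n) \<times> (real ^ 'n)" where
  "kap z = (zeta (fst z), eta (fst z) + c *\<^sub>R snd z)"

definition kinv :: "(real ^ 'n) \<times> (real ^ 'n) \<Rightarrow> (real ^ 'n) \<times> (real ^ 'n)" where
  "kinv y = (Z (fst y), (1 / c) *\<^sub>R (snd y - P (fst y)))"

lemma kap_kinv [simp]: "kap (kinv y) = y" and kinv_kap [simp]: "kinv (kap z) = z"
  using c by (simp_all add: kap_def kinv_def eta_eq prod_eq_iff)

lemma kap_shift: "int_vec m \<Longrightarrow> kap (z + (m, 0)) = kap z + (m, 0)"
  by (simp add: kap_def zeta_shift eta_period)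

lemma kinv_shift: "int_vec m \<Longrightarrow> kinv (y + (m, 0)) = kinv y + (m, 0)"
  by (simp add: kinv_def Z_shift P_period)

lemma kap_C1: "C_class 1 kap" and D_kap: "D kap z = Dkap c (fst z)"
proof -
  have d: "(kap has_derivative (\<lambda>v. (D zeta (fst z) (fst v), D eta (fst z) (fst v) + c *\<^sub>R snd v))) (at z)" for z
    unfolding kap_def[abs_def]
    by (intro has_derivative_Pair has_derivative_add has_derivative_scaleR_right has_derivative_snd has_derivative_ident
        has_derivative_compose[OF has_derivative_fst[OF has_derivative_ident] C1_D(1)[OF zeta]]
        has_derivative_compose[OF has_derivative_fst[OF has_derivative_ident] C1_D(1)[OF eta]])
  show "C_class 1 kap"
    by (rule C1_I'[OF d])
      (intro continuous_intros continuous_on_compose2[OF C1_D(2)[OF zeta]] continuous_on_compose2[OF C1_D(2)[OF eta]]; simp)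
  show "D kap z = Dkap c (fst z)"
    by (rule D_eqI, rule has_derivative_eq_rhs[OF d])
      (simp add: Dkap_def fun_eq_iff blinfun.bilinear_simps)
qed

lemma kinv_C1: "C_class 1 kinv" and D_kinv: "D kinv y = Dkinv c (fst y)"
proof -
  have d: "(kinv has_derivative (\<lambda>v. (D Z (fst y) (fst v), (1 / c) *\<^sub>R (snd v - D P (fst y) (fst v))))) (at y)" for y
    unfolding kinv_def[abs_def]
    by (intro has_derivative_Pair has_derivative_diff has_derivative_scaleR_right has_derivative_snd has_derivative_ident
        has_derivative_compose[OF has_derivative_fst[OF has_derivative_ident] C1_D(1)[OF Z_C1]]
        has_derivative_compose[OF has_derivative_fst[OF has_derivative_ident] C1_D(1)[OF P]])
  show "C_class 1 kinv"
    by (rule C1_I'[OF d])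
      (intro continuous_intros continuous_on_compose2[OF C1_D(2)[OF Z_C1]] continuous_on_compose2[OF C1_D(2)[OF P]]; simp)
  show "D kinv y = Dkinv c (fst y)"
    by (rule D_eqI, rule has_derivative_eq_rhs[OF d])
      (simp add: Dkinv_def fun_eq_iff blinfun.bilinear_simps)
qed

lemma flow_C1: "0 \<le> t \<Longrightarrow> C_class 1 (F.flow t)" and D_flow: "0 \<le> t \<Longrightarrow> D (F.flow t) z = F.dflow t z"
  using C1_I[OF F.flow_has_derivative F.dflow_continuous] D_eqI[OF F.flow_has_derivative] by blast+

lemma flow_shift:
  assumes m: "int_vec m" and t: "0 \<le> t"
  shows "F.flow t (z + (m, 0)) = F.flow t z + (m, 0)"
proof -
  have "(\<lambda>t. F.flow t z + (m, 0)) t = F.flow t ((\<lambda>t. F.flow t z + (m, 0)) 0)"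
  proof (rule F.flow_unique[where T = t])
    fix s assume s: "s \<in> {0..t}"
    have "cut R1 R (cs_field H' lam) (y + (m, 0)) = cut R1 R (cs_field H' lam) y" for y
      using cs_field_periodic[OF H' m, of lam "fst y" "snd y"] by (cases y) (simp add: cut_def)
    then show "((\<lambda>t. F.flow t z + (m, 0)) has_vector_derivative cut R1 R (cs_field H' lam) (F.flow s z + (m, 0))) (at s within {0..t})"
      using has_vector_derivative_add[OF F.flow_deriv_Icc[OF s, of z] has_vector_derivative_const[of "(m, 0)"]] by simp
  qed (use t in auto)
  then show ?thesis by simp
qed

definition G :: "(real ^ 'n) \<times> (real ^ 'n) \<Rightarrow> (real ^ 'n) \<times> (real ^ 'n)" where
  "G z = kinv (F.flow T (kap z)) - (fst z + T *\<^sub>R omega, 0)"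

lemma G_C1: "C_class 1 G"
  and D_G: "D G z = (Dkinv c (fst (F.flow T (kap z))) o\<^sub>L (F.dflow T (kap z) o\<^sub>L Dkap c (fst z))) - pair_blinfun (fst_blinfun, 0)"
proof -
  have T0: "0 \<le> T" using T by simp
  let ?g = "\<lambda>z. kinv (F.flow T (kap z))"
  have c1: "C_class 1 (\<lambda>z. F.flow T (kap z))" by (rule C1_compose(1)[OF flow_C1[OF T0] kap_C1])
  have c2: "C_class 1 ?g" by (rule C1_compose(1)[OF kinv_C1 c1])
  have Dg: "D ?g z = Dkinv c (fst (F.flow T (kap z))) o\<^sub>L (F.dflow T (kap z) o\<^sub>L Dkap c (fst z))" for z
    by (simp add: C1_compose(2)[OF kinv_C1 c1] C1_compose(2)[OF flow_C1[OF T0] kap_C1] D_kinv D_kap D_flow[OF T0])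
  have "((\<lambda>z. (fst z + T *\<^sub>R omega, 0 :: real ^ 'n)) has_derivative (\<lambda>v. (fst v, 0))) (at z)" for z :: "(real ^ 'n) \<times> (real ^ 'n)"
    by (auto intro!: derivative_eq_intros)
  from has_derivative_diff[OF C1_D(1)[OF c2] this]
  have d: "(G has_derivative (\<lambda>v. D ?g z v - (fst v, 0))) (at z)" for z unfolding G_def[abs_def] .
  show "C_class 1 G"
    by (rule C1_I'[OF d]) (intro continuous_intros C1_D(2)[OF c2])
  show "D G z = (Dkinv c (fst (F.flow T (kap z))) o\<^sub>L (F.dflow T (kap z) o\<^sub>L Dkap c (fst z))) - pair_blinfun (fst_blinfun, 0)"
    by (rule D_eqI, rule has_derivative_eq_rhs[OF d]) (simp add: Dg fun_eq_iff blinfun.diff_left)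
qed

lemma G_period: "int_vec m \<Longrightarrow> G (z + (m, 0)) = G z"
  using T by (simp add: G_def kap_shift flow_shift kinv_shift prod_eq_iff)

lemma D_G_le: "norm (snd z) \<le> rho \<Longrightarrow> norm (D G z) \<le> 1 / 16"
  unfolding D_G using near[of "snd z" "fst z"] by (simp add: kap_def)

text \<open>
  Half of the strip is left as a margin, so that orbits can be moved by the flow for a short time without leaving
  the strip.
\<close>

lemma G_half: 
  assumes "norm (snd z) \<le> rho"
  shows "norm (snd (G z)) \<le> rho / 2"
proof -
  let ?S = "UNIV \<times> cball 0 rho :: ((real ^ 'n) \<times> (real ^ 'n)) set"
  have "norm (G z - G (fst z, 0)) \<le> 1 / 16 * norm (z - (fst z, 0))"
  proof (rule differentiable_bound[where S = ?S])
    show "convex ?S" by (intro convex_Times) auto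
    show "(G has_derivative D G x) (at x within ?S)" for x
      by (rule has_derivative_at_withinI[OF C1_D(1)[OF G_C1]])
    show "onorm (D G x) \<le> 1 / 16" if "x \<in> ?S" for x
      using D_G_le[of x] that by (auto simp: norm_blinfun.rep_eq)
  qed (use assms rho in \<open>auto simp: mem_Times_iff\<close>)
  also have "norm (z - (fst z, 0)) = norm (snd z)" by (cases z) (simp add: norm_Pair)
  finally have "norm (snd (G z) - snd (G (fst z, 0))) \<le> rho / 16"
    using norm_snd_le'[of "G z - G (fst z, 0)"] assms by simp
  moreover have "norm (snd (G (fst z, 0))) \<le> rho / 4"
    using base[OF refl, of "fst z"] by (simp add: G_def kinv_def kap_def K_def)
  ultimately show ?thesis using norm_triangle_sub[of "snd (G z)" "snd (G (fst z, 0))"] rho by linarith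
qed

interpretation NT: near_translation G "D G" "T *\<^sub>R omega" rho
proof
  show "uniformly_continuous_on {z. norm (snd z) \<le> rho} (D G)"
  proof (rule uniformly_continuous_strip[OF C1_D(2)[OF G_C1]])
    show "D G (x + m, p) = D G (x, p)" if "int_vec m" for x p m
      using D_periodic[OF G_C1 G_period[OF that], of "(x, p)"] by simp
  qed (use rho in simp)
  show "norm (snd z) \<le> rho \<Longrightarrow> norm (snd (G z)) \<le> rho" for z
    using G_half[of z] rho by simp
qed (use rho C1_D(1)[OF G_C1] D_G_le in auto)

lemma Psi_eq: "NT.Psi z = kinv (F.flow T (kap z))"
  by (simp add: NT.Psi_def G_def prod_eq_iff)

lemma kap_Psi: "kap (NT.Psi z) = F.flow T (kap z)"
  by (simp add: Psi_eq)

lemma orbit_half: "norm (snd (NT.orbit q k)) \<le> rho / 2"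
  unfolding NT.orbit_step[of q k] using G_half[OF NT.orbit_strip] by (simp add: NT.Psi_def)

lemma orbit_shift: "int_vec m \<Longrightarrow> NT.orbit (q + m) k = NT.orbit q k + (m, 0)"
proof -
  assume m: "int_vec m"
  obtain C where C: "\<And>k. norm (NT.orbit q k) \<le> C * 2 ^ k" using NT.is_orbitD(3)[OF NT.orbit(1)[of q]] by blast
  have "NT.is_orbit (\<lambda>k. NT.orbit q k + (m, 0))"
  proof (rule NT.is_orbitI)
    fix k
    have "NT.Psi (z + (m, 0)) = NT.Psi z + (m, 0)" for z
      using T m by (simp add: Psi_eq kap_shift flow_shift kinv_shift)
    then show "NT.orbit q k + (m, 0) = NT.Psi (NT.orbit q (Suc k) + (m, 0))"
      using NT.orbit_step[of q k] by simp
    show "norm (snd (NT.orbit q k + (m, 0))) \<le> rho" using NT.orbit_strip by simp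
    have "norm m * 1 \<le> norm m * 2 ^ k" by (intro mult_left_mono) auto
    then have "norm (NT.orbit q k) + norm (m, 0 :: real ^ 'n) \<le> (C + norm m) * 2 ^ k"
      using C[of k] by (simp add: norm_Pair distrib_right)
    then show "norm (NT.orbit q k + (m, 0)) \<le> (C + norm m) * 2 ^ k"
      using norm_triangle_ineq[of "NT.orbit q k" "(m, 0)"] by linarith
  qed
  from fun_cong[OF NT.orbit_unique[OF this], of k] show ?thesis by (simp add: NT.orbit(2))
qed

lemma orbit_tail_base: "NT.orbit q k = NT.orbit (fst (NT.orbit q k)) 0"
proof (induction k arbitrary: q)
  case 0
  show ?case by (simp add: NT.orbit(2))
next
  case (Suc k)
  show ?case using Suc[of "fst (NT.orbit q (Suc 0))"] fun_cong[OF NT.orbit_tail[of q], of k] by simp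
qed

text \<open>
  The parametrization of the perturbed graph over the parameter of the unperturbed torus.
\<close>

definition E :: "real ^ 'n \<Rightarrow> (real ^ 'n) \<times> (real ^ 'n)" where
  "E q = kap (NT.orbit q 0)"

lemma E_backward: "E q = F.flow (real k * T) (kap (NT.orbit q k))"
proof (induction k)
  case 0
  show ?case by (simp add: E_def)
next
  case (Suc k)
  have "F.flow (real (Suc k) * T) (kap (NT.orbit q (Suc k))) = F.flow (real k * T + T) (kap (NT.orbit q (Suc k)))"
    by (simp add: algebra_simps)
  also have "\<dots> = F.flow (real k * T) (kap (NT.orbit q k))"
    using T NT.orbit_step[of q k] kap_Psi[of "NT.orbit q (Suc k)"] by (simp add: F.flow_add)
  finally show ?case using Suc by simp
qed

lemma E_inside: "norm (snd (E q)) \<le> R1"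
proof -
  have "norm (snd (E q)) \<le> norm (eta q) + c * norm (snd (NT.orbit q 0))"
    using norm_triangle_ineq[of "eta q" "c *\<^sub>R snd (NT.orbit q 0)"] c by (simp add: E_def kap_def NT.orbit(2))
  also have "\<dots> \<le> R0 + c * rho"
    using P_le[of "zeta q"] NT.orbit_strip[of q 0] c by (intro add_mono mult_left_mono) (auto simp: eta_eq)
  finally show ?thesis using crho by simp
qed

lemma kinv_Lipschitz: "\<exists>M>0. \<forall>y y'. norm (kinv y - kinv y') \<le> M * norm (y - y')"
proof -
  obtain B where B: "B > 0" "\<And>x. norm (D P x) \<le> B" using D_bounded by blast
  obtain k where DZ: "\<And>x. norm (D Z x) \<le> k" using D_Z_le by blast
  have k: "0 \<le> k" using DZ[of 0] norm_ge_zero order_trans by blast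
  have "norm (kinv y - kinv y') \<le> (k + (1 / c) * (1 + B)) * norm (y - y')" for y y'
  proof -
    have f: "norm (fst y - fst y') \<le> norm (y - y')" and s: "norm (snd y - snd y') \<le> norm (y - y')"
      using norm_fst_le'[of "y - y'"] norm_snd_le'[of "y - y'"] by auto
    have "norm (fst (kinv y - kinv y')) \<le> k * norm (y - y')"
      using order_trans[OF C1_Lipschitz[OF Z_C1 DZ] mult_left_mono[OF f]] k by (simp add: kinv_def)
    moreover have "norm (snd (kinv y - kinv y')) \<le> (1 / c) * (1 + B) * norm (y - y')"
    proof -
      have "norm (P (fst y) - P (fst y')) \<le> B * norm (y - y')"
        using order_trans[OF C1_Lipschitz[OF P B(2)] mult_left_mono[OF f]] B by simp
      then have "norm ((snd y - snd y') - (P (fst y) - P (fst y'))) \<le> (1 + B) * norm (y - y')"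
        using s norm_triangle_ineq4[of "snd y - snd y'" "P (fst y) - P (fst y')"] by (simp add: distrib_right)
      moreover have "snd (kinv y - kinv y') = (1 / c) *\<^sub>R ((snd y - snd y') - (P (fst y) - P (fst y')))"
        unfolding kinv_def snd_diff snd_conv scaleR_diff_right[symmetric] by (rule arg_cong[where f = "scaleR (1 / c)"]) simp
      ultimately show ?thesis using c by (simp add: divide_right_mono)
    qed
    ultimately show ?thesis using norm_prod_le[of "kinv y - kinv y'"] by (simp add: distrib_right)
  qed
  moreover have "0 < k + (1 / c) * (1 + B)" using k B c by (intro add_nonneg_pos mult_pos_pos) auto
  ultimately show ?thesis by blast
qed

text \<open>
  The graph is so far invariant under the time \<open>T\<close> map. The time \<open>t\<close> map commutes with it, hence maps a backward
  orbit to a sequence with the orbit property; for small \<open>t\<close> this stays in the strip, and uniqueness puts its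
  first point on the graph.
\<close>

lemma E_forward_small: "\<exists>t0>0. \<forall>t q. 0 \<le> t \<longrightarrow> t \<le> t0 \<longrightarrow> F.flow t (E q) \<in> range E"
proof -
  obtain M where M: "M > 0" "\<And>y y'. norm (kinv y - kinv y') \<le> M * norm (y - y')" using kinv_Lipschitz by blast
  have "0 \<le> R1" using R0 R01 by simp
  then have "bounded (range (cut R1 R (cs_field H' lam)))"
    by (rule cut_regular(3)[OF cs_field_C1(1)[OF H'2] _ R1 cs_field_periodic[OF H']])
  then obtain N where N: "\<And>z. norm (cut R1 R (cs_field H' lam) z) \<le> N" unfolding bounded_iff by blast
  have N0: "0 \<le> N" using N[of 0] norm_ge_zero order_trans by blast
  \<comment> \<open>\<open>N\<close> bounds the speed and \<open>M\<close> the distortion by the chart; points move at most \<open>rho / 2\<close>\<close>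
  define t0 where "t0 = rho / (2 * M * (N + 1))"
  have t0: "t0 > 0" using rho M N0 by (simp add: t0_def)
  have "F.flow t (E q) \<in> range E" if t: "0 \<le> t" "t \<le> t0" for t q
  proof -
    define y where "y k = kinv (F.flow t (kap (NT.orbit q k)))" for k
    have close: "norm (y k - NT.orbit q k) \<le> rho / 2" for k
    proof -
      have "norm (y k - NT.orbit q k) \<le> M * norm (F.flow t (kap (NT.orbit q k)) - kap (NT.orbit q k))"
        using M(2)[of "F.flow t (kap (NT.orbit q k))" "kap (NT.orbit q k)"] by (simp add: y_def)
      also have "\<dots> \<le> M * (N * t)" using M N t by (intro mult_left_mono F.flow_displacement) auto
      also have "\<dots> \<le> M * ((N + 1) * t0)" using M N0 t by (intro mult_left_mono mult_mono) auto
      also have "\<dots> = rho / 2" using M N0 by (simp add: t0_def)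
      finally show ?thesis .
    qed
    obtain C where C: "\<And>k. norm (NT.orbit q k) \<le> C * 2 ^ k" using NT.is_orbitD(3)[OF NT.orbit(1)[of q]] by blast
    have "NT.is_orbit y"
    proof (rule NT.is_orbitI)
      fix k
      have "NT.Psi (y (Suc k)) = kinv (F.flow (T + t) (kap (NT.orbit q (Suc k))))"
        using T t by (simp add: y_def Psi_eq F.flow_add)
      also have "\<dots> = kinv (F.flow t (F.flow T (kap (NT.orbit q (Suc k)))))"
        using T t F.flow_add[of T t] by (simp add: add.commute)
      also have "\<dots> = y k" using NT.orbit_step[of q k] kap_Psi[of "NT.orbit q (Suc k)"] by (simp add: y_def)
      finally show "y k = NT.Psi (y (Suc k))" by simp
      show "norm (snd (y k)) \<le> rho"
        using close[of k] orbit_half[of q k] norm_snd_le'[of "y k - NT.orbit q k"]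
          norm_triangle_sub[of "snd (y k)" "snd (NT.orbit q k)"] by simp
      have "rho / 2 * 1 \<le> rho / 2 * 2 ^ k" using rho by (intro mult_left_mono) auto
      then show "norm (y k) \<le> (C + rho / 2) * 2 ^ k"
        using C[of k] close[of k] norm_triangle_sub[of "y k" "NT.orbit q k"] by (simp add: distrib_right)
    qed
    from fun_cong[OF NT.orbit_unique[OF this], of 0]
    have "kap (y 0) = E (fst (y 0))" unfolding E_def by (rule arg_cong)
    then have "F.flow t (E q) = E (fst (y 0))" by (simp add: y_def E_def)
    then show ?thesis by blast
  qed
  then show ?thesis using t0 by blast
qed

lemma E_forward:
  assumes "0 \<le> t"
  shows "F.flow t (E q) \<in> range E"
proof -
  obtain t0 where t0: "t0 > 0" and small: "\<And>t q. 0 \<le> t \<Longrightarrow> t \<le> t0 \<Longrightarrow> F.flow t (E q) \<in> range E"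
    using E_forward_small by blast
  have *: "F.flow t (E q) \<in> range E" if "0 \<le> t" "t \<le> real n * t0" for n t q
    using that
  proof (induction n arbitrary: t)
    case 0
    then show ?case using small[of 0 q] t0 by simp
  next
    case (Suc n)
    show ?case
    proof (cases "t \<le> t0")
      case False
      then have "F.flow (t - t0) (E q) \<in> range E" using Suc by (intro Suc.IH) (auto simp: algebra_simps)
      then obtain q' where "F.flow (t - t0) (E q) = E q'" by blast
      then have "F.flow t (E q) = F.flow t0 (E q')"
        using F.flow_add[of "t - t0" t0 "E q"] False t0 by simp
      then show ?thesis using small[of t0 q'] t0 by simp
    qed (use Suc small in auto)
  qed
  obtain n :: nat where "t < real n * t0" using t0 ex_less_of_nat_mult by blast
  then show ?thesis using *[OF assms, of n q] by simp
qed

lemma flow_inside: "0 \<le> t \<Longrightarrow> norm (snd (F.flow t (E q))) \<le> R1"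
  using E_forward[of t q] E_inside by force

lemma flow_deriv_uncut:
  assumes "0 \<le> t"
  shows "((\<lambda>t. F.flow t (E q)) has_vector_derivative cs_field H' lam (F.flow t (E q))) (at t within {0..})"
  using F.flow_deriv[OF assms, of "E q"] bump_inside(1)[OF flow_inside[OF assms, of q] R1] by (simp add: cut_def)

text \<open>
  For negative times a solution through a point of the graph is a piece of a forward orbit that starts
  at an earlier point of its backward orbit.
\<close>

lemma range_E_invariant: "cs_invariant H' lam (range E)"
  unfolding cs_invariant_def
proof (intro ballI allI)
  fix z t assume "z \<in> range E"
  then obtain q where q: "z = E q" by blast
  show "\<exists>w\<in>range E. cs_flow H' lam t z w"
  proof (cases "0 \<le> t")
    case True
    have "cs_flow H' lam t z (F.flow t (E q))"
      unfolding cs_flow_def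
    proof (intro exI[of _ "\<lambda>t. F.flow t (E q)"] conjI ballI)
      fix s assume "s \<in> closed_segment 0 t"
      then have "0 \<le> s" using True by (simp add: closed_segment_eq_real_ivl)
      then show "((\<lambda>t. F.flow t (E q)) has_vector_derivative cs_field H' lam (F.flow s (E q))) (at s within closed_segment 0 t)"
        by (rule has_vector_derivative_within_subset[OF flow_deriv_uncut])
          (use True in \<open>auto simp: closed_segment_eq_real_ivl\<close>)
    qed (simp_all add: q)
    then show ?thesis using E_forward[OF True] by blast
  next
    case False
    obtain k :: nat where k: "- t < real k * T" using T ex_less_of_nat_mult by blast
    define q' where "q' = fst (NT.orbit q k)"
    have Eq': "kap (NT.orbit q k) = E q'" using orbit_tail_base[of q k] by (simp add: E_def q'_def)
    let ?c = "\<lambda>s. F.flow (real k * T + s) (E q')"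
    have "cs_flow H' lam t z (?c t)"
      unfolding cs_flow_def
    proof (intro exI[of _ ?c] conjI ballI)
      show "?c 0 = z" using E_backward[of q k] by (simp add: q Eq')
      fix s assume s: "s \<in> closed_segment 0 t"
      then have s': "t \<le> s" "s \<le> 0" using False by (auto simp: closed_segment_eq_real_ivl)
      have "((\<lambda>t. F.flow t (E q')) has_vector_derivative cs_field H' lam (?c s))
          (at (real k * T + s) within (\<lambda>s. real k * T + s) ` closed_segment 0 t)"
        by (rule has_vector_derivative_within_subset[OF flow_deriv_uncut])
          (use False k s' in \<open>auto simp: closed_segment_eq_real_ivl\<close>)
      then have "((\<lambda>t. F.flow t (E q')) \<circ> (\<lambda>s. real k * T + s) has_vector_derivative 1 *\<^sub>R cs_field H' lam (?c s)) (at s within closed_segment 0 t)"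
        by (intro vector_diff_chain_within) (auto intro!: derivative_eq_intros)
      then show "(?c has_vector_derivative cs_field H' lam (?c s)) (at s within closed_segment 0 t)"
        by (simp add: o_def)
    qed simp
    moreover have "?c t \<in> range E" using k by (intro E_forward) simp
    ultimately show ?thesis by blast
  qed
qed

definition Q :: "real ^ 'n \<Rightarrow> real ^ 'n" where
  "Q x = P x + c *\<^sub>R snd (NT.orbit (Z x) 0)"

lemma E_Z: "E (Z x) = (x, Q x)"
  by (simp add: E_def kap_def NT.orbit(2) Q_def P_eq)

lemma graph_Q: "graph_of Q = range E"
proof -
  have "E q \<in> graph_of Q" for q using E_Z[of "zeta q"] by (simp add: graph_of_def)
  moreover have "(x, Q x) \<in> range E" for x using E_Z[of x] by (metis rangeI)
  ultimately show ?thesis by (auto simp: graph_of_def)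
qed

lemma Q_close: "norm (Q x - P x) \<le> c * rho"
  using NT.orbit_strip[of "Z x" 0] c by (simp add: Q_def)

lemma Q_C1: "C1_torus_map Q"
  unfolding C1_torus_map_def
proof (intro conjI allI impI)
  let ?B = "\<lambda>q. snd (NT.orbit q 0)"
  have d: "(?B has_derivative snd (NT.tangent_orbit q 0)) (at q)" for q
    by (rule has_derivative_eq_rhs[OF has_derivative_snd[OF NT.orbit_derivative]]) (simp add: fun_eq_iff)
  have B: "C_class 1 ?B"
    by (rule C1_I[OF d]) (intro continuous_on_snd NT.tangent_orbit_continuous)
  note BZ = C1_compose(1)[OF B Z_C1]
  show "C_class 1 Q" unfolding Q_def[abs_def]
    by (rule C1_I'[OF has_derivative_add[OF C1_D(1)[OF P] has_derivative_scaleR_right[OF C1_D(1)[OF BZ]]]])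
      (intro continuous_intros C1_D(2)[OF P] C1_D(2)[OF BZ])
  show "Q (x + m) = Q x" if "int_vec m" for x m
    using that by (simp add: Q_def P_period Z_shift orbit_shift)
qed

text \<open>
  Tangent vectors of the graph are images under the time \<open>k * T\<close> flow of tangent vectors at the \<open>k\<close>-th point
  of the backward orbit, of size at most a constant times \<open>2 ^ k\<close>. The symplectic form of two of them is
  therefore at most a constant times \<open>4 ^ k * exp (- lam * k * T)\<close>, which tends to 0.
\<close>

lemma E_tangent_isotropic:
  assumes "(E has_derivative E') (at q)"
  shows "symp_form (E' u) (E' v) = 0"
proof -
  obtain B where B: "\<And>x. norm (Dkap c x) \<le> B" using Dkap_regular[of c] unfolding bounded_iff by auto
  have B0: "0 \<le> B" using B[of 0] norm_ge_zero order_trans by blast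
  define V where "V k w = Dkap c (fst (NT.orbit q k)) (pair_blinfun (NT.tangent_orbit q k) w)" for k w
  have Vn: "norm (V k w) \<le> B * (8 * 2 ^ k * norm w)" for k w unfolding V_def
    by (intro order_trans[OF norm_blinfun] mult_mono B mult_right_mono order_trans[OF norm_pair_blinfun NT.tangent_orbit_growth])
      (use B0 in auto)
  have "\<bar>symp_form (E' u) (E' v)\<bar> \<le> (64 * B * B * norm u * norm v) * (4 * exp (- (lam * T))) ^ k" for k
  proof -
    have kT: "0 \<le> real k * T" using T by simp
    let ?y = "kap (NT.orbit q k)"
    have "((\<lambda>q. kap (NT.orbit q k)) has_derivative V k) (at q)"
      using has_derivative_compose[OF NT.orbit_derivative[of k q] C1_D(1)[OF kap_C1]] by (simp add: V_def[abs_def] D_kap)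
    from has_derivative_compose[OF this F.flow_has_derivative[OF kT]]
    have "(E has_derivative (\<lambda>w. F.dflow (real k * T) ?y (V k w))) (at q)"
      by (simp flip: E_backward)
    from has_derivative_unique[OF assms this]
    have E': "E' w = F.dflow (real k * T) ?y (V k w)" for w by simp
    have y: "?y = E (fst (NT.orbit q k))" using orbit_tail_base[of q k] by (simp add: E_def)
    have "symp_form (E' u) (E' v) = exp (- (lam * (real k * T))) * symp_form (V k u) (V k v)"
      unfolding E' by (rule dflow_conformal[OF H'2 R1 field' kT]) (use flow_inside y in auto)
    then have "\<bar>symp_form (E' u) (E' v)\<bar> = exp (- (lam * (real k * T))) * \<bar>symp_form (V k u) (V k v)\<bar>"
      by (simp add: abs_mult)
    also have "\<dots> \<le> exp (- (lam * (real k * T))) * ((B * (8 * 2 ^ k * norm u)) * (B * (8 * 2 ^ k * norm v)))"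
      using B0 by (intro mult_left_mono order_trans[OF symp_form_le] mult_mono Vn) auto
    also have "exp (- (lam * (real k * T))) = exp (- (lam * T)) ^ k"
      by (simp add: exp_of_nat_mult[symmetric] mult_ac)
    also have "exp (- (lam * T)) ^ k * ((B * (8 * 2 ^ k * norm u)) * (B * (8 * 2 ^ k * norm v)))
        = (64 * B * B * norm u * norm v) * (4 * exp (- (lam * T))) ^ k"
    proof -
      have "(4 :: real) ^ k = 2 ^ k * 2 ^ k" by (simp flip: power_mult_distrib)
      then show ?thesis by (simp add: power_mult_distrib)
    qed
    finally show ?thesis .
  qed
  from exp_decay_zero[OF _ _ contraction this] show ?thesis by simp
qed

lemma Q_lagrangian: "lagrangian_graph Q"
  unfolding lagrangian_graph_def
proof (intro allI)
  fix x v w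
  have dQ: "(Q has_derivative frechet_derivative Q (at x)) (at x)"
    using Q_C1 by (intro frechet_derivative_works[THEN iffD1] C1_differentiable) (simp add: C1_torus_map_def)
  have "((\<lambda>q. (zeta q, Q (zeta q))) has_derivative (\<lambda>u. (D zeta (Z x) u, frechet_derivative Q (at x) (D zeta (Z x) u)))) (at (Z x))"
    by (intro has_derivative_Pair has_derivative_compose[OF C1_D(1)[OF zeta], of Q] C1_D(1)[OF zeta]) (simp add: dQ)
  moreover have "(\<lambda>q. (zeta q, Q (zeta q))) = E"
  proof
    show "(zeta q, Q (zeta q)) = E q" for q using E_Z[of "zeta q"] by simp
  qed
  ultimately have "(E has_derivative (\<lambda>u. (D zeta (Z x) u, frechet_derivative Q (at x) (D zeta (Z x) u)))) (at (Z x))" by simp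
  from E_tangent_isotropic[OF this, of "D Z x v" "D Z x w"]
  show "symp_form (v, frechet_derivative Q (at x) v) (w, frechet_derivative Q (at x) w) = 0"
    by (simp add: D_Z)
qed

lemma invariant_graph:
  "C1_torus_map Q \<and> lagrangian_graph Q \<and> cs_invariant H' lam (graph_of Q) \<and> (\<forall>x. norm (Q x - P x) \<le> c * rho)"
  using Q_C1 Q_lagrangian range_E_invariant Q_close graph_Q by simp

end


section \<open>Persistence\<close>

text \<open>
  The constants are chosen in the order in which they depend on each other: \<open>T\<close> large for the normal
  contraction, then \<open>c\<close> small to remove the shear over time \<open>T\<close>, then the width \<open>rho\<close> of the strip by uniform
  continuity of the linearization, and last the size of the perturbation, which has to be small relative to \<open>rho\<close>.
\<close>

lemma (in kam_setting) persistence: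
  assumes delta: "0 < delta"
  shows "\<exists>d>0. \<forall>H'. hamiltonian 2 H' \<longrightarrow>
    C1_field (cut R1 R (cs_field H' lam)) (dcut R1 R (cs_field H' lam)) L \<longrightarrow>
    (\<forall>z. norm (cut R1 R (cs_field H' lam) z - cut R1 R (cs_field H lam) z) \<le> d \<and>
         norm (dcut R1 R (cs_field H' lam) z - dcut R1 R (cs_field H lam) z) \<le> d) \<longrightarrow>
    (\<exists>Q. C1_torus_map Q \<and> lagrangian_graph Q \<and> cs_invariant H' lam (graph_of Q) \<and>
      (\<forall>x. norm (Q x - P x) < delta))"
proof -
  interpret F0: C1_field "cut R1 R (cs_field H lam)" "dcut R1 R (cs_field H lam)" L by (rule field)
  obtain B0 k where B0: "B0 > 0" "\<And>x. norm (D zeta x) \<le> B0" "\<And>x. norm (D P x) \<le> B0"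
    and k: "\<And>x. norm (D Z x) \<le> k"
    using D_bounded D_Z_le by blast
  define B where "B = max B0 k"
  have B: "B > 0" "\<And>x. norm (D zeta x) \<le> B" "\<And>x. norm (D P x) \<le> B" "\<And>x. norm (D Z x) \<le> B"
    using B0 k by (auto simp: B_def le_max_iff_disj)
  define T where "T = (4 + 64 * B * B) / lam"
  have T: "0 < T" using lam B by (simp add: T_def add_pos_pos)
  define q where "q = exp (- (lam * T))"
  have q0: "0 < q" by (simp add: q_def)
  have "4 + 64 * B * B < exp (lam * T)"
    using exp_ge_add_one_self[of "lam * T"] lam by (simp add: T_def)
  then have "(4 + 64 * B * B) * q < exp (lam * T) * q" using q0 by (intro mult_strict_right_mono)
  also have "exp (lam * T) * q = 1" by (simp add: q_def exp_minus)
  finally have q: "4 * q + 64 * (B * B * q) < 1" by (simp add: algebra_simps)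
  have Bq: "0 \<le> B * B * q" using B q0 by simp
  define m where "m = 2 * exp (2 * L * T)"
  have m: "m > 0" by (simp add: m_def)
  define c where "c = 1 / (64 * B * m)"
  have c: "0 < c" using B m by (simp add: c_def)
  have lin: "norm ((Dkinv c (zeta (x + T *\<^sub>R omega)) o\<^sub>L (F0.dflow T (K x) o\<^sub>L Dkap c x)) - pair_blinfun (fst_blinfun, 0)) \<le> 1 / 32" for x
  proof -
    have "B * m * c = 1 / 64" using B m by (simp add: c_def)
    moreover have "B * B * q \<le> 1 / 64" using q q0 by linarith
    ultimately show ?thesis
      using torus_linearization[of T c B x] T c B by (simp add: m_def q_def)
  qed
  obtain bi where bi: "\<And>x. norm (Dkinv c x) \<le> bi" using Dkinv_regular(2)[of c] unfolding bounded_iff by auto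
  obtain bk where bk: "\<And>x. norm (Dkap c x) \<le> bk" using Dkap_regular[of c] unfolding bounded_iff by auto
  have bi0: "0 \<le> bi" using bi[of 0] norm_ge_zero order_trans by blast
  have bk0: "0 \<le> bk" using bk[of 0] norm_ge_zero order_trans by blast
  \<comment> \<open>the derivative may differ from the one on the torus by \<open>1 / 64\<close> through the chart and by \<open>1 / 64\<close> through the flow\<close>
  define e2 where "e2 = 1 / (64 * (m * bk + 1))"
  have e2: "e2 > 0" using m bk0 by (simp add: e2_def add_nonneg_pos)
  obtain e1 where e1: "e1 > 0" and uc: "\<And>x y. dist y x < e1 \<Longrightarrow> dist (Dkinv c y) (Dkinv c x) < e2"
    using Dkinv_regular(1)[of c, unfolded uniformly_continuous_on_def, rule_format, OF e2] by blast
  define e where "e = min (e1 / 2) (1 / (64 * (bi * bk + 1)))"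
  have e: "e > 0" using e1 bi0 bk0 by (simp add: e_def add_nonneg_pos)
  have T0: "0 \<le> T" using T by simp
  obtain d1 where d1: "d1 > 0" and close1: "\<And>F' DF' y z t. C1_field F' DF' L \<Longrightarrow>
    (\<forall>x. norm (F' x - cut R1 R (cs_field H lam) x) \<le> d1 \<and> norm (DF' x - dcut R1 R (cs_field H lam) x) \<le> d1) \<Longrightarrow>
    norm (y - z) \<le> d1 \<Longrightarrow> t \<in> {0..T} \<Longrightarrow>
    norm (C1_field.flow F' t y - F0.flow t z) \<le> e \<and> norm (C1_field.dflow F' DF' t y - F0.dflow t z) \<le> e"
    using flow_perturbation[OF field T0 e] by blast
  define rho where "rho = min d1 (min (R1 - R0) (delta / 2)) / c"
  have rho: "0 < rho" using d1 R01 delta c by (simp add: rho_def)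
  have crho: "c * rho = min d1 (min (R1 - R0) (delta / 2))" using c by (simp add: rho_def)
  \<comment> \<open>the torus may be displaced by a quarter of the width of the strip\<close>
  define e3 where "e3 = rho * c / (4 * (1 + B))"
  have e3: "e3 > 0" using rho c B by (simp add: e3_def)
  obtain d2 where d2: "d2 > 0" and close2: "\<And>F' DF' y z t. C1_field F' DF' L \<Longrightarrow>
    (\<forall>x. norm (F' x - cut R1 R (cs_field H lam) x) \<le> d2 \<and> norm (DF' x - dcut R1 R (cs_field H lam) x) \<le> d2) \<Longrightarrow>
    norm (y - z) \<le> d2 \<Longrightarrow> t \<in> {0..T} \<Longrightarrow>
    norm (C1_field.flow F' t y - F0.flow t z) \<le> e3 \<and> norm (C1_field.dflow F' DF' t y - F0.dflow t z) \<le> e3"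
    using flow_perturbation[OF field T0 e3] by blast
  show ?thesis
  proof (intro exI[of _ "min d1 d2"] conjI allI impI)
    show "0 < min d1 d2" using d1 d2 by simp
    fix H' :: "(real ^ 'n) \<times> (real ^ 'n) \<Rightarrow> real"
    assume H': "hamiltonian 2 H'"
      and field': "C1_field (cut R1 R (cs_field H' lam)) (dcut R1 R (cs_field H' lam)) L"
      and close: "\<forall>z. norm (cut R1 R (cs_field H' lam) z - cut R1 R (cs_field H lam) z) \<le> min d1 d2 \<and>
         norm (dcut R1 R (cs_field H' lam) z - dcut R1 R (cs_field H lam) z) \<le> min d1 d2"
    interpret F: C1_field "cut R1 R (cs_field H' lam)" "dcut R1 R (cs_field H' lam)" L by (rule field')
    have near: "norm ((Dkinv c (fst (F.flow T (zeta x, eta x + c *\<^sub>R p))) o\<^sub>L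
        (F.dflow T (zeta x, eta x + c *\<^sub>R p) o\<^sub>L Dkap c x)) - pair_blinfun (fst_blinfun, 0)) \<le> 1 / 16"
      if p: "norm p \<le> rho" for x p
    proof -
      let ?y = "(zeta x, eta x + c *\<^sub>R p)"
      let ?M' = "F.dflow T ?y" and ?M = "F0.dflow T (K x)"
      let ?x' = "fst (F.flow T ?y)" and ?x = "zeta (x + T *\<^sub>R omega)"
      have "norm (?y - K x) = c * norm p" using c by (simp add: K_def norm_Pair)
      also have "\<dots> \<le> c * rho" using p c by simp
      also have "\<dots> \<le> d1" by (simp add: crho)
      finally have yK: "norm (?y - K x) \<le> d1" .
      have cl: "norm (F.flow T ?y - F0.flow T (K x)) \<le> e" "norm (?M' - ?M) \<le> e"
        using close1[OF field' _ yK, of T] close T by auto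
      have "norm (?x' - ?x) \<le> e"
        using cl(1) norm_fst_le'[of "F.flow T ?y - F0.flow T (K x)"] orbit_on_torus[OF T0, of x] by (simp add: K_def)
      also have "e < e1" using e1 by (simp add: e_def min_def)
      finally have "norm (Dkinv c ?x' - Dkinv c ?x) \<le> e2" using uc[of ?x' ?x] by (simp add: dist_norm)
      moreover have "norm (?M o\<^sub>L Dkap c x) \<le> m * bk"
        using F0.dflow_le[of T T "K x"] T bk m unfolding m_def
        by (intro order_trans[OF norm_blinfun_compose] mult_mono) auto
      ultimately have 1: "norm ((Dkinv c ?x' - Dkinv c ?x) o\<^sub>L (?M o\<^sub>L Dkap c x)) \<le> e2 * (m * bk)"
        using e2 by (intro order_trans[OF norm_blinfun_compose[of "Dkinv c ?x' - Dkinv c ?x"]] mult_mono) auto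
      have "norm ((?M' - ?M) o\<^sub>L Dkap c x) \<le> e * bk"
        using cl(2) bk e by (intro order_trans[OF norm_blinfun_compose] mult_mono) auto
      then have 2: "norm (Dkinv c ?x' o\<^sub>L ((?M' - ?M) o\<^sub>L Dkap c x)) \<le> bi * (e * bk)"
        using bi bi0 by (intro order_trans[OF norm_blinfun_compose[of "Dkinv c ?x'"]] mult_mono) auto
      have "e2 * (m * bk) \<le> 1 / 64" using m bk0 by (simp add: e2_def divide_simps add_nonneg_pos)
      moreover have "bi * (e * bk) \<le> 1 / 64"
      proof -
        have "e * (bi * bk) \<le> 1 / (64 * (bi * bk + 1)) * (bi * bk)"
          using bi0 bk0 by (intro mult_right_mono) (auto simp: e_def)
        also have "\<dots> \<le> 1 / 64" using bi0 bk0 by (simp add: divide_simps add_nonneg_pos)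
        finally show ?thesis by (simp add: mult_ac)
      qed
      moreover have eq: "(Dkinv c ?x' o\<^sub>L (?M' o\<^sub>L Dkap c x)) - pair_blinfun (fst_blinfun, 0) =
          ((Dkinv c ?x o\<^sub>L (?M o\<^sub>L Dkap c x)) - pair_blinfun (fst_blinfun, 0)) +
          ((Dkinv c ?x' o\<^sub>L ((?M' - ?M) o\<^sub>L Dkap c x)) + ((Dkinv c ?x' - Dkinv c ?x) o\<^sub>L (?M o\<^sub>L Dkap c x)))"
        by (simp add: blinfun_compose_diff)
      ultimately show ?thesis
        unfolding eq using lin[of x] 1 2
          norm_triangle_ineq[of "(Dkinv c ?x o\<^sub>L (?M o\<^sub>L Dkap c x)) - pair_blinfun (fst_blinfun, 0)"
            "(Dkinv c ?x' o\<^sub>L ((?M' - ?M) o\<^sub>L Dkap c x)) + ((Dkinv c ?x' - Dkinv c ?x) o\<^sub>L (?M o\<^sub>L Dkap c x))"]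
          norm_triangle_ineq[of "Dkinv c ?x' o\<^sub>L ((?M' - ?M) o\<^sub>L Dkap c x)" "(Dkinv c ?x' - Dkinv c ?x) o\<^sub>L (?M o\<^sub>L Dkap c x)"]
        by linarith
    qed
    have base: "norm ((1 / c) *\<^sub>R (snd y - P (fst y))) \<le> rho / 4" if y: "y = F.flow T (K x)" for x y
    proof -
      let ?y0 = "K (x + T *\<^sub>R omega)"
      have "norm (y - ?y0) \<le> e3"
        using close2[OF field', of "K x" "K x" T] close T d2 orbit_on_torus[OF T0, of x] by (auto simp: y)
      then have f: "norm (fst y - fst ?y0) \<le> e3" and s: "norm (snd y - snd ?y0) \<le> e3"
        using norm_fst_le'[of "y - ?y0"] norm_snd_le'[of "y - ?y0"] by auto
      have "norm (P (fst y) - P (fst ?y0)) \<le> B * e3"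
        using order_trans[OF C1_Lipschitz[OF P B(3)] mult_left_mono[OF f]] B by simp
      moreover have "P (fst ?y0) = snd ?y0" by (simp add: K_def eta_eq)
      ultimately have "norm (snd y - P (fst y)) \<le> (1 + B) * e3"
        using s norm_triangle_ineq4[of "snd y - snd ?y0" "P (fst y) - snd ?y0"] by (simp add: distrib_right)
      also have "\<dots> = c * (rho / 4)" using B by (simp add: e3_def field_simps)
      finally have "norm (snd y - P (fst y)) / c \<le> rho / 4" using c by (simp add: pos_divide_le_eq mult.commute)
      moreover have "norm ((1 / c) *\<^sub>R (snd y - P (fst y))) = norm (snd y - P (fst y)) / c"
        unfolding norm_scaleR using c by simp
      ultimately show ?thesis by linarith
    qed
    interpret PK: perturbed_kam H lam omega P zeta eta R0 R1 R L H' T c rho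
    proof
      show "hamiltonian 2 H'" by (rule H')
      show "R0 + c * rho \<le> R1" unfolding crho by simp
      show "4 * exp (- (lam * T)) < 1" using q Bq unfolding q_def by linarith
    qed (use T c rho near base in auto)
    have "c * rho < delta" unfolding crho using delta by (simp add: min_def)
    then show "\<exists>Q. C1_torus_map Q \<and> lagrangian_graph Q \<and> cs_invariant H' lam (graph_of Q) \<and> (\<forall>x. norm (Q x - P x) < delta)"
      using PK.invariant_graph order_le_less_trans by blast
  qed
qed

lemma hamiltonian_antimono: "hamiltonian n H \<Longrightarrow> k \<le> n \<Longrightarrow> hamiltonian k H"
  unfolding hamiltonian_def using C_class_antimono by blast

theorem theorem5:
  fixes H :: "(real ^ 'n) \<times> (real ^ 'n) \<Rightarrow> real"
    and P :: "real ^ 'n \<Rightarrow> real ^ 'n"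
    and omega :: "real ^ 'n"
    and lam R delta :: real
    and r :: nat
  assumes "lam > 0"
    and "r \<ge> 2"
    and "hamiltonian r H"
    and "tonelli H"
    and "kam_torus H lam omega P"
    and "\<And>x. norm (P x) < R"
    and "delta > 0"
  shows "\<exists>eps0 > 0. \<forall>H1 eps.
           hamiltonian r H1 \<and> C2_norm_le H1 {(x, p). norm p \<le> R} 1 \<and>
           0 < eps \<and> eps \<le> eps0 \<and> tonelli (\<lambda>z. H z + eps * H1 z) \<longrightarrow>
           (\<exists>Q. C1_torus_map Q \<and> lagrangian_graph Q \<and>
                cs_invariant (\<lambda>z. H z + eps * H1 z) lam (graph_of Q) \<and>
                (\<forall>x. norm (Q x - P x) < delta))"
proof -
  have H: "hamiltonian 2 H" using assms(2,3) hamiltonian_antimono by blast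
  have P: "C_class 1 P" and P_period: "\<And>x m. int_vec m \<Longrightarrow> P (x + m) = P x"
    using assms(5) unfolding kam_torus_def C1_torus_map_def by blast+
  obtain zeta eta where emb: "C1_torus_embedding zeta eta"
    and rng: "range (\<lambda>x. (zeta x, eta x)) = graph_of P"
    and rot: "\<And>x t. cs_flow H lam t (zeta x, eta x) (zeta (x + t *\<^sub>R omega), eta (x + t *\<^sub>R omega))"
    using assms(5) unfolding kam_torus_def by blast
  have zeta: "C_class 1 zeta" and eta: "C_class 1 eta"
    and zeta_shift: "\<And>x m. int_vec m \<Longrightarrow> zeta (x + m) = zeta x + m"
    and imm: "\<And>x. inj (\<lambda>v. (frechet_derivative zeta (at x) v, frechet_derivative eta (at x) v))"
    and inj: "\<And>x y. int_vec (zeta x - zeta y) \<Longrightarrow> eta x = eta y \<Longrightarrow> int_vec (x - y)"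
    using emb unfolding C1_torus_embedding_def by blast+
  have eta_eq: "eta x = P (zeta x)" for x
  proof -
    have "(zeta x, eta x) \<in> graph_of P" using rng by blast
    then show ?thesis by (auto simp: graph_of_def)
  qed
  have "bij zeta"
  proof (rule bijI)
    show "inj zeta"
    proof (rule injI)
      fix x y assume xy: "zeta x = zeta y"
      then have "int_vec (zeta x - zeta y)" "eta x = eta y" by (simp_all add: eta_eq int_vec_def)
      then have "int_vec (x - y)" by (rule inj)
      from zeta_shift[OF this, of y] xy show "x = y" by simp
    qed
    have "y \<in> range zeta" for y
    proof -
      have "(y, P y) \<in> range (\<lambda>x. (zeta x, eta x))" unfolding rng graph_of_def by blast
      then show ?thesis by blast
    qed
    then show "surj zeta" by blast
  qed
  \<comment> \<open>over a graph, an immersion of the torus projects to an immersion of the base\<close>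
  have zeta_imm: "v = 0" if v: "D zeta x v = 0" for x v
  proof -
    have "(eta has_derivative (\<lambda>v. D P (zeta x) (D zeta x v))) (at x)"
      using has_derivative_compose[OF C1_D(1)[OF zeta] C1_D(1)[OF P]] by (simp add: eta_eq[abs_def])
    from has_derivative_unique[OF this C1_D(1)[OF eta]]
    have "D eta x v = 0" using v by (metis blinfun.zero_right)
    then have "(D zeta x v, D eta x v) = (D zeta x 0, D eta x 0)" using v by simp
    then show ?thesis
      using imm[of x] D_apply[OF C1_differentiable[OF zeta]] D_apply[OF C1_differentiable[OF eta]]
      by (auto dest!: injD)
  qed
  have ne: "cbox 0 1 \<noteq> ({} :: (real ^ 'n) set)"
    using int_vec_reduce[of "0 :: real ^ 'n"] by blast
  have "continuous_on (cbox 0 1) (\<lambda>x. norm (P x))"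
    by (intro continuous_on_norm C1_D(3)[OF P])
  from continuous_attains_sup[OF compact_cbox ne this]
  obtain x0 where max: "\<And>x. x \<in> cbox 0 1 \<Longrightarrow> norm (P x) \<le> norm (P x0)" by blast
  define R0 where "R0 = norm (P x0)"
  have P_le: "norm (P x) \<le> R0" for x
  proof -
    obtain m where m: "int_vec m" "x + m \<in> cbox 0 1" using int_vec_reduce by blast
    show ?thesis using max[OF m(2)] P_period[OF m(1)] by (simp add: R0_def)
  qed
  \<comment> \<open>by compactness the torus stays away from the boundary \<open>norm p = R\<close>\<close>
  define R1 where "R1 = (R0 + R) / 2"
  have R: "0 \<le> R0" "R0 < R1" "R1 < R" using assms(6)[of x0] by (auto simp: R1_def R0_def)
  then have "0 \<le> R1" by simp
  from perturbed_cut_field[OF H this R(3), of lam]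
  obtain L C where field: "C1_field (cut R1 R (cs_field H lam)) (dcut R1 R (cs_field H lam)) L"
    and pert: "\<forall>H1 e. hamiltonian 2 H1 \<longrightarrow> C2_norm_le H1 {(x, p). norm p \<le> R} 1 \<longrightarrow> 0 < e \<longrightarrow> e \<le> 1 \<longrightarrow>
      (let X = cs_field (\<lambda>z. H z + e * H1 z) lam in C1_field (cut R1 R X) (dcut R1 R X) L \<and>
      (\<forall>z. norm (cut R1 R X z - cut R1 R (cs_field H lam) z) \<le> e * C \<and>
           norm (dcut R1 R X z - dcut R1 R (cs_field H lam) z) \<le> e * C))"
    by (elim exE conjE)
  interpret kam_setting H lam omega P zeta eta R0 R1 R L
    by (rule kam_setting.intro) (fact assms(1) H R P_le P P_period zeta zeta_shift \<open>bij zeta\<close> zeta_imm eta eta_eq rot field)+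
  obtain d where d: "d > 0" and pers: "\<And>H'. hamiltonian 2 H' \<Longrightarrow>
    C1_field (cut R1 R (cs_field H' lam)) (dcut R1 R (cs_field H' lam)) L \<Longrightarrow>
    (\<forall>z. norm (cut R1 R (cs_field H' lam) z - cut R1 R (cs_field H lam) z) \<le> d \<and>
         norm (dcut R1 R (cs_field H' lam) z - dcut R1 R (cs_field H lam) z) \<le> d) \<Longrightarrow>
    (\<exists>Q. C1_torus_map Q \<and> lagrangian_graph Q \<and> cs_invariant H' lam (graph_of Q) \<and>
      (\<forall>x. norm (Q x - P x) < delta))"
    using persistence[OF assms(7)] by blast
  show ?thesis
  proof (intro exI[of _ "min 1 (d / (\<bar>C\<bar> + 1))"] conjI allI impI; (elim conjE)?)
    show "0 < min 1 (d / (\<bar>C\<bar> + 1))" using d by (simp add: add_nonneg_pos)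
    fix H1 :: "(real ^ 'n) \<times> (real ^ 'n) \<Rightarrow> real" and eps :: real
    assume H1: "hamiltonian r H1" and C2: "C2_norm_le H1 {(x, p). norm p \<le> R} 1"
      and eps: "0 < eps" "eps \<le> min 1 (d / (\<bar>C\<bar> + 1))"
    have H12: "hamiltonian 2 H1" using H1 assms(2) hamiltonian_antimono by blast
    let ?H' = "\<lambda>z. H z + eps * H1 z"
    have H': "hamiltonian 2 ?H'"
      using H H12 C_class_add_scaled[of 2 H H1 eps] by (simp add: hamiltonian_def)
    have "eps * C \<le> eps * (\<bar>C\<bar> + 1)" using eps by (intro mult_left_mono) auto
    also have "\<dots> \<le> d" using eps by (simp add: pos_le_divide_eq add_nonneg_pos)
    finally have small: "eps * C \<le> d" .
    have le1: "eps \<le> 1" using eps by simp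
    note p = pert[rule_format, OF H12 C2 eps(1) le1, unfolded Let_def]
    show "\<exists>Q. C1_torus_map Q \<and> lagrangian_graph Q \<and> cs_invariant ?H' lam (graph_of Q) \<and> (\<forall>x. norm (Q x - P x) < delta)"
    proof (rule pers[OF H'])
      show "C1_field (cut R1 R (cs_field ?H' lam)) (dcut R1 R (cs_field ?H' lam)) L" using p by (rule conjunct1)
      show "\<forall>z. norm (cut R1 R (cs_field ?H' lam) z - cut R1 R (cs_field H lam) z) \<le> d \<and>
         norm (dcut R1 R (cs_field ?H' lam) z - dcut R1 R (cs_field H lam) z) \<le> d"
        using conjunct2[OF p] order_trans[OF _ small] by blast
    qed
  qed
qed

end
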